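(* Let $p = (p_t)_{t \ge 0}$ be a process of the form $$p_t = p_0 + \int_0^t \mu_u \,\mathrm{d}u + \int_0^t \sigma_u \,\mathrm{d}W_u, \qquad t \ge 0,$$ where $\mu = (\mu_t)_{t\ge 0}$ is locally bounded and predictable, $\sigma = (\sigma_t)_{t \ge 0}$ is càdlàg, and $W = (W_t)_{t\ge 0}$ is a standard Brownian motion. For $n \in \mathbb{N}$ define $$RRV^{\Delta} = \frac{1}{\lambda_2} \sum_{i=1}^n s_{p,i,n}^2 , \qquad s_{p,i,n} = \sup_{(i-1)/n \le s,t \le i/n} \{ p_t - p_s \}.$$ Then, as $n \to \infty$, $$RRV^{\Delta} \overset{p}{\to} IV = \int_0^1 \sigma_u^2 \,\mathrm{d}u ,$$ where $\overset{p}{\to}$ denotes convergence in probability.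
   Context: All processes are defined on a filtered probability space $(\Omega, \mathcal{F}, (\mathcal{F}_t)_{t\ge 0}, \mathbb{P})$; $p$ is adapted, $W$ is a Brownian motion with respect to $(\mathcal{F}_t)$, and $\sigma$ is adapted. The constant $\lambda_2$ is the second moment of the range of a standard Brownian motion over the unit interval: for $r \geq 1$, $\lambda_r = \mathbb{E}[s_W^r]$ with $s_W = \sup_{0 \le s,t \le 1}\{W_t - W_s\}$. The sampling period $[0,1]$ is partitioned by $t_i = i/n$, with $\Delta = 1/n$. *)

theory Defs
  imports "HOL-Probability.Probability"
begin

text \<open>
  The filtration is indexed by all reals so that the library locale can be used. Only the indices
  \<open>t \<ge> 0\<close> carry content: a filtration on \<open>[0,\<infinity>)\<close> extends by \<open>F t = F 0\<close> for \<open>t < 0\<close>, and no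
  definition below otherwise depends on \<open>F t\<close> for \<open>t < 0\<close>. Likewise processes are functions
  \<open>real \<Rightarrow> 'a \<Rightarrow> real\<close> whose values at negative times are irrelevant. Neither completeness nor
  right-continuity of the filtration is assumed. Path properties that are customarily required
  up to a null set are stated almost everywhere.
\<close>

locale filtered_prob_space = prob_space M + filtration "space M" F
  for M :: "'a measure" and F :: "real \<Rightarrow> 'a measure" +
  assumes sets_F_subset: "sets (F t) \<subseteq> sets M"

definition adapted :: "(real \<Rightarrow> 'a measure) \<Rightarrow> (real \<Rightarrow> 'a \<Rightarrow> real) \<Rightarrow> bool" where
  "adapted F X \<longleftrightarrow> (\<forall>t\<ge>0. X t \<in> borel_measurable (F t))"

definition predictable_sigma :: "(real \<Rightarrow> 'a measure) \<Rightarrow> (real \<times> 'a) measure" where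
  "predictable_sigma F = sigma ({0..} \<times> space (F 0))
     ({{0} \<times> A | A. A \<in> sets (F 0)} \<union>
      {{s<..t} \<times> A | s t A. 0 \<le> s \<and> s \<le> t \<and> A \<in> sets (F s)})"

definition predictable :: "(real \<Rightarrow> 'a measure) \<Rightarrow> (real \<Rightarrow> 'a \<Rightarrow> real) \<Rightarrow> bool" where
  "predictable F X \<longleftrightarrow> (\<lambda>(t, \<omega>). X t \<omega>) \<in> borel_measurable (predictable_sigma F)"

text \<open>
  There is a localizing sequence of stopping times along which the stopped process is bounded by
  constants; the restriction to \<open>{T n > 0}\<close> allows an unbounded initial value. Finite stopping
  times suffice, since \<open>T n\<close> may be replaced by \<open>min (T n) n\<close>.
\<close>

definition locally_bounded ::
    "'a measure \<Rightarrow> (real \<Rightarrow> 'a measure) \<Rightarrow> (real \<Rightarrow> 'a \<Rightarrow> real) \<Rightarrow> bool" where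
  "locally_bounded M F X \<longleftrightarrow> (\<exists>(T :: nat \<Rightarrow> 'a \<Rightarrow> real) (K :: nat \<Rightarrow> real).
     (\<forall>n. stopping_time F (T n) \<and> (\<forall>\<omega>\<in>space M. 0 \<le> T n \<omega>)) \<and>
     (AE \<omega> in M. incseq (\<lambda>n. T n \<omega>) \<and> filterlim (\<lambda>n. T n \<omega>) at_top sequentially) \<and>
     (\<forall>n. AE \<omega> in M. 0 < T n \<omega> \<longrightarrow> (\<forall>t\<ge>0. \<bar>X (min t (T n \<omega>)) \<omega>\<bar> \<le> K n)))"

definition cadlag :: "'a measure \<Rightarrow> (real \<Rightarrow> 'a \<Rightarrow> real) \<Rightarrow> bool" where
  "cadlag M X \<longleftrightarrow> (AE \<omega> in M.
     (\<forall>t\<ge>0. ((\<lambda>u. X u \<omega>) \<longlongrightarrow> X t \<omega>) (at_right t)) \<and>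
     (\<forall>t>0. \<exists>l. ((\<lambda>u. X u \<omega>) \<longlongrightarrow> l) (at_left t)))"

definition continuous_process :: "'a measure \<Rightarrow> (real \<Rightarrow> 'a \<Rightarrow> real) \<Rightarrow> bool" where
  "continuous_process M X \<longleftrightarrow> (AE \<omega> in M. continuous_on {0..} (\<lambda>t. X t \<omega>))"

definition brownian_motion ::
    "'a measure \<Rightarrow> (real \<Rightarrow> 'a measure) \<Rightarrow> (real \<Rightarrow> 'a \<Rightarrow> real) \<Rightarrow> bool" where
  "brownian_motion M F W \<longleftrightarrow>
     adapted F W \<and> continuous_process M W \<and> (AE \<omega> in M. W 0 \<omega> = 0) \<and>
     (\<forall>s t. 0 \<le> s \<and> s < t \<longrightarrow>
        distributed M lborel (\<lambda>\<omega>. W t \<omega> - W s \<omega>) (normal_density 0 (sqrt (t - s))) \<and>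
        prob_space.indep_set M (sets (F s))
          {(\<lambda>\<omega>. W t \<omega> - W s \<omega>) -` B \<inter> space M | B. B \<in> sets borel})"

text \<open>
  Suprema over intervals are taken pathwise, hence for processes with almost surely continuous
  paths they are measurable only with respect to the completion of \<open>M\<close>. Measurability is part of
  the definition, because \<open>measure\<close> vanishes on non-measurable sets.
\<close>

definition tendsto_in_prob ::
    "'a measure \<Rightarrow> (nat \<Rightarrow> 'a \<Rightarrow> real) \<Rightarrow> ('a \<Rightarrow> real) \<Rightarrow> bool" where
  "tendsto_in_prob M X Y \<longleftrightarrow>
     (\<forall>n. X n \<in> borel_measurable (completion M)) \<and> Y \<in> borel_measurable (completion M) \<and>
     (\<forall>\<epsilon>>0. (\<lambda>n. measure (completion M) {\<omega> \<in> space M. \<epsilon> < \<bar>X n \<omega> - Y \<omega>\<bar>}) \<longlonglongrightarrow> 0)"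

text \<open>
  Simple integrands \<open>H\<^sub>t = \<Sum>j<k. \<xi>\<^sub>j 1{s\<^sub>j < t \<le> s\<^sub>j\<^sub>+\<^sub>1}\<close> with \<open>0 \<le> s\<^sub>0 \<le> \<dots> \<le> s\<^sub>k\<close> and bounded
  \<open>F s\<^sub>j\<close>-measurable \<open>\<xi>\<^sub>j\<close>.
\<close>

definition simple_integrand ::
    "'a measure \<Rightarrow> (real \<Rightarrow> 'a measure) \<Rightarrow> nat \<Rightarrow> (nat \<Rightarrow> real) \<Rightarrow> (nat \<Rightarrow> 'a \<Rightarrow> real) \<Rightarrow> bool" where
  "simple_integrand M F k s \<xi> \<longleftrightarrow> 0 \<le> s 0 \<and> mono_on {..k} s \<and>
     (\<forall>j<k. \<xi> j \<in> borel_measurable (F (s j)) \<and> (\<exists>C. \<forall>\<omega>\<in>space M. \<bar>\<xi> j \<omega>\<bar> \<le> C))"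

definition simple_process ::
    "nat \<Rightarrow> (nat \<Rightarrow> real) \<Rightarrow> (nat \<Rightarrow> 'a \<Rightarrow> real) \<Rightarrow> real \<Rightarrow> 'a \<Rightarrow> real" where
  "simple_process k s \<xi> t \<omega> = (\<Sum>j<k. \<xi> j \<omega> * indicator {s j<..s (Suc j)} t)"

definition simple_integral ::
    "(real \<Rightarrow> 'a \<Rightarrow> real) \<Rightarrow> nat \<Rightarrow> (nat \<Rightarrow> real) \<Rightarrow> (nat \<Rightarrow> 'a \<Rightarrow> real) \<Rightarrow> real \<Rightarrow> 'a \<Rightarrow> real" where
  "simple_integral W k s \<xi> t \<omega> =
     (\<Sum>j<k. \<xi> j \<omega> * (W (min t (s (Suc j))) \<omega> - W (min t (s j)) \<omega>))"

text \<open>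
  \<open>ito_integral M F W \<sigma> I\<close>: the process \<open>I\<close> is (a version of) \<open>\<integral>\<^sub>0 \<sigma> dW\<close>, for \<open>\<sigma>\<close> with
  \<open>\<integral>\<^sub>0\<^sup>T \<sigma>\<^sup>2 du < \<infinity>\<close> almost surely. It is the continuous process that is the limit, uniformly on
  compacts in probability, of the integrals of simple integrands approximating \<open>\<sigma>\<close> in
  \<open>L\<^sup>2([0,T])\<close> in probability. This determines \<open>I\<close> up to indistinguishability; being such a limit,
  \<open>I\<close> is adapted to the completed filtration.
\<close>

definition ito_integral ::
    "'a measure \<Rightarrow> (real \<Rightarrow> 'a measure) \<Rightarrow> (real \<Rightarrow> 'a \<Rightarrow> real) \<Rightarrow> (real \<Rightarrow> 'a \<Rightarrow> real) \<Rightarrow>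
     (real \<Rightarrow> 'a \<Rightarrow> real) \<Rightarrow> bool" where
  "ito_integral M F W \<sigma> I \<longleftrightarrow>
     (AE \<omega> in M. \<forall>T\<ge>0. set_integrable lborel {0..T} (\<lambda>u. (\<sigma> u \<omega>)\<^sup>2)) \<and>
     continuous_process M I \<and>
     (\<exists>(k :: nat \<Rightarrow> nat) (s :: nat \<Rightarrow> nat \<Rightarrow> real) (\<xi> :: nat \<Rightarrow> nat \<Rightarrow> 'a \<Rightarrow> real).
        (\<forall>m. simple_integrand M F (k m) (s m) (\<xi> m)) \<and>
        (\<forall>T\<ge>0.
           tendsto_in_prob M
             (\<lambda>m \<omega>. LBINT u:{0..T}. (simple_process (k m) (s m) (\<xi> m) u \<omega> - \<sigma> u \<omega>)\<^sup>2)
             (\<lambda>\<omega>. 0) \<and>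
           tendsto_in_prob M
             (\<lambda>m \<omega>. SUP t\<in>{0..T}. \<bar>simple_integral W (k m) (s m) (\<xi> m) t \<omega> - I t \<omega>\<bar>)
             (\<lambda>\<omega>. 0)))"

definition path_range :: "(real \<Rightarrow> 'a \<Rightarrow> real) \<Rightarrow> real \<Rightarrow> real \<Rightarrow> 'a \<Rightarrow> real" where
  "path_range X a b \<omega> = (SUP (s, t) \<in> {a..b} \<times> {a..b}. X t \<omega> - X s \<omega>)"

text \<open>
  The moments \<open>\<lambda>\<^sub>r\<close>, \<open>r \<ge> 1\<close>, of the range of a Brownian motion \<open>W\<close> over the unit interval.
\<close>

definition range_moment :: "'a measure \<Rightarrow> (real \<Rightarrow> 'a \<Rightarrow> real) \<Rightarrow> real \<Rightarrow> real" where
  "range_moment M W r = (\<integral>\<omega>. path_range W 0 1 \<omega> powr r \<partial>completion M)"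

definition realized_range_variance ::
    "real \<Rightarrow> (real \<Rightarrow> 'a \<Rightarrow> real) \<Rightarrow> nat \<Rightarrow> 'a \<Rightarrow> real" where
  "realized_range_variance lam2 p n \<omega> =
     1 / lam2 * (\<Sum>i=1..n. (path_range p ((real i - 1) / real n) (real i / real n) \<omega>)\<^sup>2)"

definition integrated_variance :: "(real \<Rightarrow> 'a \<Rightarrow> real) \<Rightarrow> 'a \<Rightarrow> real" where
  "integrated_variance \<sigma> \<omega> = (LBINT u:{0..1}. (\<sigma> u \<omega>)\<^sup>2)"

end

theory Submission
  imports Defs
begin

text \<open>
  On continuous paths, the root of the sum of squared ranges over the blocks \<open>[(i-1)/n, i/n]\<close> is a
  seminorm \<open>q\<close>. Hence \<open>q p\<close> differs from \<open>q J\<close>, with \<open>J\<close> the integral of a simple integrand \<open>H\<close>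
  close to \<open>\<sigma>\<close>, by at most \<open>q\<close> of the drift, which is of order \<open>1/sqrt n\<close> because \<open>\<mu>\<close> is bounded
  along paths, plus \<open>q (I - J)\<close>. The latter is small uniformly in \<open>n\<close> by a Lenglart-type inequality:
  stop the integrand once its energy exceeds \<open>\<delta>\<close> and apply Doob's \<open>L\<^sup>2\<close> inequality on every block.
  For simple \<open>H\<close>, all but boundedly many blocks contribute \<open>H\<^sup>2\<close> times a squared range of \<open>W\<close>, and
  these ranges are, by scaling, independent with the same law, so a truncated law of large numbers
  gives the limit \<open>\<lambda>\<^sub>2 \<integral>H\<^sup>2\<close>. All of this takes place in the completion of the probability space.
\<close>

section \<open>Oscillation over a set\<close>

text \<open>The energy of \<sigma> may have infinite expectation, so no isometry applies to \<sigma>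
  itself. All estimates concern probabilities, and expectations are taken only of integrands cut off
  to have energy at most \<open>d\<close>. The energy through a grid interval is known at its left
  end, so the cut-off is adapted and does not overshoot \<open>d\<close>.

  \<open>I\<close> is known only as a uniform limit in probability, and a uniform error
  \<open>r\<close> costs up to \<open>2 * r * sqrt n\<close> in the seminorm; closeness of
  \<open>I\<close> to a fixed approximant thus says nothing for large n. Two approximants are used:
  \<open>J m\<close>, fixed before n, and \<open>J l\<close>, chosen after n and so close to
  \<open>I\<close> that \<open>sqrt n\<close> does no harm. Their difference is again elementary,
  and the maximal estimate for it is free of n.

  The constant 16 combines Doob's 4 with a factor 4 from bounding a range by the maxima of a process
  and of its negative. It also bounds the second moment of the Brownian range. Truncation in the law
  of large numbers is there because a variance of the squared range would involve a fourth moment,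
  while truncated variables are bounded.\<close>

definition osc :: "('b \<Rightarrow> real) \<Rightarrow> 'b set \<Rightarrow> real" where
  "osc f A = (SUP (s, t) \<in> A \<times> A. f t - f s)"

lemma path_range_osc: "path_range X a b w = osc (\<lambda>t. X t w) {a..b}"
  by (simp add: path_range_def osc_def)

text \<open>The supremum of an unbounded set of reals has no useful value, so using
  \<open>osc\<close> as an upper bound requires bounded values; continuous paths on compact blocks
  provide them.\<close>

lemma osc_bdd:
  fixes f :: "'b \<Rightarrow> real"
  assumes "bounded (f ` A)" shows "bdd_above ((\<lambda>(s, t). f t - f s) ` (A \<times> A))"
proof -
  obtain B where B: "\<And>x. x \<in> A \<Longrightarrow> \<bar>f x\<bar> \<le> B"
    using assms by (auto simp: bounded_iff)
  show ?thesis
  proof (rule bdd_aboveI[of _ "2 * B"], safe)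
    fix s t assume "s \<in> A" "t \<in> A"
    then show "f t - f s \<le> 2 * B" using B[of s] B[of t] by linarith
  qed
qed

lemma osc_upper: "bounded (f ` A) \<Longrightarrow> s \<in> A \<Longrightarrow> t \<in> A \<Longrightarrow> f t - f s \<le> osc f A"
  unfolding osc_def by (rule cSUP_upper2[OF osc_bdd, of _ _ "(s, t)"]) auto

lemma osc_least: "A \<noteq> {} \<Longrightarrow> (\<And>s t. s \<in> A \<Longrightarrow> t \<in> A \<Longrightarrow> f t - f s \<le> c) \<Longrightarrow> osc f A \<le> c"
  unfolding osc_def by (rule cSUP_least) auto

lemma osc_nonneg: "bounded (f ` A) \<Longrightarrow> A \<noteq> {} \<Longrightarrow> 0 \<le> osc f A"
  using osc_upper[of f A] by fastforce

lemma osc_cong: "(\<And>s t. s \<in> A \<Longrightarrow> t \<in> A \<Longrightarrow> f t - f s = g t - g s) \<Longrightarrow> osc f A = osc g A"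
  unfolding osc_def by (rule SUP_cong) auto

lemma osc_mono:
  assumes "bounded (f ` B)" "A \<subseteq> B" "A \<noteq> {}" shows "osc f A \<le> osc f B"
  using assms by (intro osc_least osc_upper) auto

lemma osc_add:
  assumes "bounded (f ` A)" "bounded (g ` A)" "A \<noteq> {}"
  shows "osc (\<lambda>t. f t + g t) A \<le> osc f A + osc g A"
proof (rule osc_least[OF assms(3)])
  fix s t assume "s \<in> A" "t \<in> A"
  with osc_upper[OF assms(1) this] osc_upper[OF assms(2) this]
  show "f t + g t - (f s + g s) \<le> osc f A + osc g A" by linarith
qed

lemma osc_upper_abs: "bounded (f ` A) \<Longrightarrow> s \<in> A \<Longrightarrow> t \<in> A \<Longrightarrow> \<bar>f t - f s\<bar> \<le> osc f A"
  using osc_upper[of f A s t] osc_upper[of f A t s] by linarith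

lemma osc_cmult:
  assumes b: "bounded (f ` A)" and A: "A \<noteq> {}"
  shows "osc (\<lambda>t. c * f t) A = \<bar>c\<bar> * osc f A"
proof (rule antisym)
  have abs: "\<bar>c * f t - c * f s\<bar> = \<bar>c\<bar> * \<bar>f t - f s\<bar>" for s t
    by (simp add: abs_mult[symmetric] right_diff_distrib)
  show "osc (\<lambda>t. c * f t) A \<le> \<bar>c\<bar> * osc f A"
  proof (rule osc_least[OF A])
    fix s t assume "s \<in> A" "t \<in> A"
    then have "\<bar>c\<bar> * \<bar>f t - f s\<bar> \<le> \<bar>c\<bar> * osc f A" using osc_upper_abs[OF b] by (intro mult_left_mono) auto
    then show "c * f t - c * f s \<le> \<bar>c\<bar> * osc f A" unfolding abs[symmetric] by linarith
  qed
  have b': "bounded ((\<lambda>t. c * f t) ` A)"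
    using bounded_scaling[OF b, of c] by (simp add: image_image)
  show "\<bar>c\<bar> * osc f A \<le> osc (\<lambda>t. c * f t) A"
  proof (cases "c = 0")
    case True then show ?thesis using osc_nonneg[OF b' A] by simp
  next
    case False
    have "osc f A \<le> osc (\<lambda>t. c * f t) A / \<bar>c\<bar>"
    proof (rule osc_least[OF A])
      fix s t assume "s \<in> A" "t \<in> A"
      from osc_upper_abs[OF b' this] have "\<bar>f t - f s\<bar> \<le> osc (\<lambda>t. c * f t) A / \<bar>c\<bar>"
        unfolding abs using False by (simp add: field_simps)
      then show "f t - f s \<le> osc (\<lambda>t. c * f t) A / \<bar>c\<bar>" by linarith
    qed
    with False show ?thesis by (simp add: field_simps)
  qed
qed

lemma osc_le_two_sup:
  assumes "A \<noteq> {}" "\<And>x. x \<in> A \<Longrightarrow> \<bar>f x\<bar> \<le> c" shows "osc f A \<le> 2 * c"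
proof (rule osc_least[OF assms(1)])
  fix s t assume "s \<in> A" "t \<in> A"
  then show "f t - f s \<le> 2 * c" using assms(2)[of s] assms(2)[of t] by linarith
qed

section \<open>Finite grids and the range of a continuous path\<close>

lemma osc_measurable_finite:
  assumes "finite A" "\<And>t. t \<in> A \<Longrightarrow> X t \<in> borel_measurable M"
  shows "(\<lambda>w. osc (\<lambda>t. X t w) A) \<in> borel_measurable M"
  unfolding osc_def case_prod_beta using assms
  by (intro borel_measurable_cSUP borel_measurable_diff) (auto intro!: countable_finite)

text \<open>An affine image of \<open>{..2 ^ l}\<close>, so that \<open>osc_image\<close> turns a
  grid range into a range over indices, and neighbouring points have the common distance that the
  scaling of Brownian increments needs.\<close>

definition dyad :: "real \<Rightarrow> real \<Rightarrow> nat \<Rightarrow> real set" where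
  "dyad a b l = (\<lambda>k::nat. a + (b - a) * real k / 2 ^ l) ` {..2 ^ l}"

lemma dyad_finite [simp]: "finite (dyad a b l)" by (simp add: dyad_def)

lemma dyad_nonempty [simp]: "dyad a b l \<noteq> {}" by (auto simp: dyad_def)

lemma dyad_subset: assumes "a \<le> b" shows "dyad a b l \<subseteq> {a..b}"
proof
  fix x assume "x \<in> dyad a b l"
  then obtain k where k: "k \<le> 2 ^ l" "x = a + (b - a) * (real k / 2 ^ l)" by (auto simp: dyad_def)
  have "real k \<le> 2 ^ l" using k(1) by (metis of_nat_le_iff of_nat_numeral of_nat_power)
  then have "real k / 2 ^ l \<le> 1" by simp
  then have "(b - a) * (real k / 2 ^ l) \<le> (b - a) * 1" using assms by (intro mult_left_mono) auto
  moreover have "0 \<le> (b - a) * (real k / 2 ^ l)" using assms by simp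
  ultimately show "x \<in> {a..b}" using k by auto
qed

lemma dyad_dense:
  assumes "a \<le> t" "t \<le> b" shows "\<exists>x\<in>dyad a b l. \<bar>t - x\<bar> \<le> (b - a) / 2 ^ l"
proof (cases "a = b")
  case True then show ?thesis using assms by (auto simp: dyad_def)
next
  case False
  with assms have ab: "a < b" by simp
  define y where "y = (t - a) * 2 ^ l / (b - a)"
  define k where "k = nat \<lfloor>y\<rfloor>"
  have y: "0 \<le> y" "y \<le> 2 ^ l" using assms ab by (auto simp: y_def field_simps)
  have ky: "real k \<le> y" "y < real k + 1" using y unfolding k_def by linarith+
  have "real k \<le> 2 ^ l" using y ky by linarith
  then have kl: "k \<le> 2 ^ l" by (metis of_nat_le_iff of_nat_numeral of_nat_power)
  have t: "t = a + (b - a) * y / 2 ^ l" using ab by (simp add: y_def)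
  have "t - (a + (b - a) * real k / 2 ^ l) = (b - a) * (y - real k) / 2 ^ l"
    unfolding t by (simp add: field_simps)
  also have "\<bar>\<dots>\<bar> \<le> (b - a) / 2 ^ l"
    using ab ky by (simp add: abs_mult abs_divide divide_right_mono)
  finally have "\<bar>t - (a + (b - a) * real k / 2 ^ l)\<bar> \<le> (b - a) / 2 ^ l" .
  with kl show ?thesis unfolding dyad_def by (intro bexI[of _ "a + (b - a) * real k / 2 ^ l"]) auto
qed

text \<open>By uniform continuity, moving both times to grid points changes a difference of values
  by less than \<open>2 * (e / 4)\<close>. The sets \<open>A l\<close> only have to contain the
  dyadic grid, which leaves room for the break points of an integrand.\<close>

lemma osc_grid_tendsto:
  assumes f: "continuous_on {a..b} f" and ab: "a \<le> b"
    and A: "\<And>l. dyad a b l \<subseteq> A l" "\<And>l. A l \<subseteq> {a..b}"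
  shows "(\<lambda>l. osc f (A l)) \<longlonglongrightarrow> osc f {a..b}"
proof (rule LIMSEQ_I)
  fix e :: real assume e: "0 < e"
  have b: "bounded (f ` {a..b})"
    using compact_continuous_image[OF f] compact_imp_bounded by auto
  have "uniformly_continuous_on {a..b} f" by (rule compact_uniformly_continuous[OF f]) simp
  from this[unfolded uniformly_continuous_on_def, rule_format, of "e / 4"] e
  obtain d where d: "d > 0" "\<And>x y. x \<in> {a..b} \<Longrightarrow> y \<in> {a..b} \<Longrightarrow> dist y x < d \<Longrightarrow> dist (f y) (f x) < e / 4"
    by auto
  have "(\<lambda>l. (b - a) * (1 / 2) ^ l) \<longlonglongrightarrow> (b - a) * 0"
    by (intro tendsto_mult tendsto_const LIMSEQ_realpow_zero) auto
  then have "eventually (\<lambda>l. (b - a) * (1 / 2) ^ l < d) sequentially"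
    using d(1) by (intro order_tendstoD(2)[where y = "(b - a) * 0"]) auto
  then obtain L where L: "\<And>l. l \<ge> L \<Longrightarrow> (b - a) / 2 ^ l < d"
    unfolding eventually_sequentially by (auto simp: power_one_over)
  show "\<exists>no. \<forall>n\<ge>no. norm (osc f (A n) - osc f {a..b}) < e"
  proof (intro exI[of _ L] allI impI)
    fix l assume l: "l \<ge> L"
    have ne: "A l \<noteq> {}" using A(1)[of l] dyad_nonempty[of a b l] by blast
    have bA: "bounded (f ` A l)" using bounded_subset[OF b image_mono[OF A(2)]] .
    have "osc f {a..b} \<le> osc f (A l) + e / 2"
    proof (rule osc_least)
      fix s t assume st: "s \<in> {a..b}" "t \<in> {a..b}"
      obtain s' where s': "s' \<in> dyad a b l" "\<bar>s - s'\<bar> \<le> (b - a) / 2 ^ l" using dyad_dense[of a s b l] st by auto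
      obtain t' where t': "t' \<in> dyad a b l" "\<bar>t - t'\<bar> \<le> (b - a) / 2 ^ l" using dyad_dense[of a t b l] st by auto
      have s'A: "s' \<in> A l" and t'A: "t' \<in> A l" using A(1)[of l] s' t' by auto
      have "dist (f s) (f s') < e / 4"
        by (rule d(2)) (use s' L[OF l] st A(2)[of l] s'A in \<open>auto simp: dist_real_def\<close>)
      moreover have "dist (f t) (f t') < e / 4"
        by (rule d(2)) (use t' L[OF l] st A(2)[of l] t'A in \<open>auto simp: dist_real_def\<close>)
      ultimately show "f t - f s \<le> osc f (A l) + e / 2"
        using osc_upper[OF bA s'A t'A] unfolding dist_real_def by linarith
    qed (use ab in auto)
    moreover have "osc f (A l) \<le> osc f {a..b}" by (rule osc_mono[OF b A(2) ne])
    ultimately show "norm (osc f (A l) - osc f {a..b}) < e" using e by auto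
  qed
qed

lemma continuous_bounded_Icc: "continuous_on {a..b::real} f \<Longrightarrow> bounded (f ` {a..b} :: real set)"
  using compact_continuous_image[of "{a..b}" f] compact_imp_bounded by auto

lemma continuous_path_Icc: "continuous_on {0..} f \<Longrightarrow> 0 \<le> a \<Longrightarrow> continuous_on {a..b::real} (f :: real \<Rightarrow> real)"
  by (erule continuous_on_subset) auto

section \<open>The seminorm built from the ranges over blocks\<close>

abbreviation block :: "nat \<Rightarrow> nat \<Rightarrow> real set" where
  "block n i \<equiv> {real i / real n..real (Suc i) / real n}"

definition block_norm :: "nat \<Rightarrow> (real \<Rightarrow> real) \<Rightarrow> real" where
  "block_norm n f = L2_set (\<lambda>i. osc f (block n i)) {..<n}"

lemma block_subset: "i < n \<Longrightarrow> (block n i) \<subseteq> {0..1}"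
proof -
  assume "i < n"
  then have "real (Suc i) \<le> real n" by linarith
  then have "real (Suc i) / real n \<le> 1" by (simp add: divide_le_eq_1)
  then show ?thesis by auto
qed

lemma block_nonempty: "real i / real n \<le> real (Suc i) / real n" by (simp add: divide_right_mono)

lemma block_norm_nonneg: "0 \<le> block_norm n f" by (simp add: block_norm_def)

lemma block_norm_square: "(block_norm n f)\<^sup>2 = (\<Sum>i<n. (osc f (block n i))\<^sup>2)"
  unfolding block_norm_def L2_set_def by (simp add: sum_nonneg)

text \<open>Minkowski's inequality for finite sums, applied after the subadditivity of
  \<open>osc\<close> on each block.\<close>

lemma block_norm_add:
  assumes "bounded (f ` {0..1})" "bounded (g ` {0..1})"
  shows "block_norm n (\<lambda>t. f t + g t) \<le> block_norm n f + block_norm n g"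
proof -
  have "block_norm n (\<lambda>t. f t + g t) \<le> L2_set (\<lambda>i. osc f ((block n i)) + osc g ((block n i))) {..<n}"
    unfolding block_norm_def
  proof (rule L2_set_mono)
    fix i assume i: "i \<in> {..<n}"
    have *: "bounded (f ` (block n i))" "bounded (g ` (block n i))"
      using bounded_subset[OF assms(1) image_mono[OF block_subset]] bounded_subset[OF assms(2) image_mono[OF block_subset]] i
      by auto
    have "bounded ((\<lambda>t. f t + g t) ` (block n i))" by (rule bounded_plus_comp[OF *])
    then show "0 \<le> osc (\<lambda>t. f t + g t) ((block n i))" by (rule osc_nonneg) (use block_nonempty in auto)
    show "osc (\<lambda>t. f t + g t) ((block n i)) \<le> osc f ((block n i)) + osc g ((block n i))"
      by (rule osc_add[OF *]) (use block_nonempty in auto)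
  qed
  also have "\<dots> \<le> block_norm n f + block_norm n g" unfolding block_norm_def by (rule L2_set_triangle_ineq)
  finally show ?thesis .
qed

text \<open>Both inequalities use the same difference, so that together they bound the absolute
  difference of two seminorms. The sign is removed by \<open>osc_cmult\<close> with factor
  -1.\<close>

lemma block_norm_diff:
  assumes "bounded (f ` {0..1})" "bounded (g ` {0..1})"
  shows "block_norm n f \<le> block_norm n (\<lambda>t. f t - g t) + block_norm n g" "block_norm n g \<le> block_norm n (\<lambda>t. f t - g t) + block_norm n f"
proof -
  have b: "bounded ((\<lambda>t. f t - g t) ` {0..1})" "bounded ((\<lambda>t. g t - f t) ` {0..1})"
    by (auto intro: bounded_minus_comp assms)
  show "block_norm n f \<le> block_norm n (\<lambda>t. f t - g t) + block_norm n g" using block_norm_add[OF b(1) assms(2)] by simp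
  have "block_norm n (\<lambda>t. g t - f t) = block_norm n (\<lambda>t. - (f t - g t))" by simp
  also have "\<dots> = block_norm n (\<lambda>t. f t - g t)"
    unfolding block_norm_def
  proof (rule L2_set_cong[OF refl])
    fix i assume "i \<in> {..<n}"
    then have "bounded ((\<lambda>t. f t - g t) ` block n i)"
      using bounded_subset[OF b(1) image_mono[OF block_subset]] by auto
    from osc_cmult[OF this, of "- 1"] show "osc (\<lambda>t. - (f t - g t)) (block n i) = osc (\<lambda>t. f t - g t) (block n i)"
      using block_nonempty[of i n] by simp
  qed
  finally show "block_norm n g \<le> block_norm n (\<lambda>t. f t - g t) + block_norm n f"
    using block_norm_add[OF b(2) assms(1), of n] by simp
qed

text \<open>This fixes the scale of negligible errors: block ranges of order 1/n, as for a Lipschitz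
  drift, disappear in the limit, whereas a uniform error must be small compared with
  \<open>1 / sqrt n\<close>.\<close>

lemma block_norm_le:
  assumes "\<And>i. i < n \<Longrightarrow> osc f (block n i) \<le> c" "bounded (f ` {0..1})" "0 \<le> c"
  shows "block_norm n f \<le> sqrt n * c"
proof -
  have "block_norm n f \<le> L2_set (\<lambda>i. c) {..<n}"
    unfolding block_norm_def
  proof (rule L2_set_mono)
    fix i assume i: "i \<in> {..<n}"
    then have "bounded (f ` (block n i))"
      using bounded_subset[OF assms(2) image_mono[OF block_subset]] by auto
    then show "0 \<le> osc f (block n i)"
      by (rule osc_nonneg) (use block_nonempty in auto)
  qed (use assms in auto)
  also have "\<dots> = sqrt n * c" using assms(3) by (simp add: L2_set_def real_sqrt_mult)
  finally show ?thesis .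
qed

section \<open>Brownian increments and Doob's maximal inequality\<close>

text \<open>Intended for \<open>N\<close> the completion of the given measure, with the filtration
  left as it is. Completeness makes suprema over intervals measurable; independence is a product
  formula for events, the form in which it passes to the completion.\<close>

locale brownian_setup = prob_space N for N :: "'a measure" +
  fixes F :: "real \<Rightarrow> 'a measure" and W :: "real \<Rightarrow> 'a \<Rightarrow> real"
  assumes complete: "Z \<in> null_sets N \<Longrightarrow> A \<subseteq> Z \<Longrightarrow> A \<in> sets N"
    and space_F: "space (F t) = space N"
    and F_mono: "s \<le> t \<Longrightarrow> sets (F s) \<subseteq> sets (F t)"
    and F_sub: "sets (F t) \<subseteq> sets N"
    and W_adapted: "0 \<le> t \<Longrightarrow> W t \<in> borel_measurable (F t)"
    and W_cont: "AE w in N. continuous_on {0..} (\<lambda>t. W t w)"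
    and W_distr: "0 \<le> s \<Longrightarrow> s < t \<Longrightarrow>
        distributed N lborel (\<lambda>w. W t w - W s w) (normal_density 0 (sqrt (t - s)))"
    and W_indep: "0 \<le> s \<Longrightarrow> s < t \<Longrightarrow> A \<in> sets (F s) \<Longrightarrow> B \<in> sets borel \<Longrightarrow>
        prob (A \<inter> ((\<lambda>w. W t w - W s w) -` B \<inter> space N)) =
        prob A * prob ((\<lambda>w. W t w - W s w) -` B \<inter> space N)"
begin

lemma F_measurable_mono: "X \<in> borel_measurable (F s) \<Longrightarrow> s \<le> t \<Longrightarrow> X \<in> borel_measurable (F t)"
  by (rule measurable_from_subalg[of _ "F s"]) (use F_mono space_F in \<open>auto simp: subalgebra_def\<close>)

lemma F_measurable: "X \<in> borel_measurable (F s) \<Longrightarrow> X \<in> borel_measurable N"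
  by (rule measurable_from_subalg[of _ "F s"]) (use F_sub space_F in \<open>auto simp: subalgebra_def\<close>)

lemma W_measurable: "0 \<le> t \<Longrightarrow> W t \<in> borel_measurable N"
  by (rule F_measurable[OF W_adapted])

text \<open>The events of \<open>X\<close> generate a sub-sigma-algebra of \<open>F s\<close>, and
  the preimages of Borel sets under the increment already form a sigma-algebra, so the product
  formula of the locale applies directly.\<close>

lemma increment_indep:
  assumes X: "X \<in> borel_measurable (F s)" and st: "0 \<le> s" "s < t"
  shows "indep_var borel X borel (\<lambda>w. W t w - W s w)"
proof -
  let ?D = "\<lambda>w. W t w - W s w"
  have D: "?D \<in> borel_measurable N" using W_measurable st by auto
  have XN: "X \<in> borel_measurable N" by (rule F_measurable[OF X])
  have 1: "sigma_sets (space N) {X -` A \<inter> space N |A. A \<in> sets borel} \<subseteq> sets (F s)"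
    using sets.sigma_sets_subset[of "{X -` A \<inter> space N |A. A \<in> sets borel}" "F s"] X space_F[of s]
    by (auto simp: measurable_def)
  have 2: "sigma_sets (space N) {?D -` A \<inter> space N |A. A \<in> sets borel} = {?D -` A \<inter> space N |A. A \<in> sets borel}"
    using sets.sigma_sets_eq[of "vimage_algebra (space N) ?D borel"]
    by (subst (asm) (1 2) sets_vimage_algebra2) auto
  show ?thesis unfolding indep_var_eq 2
  proof (intro conjI indep_setI XN D)
    show "sigma_sets (space N) {X -` A \<inter> space N |A. A \<in> sets borel} \<subseteq> events" using 1 F_sub by blast
    show "{?D -` A \<inter> space N |A. A \<in> sets borel} \<subseteq> events" using D by (auto simp: measurable_def)
  next
    fix a b assume "a \<in> sigma_sets (space N) {X -` A \<inter> space N |A. A \<in> sets borel}"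
      and "b \<in> {?D -` A \<inter> space N |A. A \<in> sets borel}"
    then show "prob (a \<inter> b) = prob a * prob b" using W_indep[OF st, of a] 1 by auto
  qed
qed

text \<open>Times may coincide because the grids used later are indexed by all naturals and repeat
  their last point. A normal law of variance zero has no density, hence the separate case.\<close>

lemma increment_moments:
  assumes "0 \<le> s" "s \<le> t"
  shows "integrable N (\<lambda>w. W t w - W s w) \<and> expectation (\<lambda>w. W t w - W s w) = 0 \<and>
    integrable N (\<lambda>w. (W t w - W s w)\<^sup>2) \<and> expectation (\<lambda>w. (W t w - W s w)\<^sup>2) = t - s"
proof (cases "s = t")
  case False
  with assms have st: "s < t" by simp
  then have pos: "0 < sqrt (t - s)" by simp
  note D = W_distr[OF assms(1) st]
  have i1: "integrable N (\<lambda>w. W t w - W s w)"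
    using distributed_integrable[OF D, of "\<lambda>x. x"] integrable_normal_moment[OF pos, of 0 1] by simp
  have i2: "integrable N (\<lambda>w. (W t w - W s w)\<^sup>2)"
    using distributed_integrable[OF D, of "\<lambda>x. x\<^sup>2"] integrable_normal_moment[OF pos, of 0 2] by simp
  have e1: "expectation (\<lambda>w. W t w - W s w) = 0"
    by (rule normal_distributed_expectation[OF pos D])
  have e2: "expectation (\<lambda>w. (W t w - W s w)\<^sup>2) = t - s"
    using normal_distributed_variance[OF pos D] e1 st by simp
  from i1 i2 e1 e2 show ?thesis by blast
qed simp

lemma increment_orthogonal:
  assumes X: "X \<in> borel_measurable (F s)" and st: "0 \<le> s" "s \<le> t" and i: "integrable N X"
  shows "integrable N (\<lambda>w. X w * (W t w - W s w)) \<and> expectation (\<lambda>w. X w * (W t w - W s w)) = 0"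
proof (cases "s = t")
  case False
  with st have "s < t" by simp
  note I = increment_indep[OF X st(1) this]
  show ?thesis
    using indep_var_integrable[OF I i] indep_var_lebesgue_integral[OF I i] increment_moments[OF st] by simp
qed simp

lemma increment_isometry:
  assumes X: "X \<in> borel_measurable (F s)" and st: "0 \<le> s" "s \<le> t" and i: "integrable N (\<lambda>w. (X w)\<^sup>2)"
  shows "integrable N (\<lambda>w. (X w)\<^sup>2 * (W t w - W s w)\<^sup>2) \<and>
    expectation (\<lambda>w. (X w)\<^sup>2 * (W t w - W s w)\<^sup>2) = expectation (\<lambda>w. (X w)\<^sup>2) * (t - s)"
proof (cases "s = t")
  case False
  with st have "s < t" by simp
  note I = indep_var_compose[OF increment_indep[OF X st(1) this], of "\<lambda>x. x\<^sup>2" borel "\<lambda>x. x\<^sup>2" borel, unfolded comp_def]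
  have I: "indep_var borel (\<lambda>w. (X w)\<^sup>2) borel (\<lambda>w. (W t w - W s w)\<^sup>2)" by (rule I) auto
  show ?thesis
    using indep_var_integrable[OF I i] indep_var_lebesgue_integral[OF I i] increment_moments[OF st] by simp
qed simp

end

section \<open>Doob's maximal inequality for discrete martingale transforms\<close>

fun rmax :: "(nat \<Rightarrow> real) \<Rightarrow> nat \<Rightarrow> real" where
  "rmax s 0 = 0"
| "rmax s (Suc r) = max (rmax s r) (s (Suc r))"

lemma rmax_nonneg: "0 \<le> rmax s r" by (induction r) auto

text \<open>The recursion starts from 0 and skips the value at index 0; with \<open>s 0 = 0\<close>
  it is the maximum over all indices up to \<open>r\<close>.\<close>

lemma rmax_ge: "s 0 = 0 \<Longrightarrow> q \<le> r \<Longrightarrow> s q \<le> rmax s r"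
  by (induction r) (auto simp: le_Suc_eq le_max_iff_disj)

text \<open>A crude bound that serves only to make the squared maximum integrable before Doob's
  inequality is applied.\<close>

lemma rmax_square_le: "(rmax s r)\<^sup>2 \<le> (\<Sum>q\<le>r. (s q)\<^sup>2)"
proof (induction r)
  case (Suc r)
  have "(rmax s (Suc r))\<^sup>2 \<le> (rmax s r)\<^sup>2 + (s (Suc r))\<^sup>2" by (auto simp: max_def)
  with Suc show ?case by simp
qed simp

text \<open>
  Summation by parts, where the running maximum only grows at times at which it equals the process.
\<close>

lemma pathwise_doob:
  assumes "s 0 = 0"
  shows "(rmax s n)\<^sup>2 + 4 * (\<Sum>i<n. rmax s i * (s (Suc i) - s i)) \<le> 4 * (s n)\<^sup>2"
proof -
  have "(rmax s n)\<^sup>2 \<le> 2 * rmax s n * s n - 2 * (\<Sum>i<n. rmax s i * (s (Suc i) - s i))"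
  proof (induction n)
    case 0 then show ?case by simp
  next
    case (Suc n)
    define m x y T where "m = rmax s n" and "x = s n" and "y = s (Suc n)"
      and "T = (\<Sum>i<n. rmax s i * (s (Suc i) - s i))"
    have IH: "m\<^sup>2 \<le> 2 * m * x - 2 * T" using Suc by (simp add: m_def x_def T_def)
    have "(max m y)\<^sup>2 \<le> 2 * max m y * y - 2 * (T + m * (y - x))"
    proof (cases "m \<ge> y")
      case True
      have "m\<^sup>2 \<le> 2 * m * y - 2 * (T + m * (y - x))" using IH by (simp add: algebra_simps)
      with True show ?thesis by (simp add: max_def)
    next
      case False
      have "0 \<le> (y - m)\<^sup>2" by simp
      then have "y\<^sup>2 \<le> 2 * y * y - 2 * (T + m * (y - x))" using IH by (simp add: algebra_simps power2_eq_square)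
      with False show ?thesis by (simp add: max_def)
    qed
    then show ?case by (simp add: m_def x_def y_def T_def)
  qed
  \<comment> \<open>Completing the square absorbs the product of maximum and final value; this is
    where Doob's constant 4 arises.\<close>
  moreover have "0 \<le> (rmax s n - 2 * s n)\<^sup>2" by simp
  ultimately show ?thesis by (simp add: algebra_simps power2_eq_square)
qed

text \<open>\<open>h r\<close> is the value carried from \<open>g r\<close> to
  \<open>g (Suc r)\<close>; measurability at the left end makes it independent of the increment it
  multiplies. Repeated grid points contribute nothing.\<close>

locale grid_integrand = brownian_setup +
  fixes g :: "nat \<Rightarrow> real" and h :: "nat \<Rightarrow> 'a \<Rightarrow> real"
  assumes g_mono: "incseq g" and g_nonneg: "0 \<le> g 0"
    and h_meas: "h r \<in> borel_measurable (F (g r))"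
    and h_bdd: "\<exists>C. \<forall>w\<in>space N. \<bar>h r w\<bar> \<le> C"
begin

definition S :: "nat \<Rightarrow> 'a \<Rightarrow> real" where
  "S r w = (\<Sum>q<r. h q w * (W (g (Suc q)) w - W (g q) w))"

lemma g_ge0: "0 \<le> g r"
  using g_nonneg g_mono[THEN incseqD, of 0 r] by simp

lemma g_Suc: "g r \<le> g (Suc r)" using g_mono by (simp add: incseq_SucD)

lemma S_adapted: "S r \<in> borel_measurable (F (g r))"
  unfolding S_def
proof (intro borel_measurable_sum borel_measurable_times borel_measurable_diff)
  fix q assume "q \<in> {..<r}"
  then have "g q \<le> g r" "g (Suc q) \<le> g r" using g_mono[THEN incseqD] by auto
  then show "h q \<in> borel_measurable (F (g r))" "W (g (Suc q)) \<in> borel_measurable (F (g r))"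
    "W (g q) \<in> borel_measurable (F (g r))"
    by (auto intro: F_measurable_mono h_meas W_adapted g_ge0)
qed

lemma integrable_mult_h:
  assumes "integrable N X" shows "integrable N (\<lambda>w. X w * h r w)"
proof -
  obtain C where C: "\<And>w. w \<in> space N \<Longrightarrow> \<bar>h r w\<bar> \<le> C" using h_bdd by blast
  have [measurable]: "h r \<in> borel_measurable N" "X \<in> borel_measurable N"
    using F_measurable[OF h_meas] assms by auto
  show ?thesis
  proof (rule Bochner_Integration.integrable_bound[OF integrable_mult_right[OF assms, of C]])
    show "AE w in N. norm (X w * h r w) \<le> norm (C * X w)"
    proof (rule AE_I2)
      fix w assume "w \<in> space N"
      then have "\<bar>h r w\<bar> \<le> \<bar>C\<bar>" using C by fastforce
      then have "\<bar>X w\<bar> * \<bar>h r w\<bar> \<le> \<bar>X w\<bar> * \<bar>C\<bar>" by (intro mult_left_mono) auto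
      then show "norm (X w * h r w) \<le> norm (C * X w)"
        by (simp add: abs_mult mult.commute)
    qed
  qed measurable
qed

lemma h_sq_integrable: "integrable N (\<lambda>w. (h r w)\<^sup>2)"
proof -
  have "integrable N (\<lambda>w. (1 * h r w) * h r w)"
    by (intro integrable_mult_h) simp
  then show ?thesis by (simp add: power2_eq_square)
qed

text \<open>The cross term is the new increment times \<open>S r w * h r w\<close>, which is known
  at time \<open>g r\<close> and integrable, so its expectation vanishes.\<close>

lemma S_isometry:
  "integrable N (\<lambda>w. (S r w)\<^sup>2) \<and>
   expectation (\<lambda>w. (S r w)\<^sup>2) = (\<Sum>q<r. expectation (\<lambda>w. (h q w)\<^sup>2) * (g (Suc q) - g q))"
proof (induction r)
  case 0 then show ?case by (simp add: S_def)
next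
  case (Suc r)
  let ?D = "\<lambda>w. W (g (Suc r)) w - W (g r) w"
  have iS: "integrable N (S r)"
    using square_integrable_imp_integrable[OF F_measurable[OF S_adapted]] Suc by blast
  have m: "(\<lambda>w. S r w * h r w) \<in> borel_measurable (F (g r))"
    using S_adapted h_meas by auto
  note o = increment_orthogonal[OF m g_ge0 g_Suc integrable_mult_h[OF iS]]
  note s = increment_isometry[OF h_meas g_ge0 g_Suc h_sq_integrable, of r]
  have eq: "(\<lambda>w. (S (Suc r) w)\<^sup>2) = (\<lambda>w. (S r w)\<^sup>2 + 2 * (S r w * h r w * ?D w) + (h r w)\<^sup>2 * (?D w)\<^sup>2)"
    by (auto simp: S_def power2_eq_square algebra_simps)
  show ?case unfolding eq using o s Suc by simp
qed

lemma rmax_adapted: "(\<lambda>w. rmax (\<lambda>q. S q w) r) \<in> borel_measurable (F (g r))"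
proof (induction r)
  case (Suc r)
  then show ?case using F_measurable_mono[OF Suc g_Suc] S_adapted by simp
qed simp

text \<open>Take expectations in \<open>pathwise_doob\<close>. The sum there is itself a martingale
  transform: its integrand \<open>rmax * h\<close> is evaluated at the left end of each interval, so
  it has mean zero, and the isometry computes the rest.\<close>

lemma doob_rmax:
  "integrable N (\<lambda>w. (rmax (\<lambda>q. S q w) n)\<^sup>2) \<and>
   expectation (\<lambda>w. (rmax (\<lambda>q. S q w) n)\<^sup>2) \<le> 4 * (\<Sum>q<n. expectation (\<lambda>w. (h q w)\<^sup>2) * (g (Suc q) - g q))"
proof -
  let ?m = "\<lambda>r w. rmax (\<lambda>q. S q w) r"
  have mm: "?m r \<in> borel_measurable N" for r using rmax_adapted F_measurable by blast
  have i2: "integrable N (\<lambda>w. (?m r w)\<^sup>2)" for r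
  proof (rule Bochner_Integration.integrable_bound)
    show "integrable N (\<lambda>w. \<Sum>q\<le>r. (S q w)\<^sup>2)" using S_isometry by auto
    show "AE w in N. norm ((?m r w)\<^sup>2) \<le> norm (\<Sum>q\<le>r. (S q w)\<^sup>2)"
      using rmax_square_le by (simp add: sum_nonneg)
  qed (use mm in auto)
  have i1: "integrable N (?m r)" for r
    by (rule square_integrable_imp_integrable[OF mm i2])
  let ?D = "\<lambda>i w. W (g (Suc i)) w - W (g i) w"
  have o: "integrable N (\<lambda>w. ?m i w * h i w * ?D i w)" "expectation (\<lambda>w. ?m i w * h i w * ?D i w) = 0" for i
  proof -
    have m: "(\<lambda>w. ?m i w * h i w) \<in> borel_measurable (F (g i))" using rmax_adapted h_meas by auto
    show "integrable N (\<lambda>w. ?m i w * h i w * ?D i w)" "expectation (\<lambda>w. ?m i w * h i w * ?D i w) = 0"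
      using increment_orthogonal[OF m g_ge0 g_Suc integrable_mult_h[OF i1]] by auto
  qed
  have pw: "(?m n w)\<^sup>2 \<le> 4 * (S n w)\<^sup>2 - 4 * (\<Sum>i<n. ?m i w * h i w * ?D i w)" for w
    using pathwise_doob[of "\<lambda>q. S q w" n] by (simp add: S_def algebra_simps)
  have "expectation (\<lambda>w. (?m n w)\<^sup>2) \<le> expectation (\<lambda>w. 4 * (S n w)\<^sup>2 - 4 * (\<Sum>i<n. ?m i w * h i w * ?D i w))"
    by (intro integral_mono i2 pw) (use S_isometry o in auto)
  also have "\<dots> = 4 * expectation (\<lambda>w. (S n w)\<^sup>2)"
    using S_isometry[of n] o by (simp add: Bochner_Integration.integral_sum)
  finally show ?thesis using i2 S_isometry[of n] by simp
qed

end

text \<open>\<open>R\<close> is the maximum of \<open>S\<close> plus the maximum of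
  \<open>- S\<close>. With \<open>(x + y)\<^sup>2 \<le> 2 * x\<^sup>2 + 2 * y\<^sup>2\<close> and
  Doob's constant 4 for each summand, the total is 16.\<close>

lemma (in grid_integrand) doob_range:
  "\<exists>R\<in>borel_measurable N. integrable N (\<lambda>w. (R w)\<^sup>2) \<and>
     expectation (\<lambda>w. (R w)\<^sup>2) \<le> 16 * (\<Sum>q<n. expectation (\<lambda>w. (h q w)\<^sup>2) * (g (Suc q) - g q)) \<and>
     (\<forall>w. 0 \<le> R w \<and> (\<forall>r\<le>n. \<forall>r'\<le>n. S r' w - S r w \<le> R w))"
proof -
  interpret neg: grid_integrand N F W g "\<lambda>r w. - h r w"
    by unfold_locales (use g_mono g_nonneg h_meas h_bdd in auto)
  have neg: "neg.S r w = - S r w" for r w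
    by (simp add: neg.S_def S_def sum_negf)
  let ?a = "\<lambda>w. rmax (\<lambda>q. S q w) n" and ?b = "\<lambda>w. rmax (\<lambda>q. - S q w) n"
  have a: "?a \<in> borel_measurable N" "integrable N (\<lambda>w. (?a w)\<^sup>2)" and b: "?b \<in> borel_measurable N" "integrable N (\<lambda>w. (?b w)\<^sup>2)"
    and E: "expectation (\<lambda>w. (?a w)\<^sup>2) \<le> 4 * (\<Sum>q<n. expectation (\<lambda>w. (h q w)\<^sup>2) * (g (Suc q) - g q))"
      "expectation (\<lambda>w. (?b w)\<^sup>2) \<le> 4 * (\<Sum>q<n. expectation (\<lambda>w. (h q w)\<^sup>2) * (g (Suc q) - g q))"
    using rmax_adapted[THEN F_measurable] doob_rmax neg.rmax_adapted[THEN F_measurable] neg.doob_rmax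
    by (auto simp: neg)
  have sq: "(x + y)\<^sup>2 \<le> 2 * x\<^sup>2 + 2 * y\<^sup>2" for x y :: real
    using zero_le_power2[of "x - y"] by (simp add: power2_eq_square algebra_simps)
  have i: "integrable N (\<lambda>w. (?a w + ?b w)\<^sup>2)"
    by (rule Bochner_Integration.integrable_bound[of _ "\<lambda>w. 2 * (?a w)\<^sup>2 + 2 * (?b w)\<^sup>2"])
      (use a b sq in auto)
  have "expectation (\<lambda>w. (?a w + ?b w)\<^sup>2) \<le> expectation (\<lambda>w. 2 * (?a w)\<^sup>2 + 2 * (?b w)\<^sup>2)"
    by (intro integral_mono i sq) (use a b in auto)
  also have "\<dots> = 2 * expectation (\<lambda>w. (?a w)\<^sup>2) + 2 * expectation (\<lambda>w. (?b w)\<^sup>2)"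
    using a b by simp
  finally have "expectation (\<lambda>w. (?a w + ?b w)\<^sup>2) \<le> 16 * (\<Sum>q<n. expectation (\<lambda>w. (h q w)\<^sup>2) * (g (Suc q) - g q))"
    using E by linarith
  moreover have "S r' w - S r w \<le> ?a w + ?b w" if "r \<le> n" "r' \<le> n" for r r' w
    using rmax_ge[of "\<lambda>q. S q w" r' n] rmax_ge[of "\<lambda>q. - S q w" r n] that by (simp add: S_def)
  ultimately show ?thesis
    using a b i rmax_nonneg by (intro bexI[of _ "\<lambda>w. ?a w + ?b w"]) auto
qed

section \<open>Stochastic integrals of elementary integrands\<close>

text \<open>The sorted list is prolonged by its last element, so that a finite grid is indexed by
  all naturals, as \<open>grid_integrand\<close> expects.\<close>

lemma finite_grid_enumeration:
  fixes A :: "real set"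
  assumes "finite A" "A \<noteq> {}"
  obtains g :: "nat \<Rightarrow> real" and m where "incseq g" "range g = A" "\<And>r. A \<inter> {g r<..<g (Suc r)} = {}"
    "\<And>r. m \<le> r \<Longrightarrow> g r = g m"
proof -
  define xs where "xs = sorted_list_of_set A"
  define m where "m = length xs - 1"
  define g where "g r = xs ! min r m" for r
  have xs: "sorted xs" "set xs = A" "xs \<noteq> []" using assms by (auto simp: xs_def)
  have lt: "min r m < length xs" for r using xs(3) by (auto simp: m_def min_def) (metis Suc_pred diff_less length_greater_0_conv less_Suc_eq_le le_imp_less_Suc not_less_eq_eq)+
  show ?thesis
  proof (rule that[of g m])
    show "incseq g" unfolding incseq_def g_def
      by (intro allI impI sorted_nth_mono[OF xs(1)] lt) auto
    have idx: "\<exists>j\<le>m. x = xs ! j" if "x \<in> A" for x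
    proof -
      from that xs(2) obtain j where "j < length xs" "x = xs ! j" by (auto simp: in_set_conv_nth)
      then show ?thesis by (intro exI[of _ j]) (auto simp: m_def)
    qed
    show "range g = A"
    proof (rule antisym)
      show "range g \<subseteq> A" using xs(2) lt by (auto simp: g_def)
      show "A \<subseteq> range g"
      proof
        fix x assume "x \<in> A"
        then obtain j where "j \<le> m" "x = xs ! j" using idx by auto
        then have "x = g j" by (simp add: g_def min_def)
        then show "x \<in> range g" by simp
      qed
    qed
    show "A \<inter> {g r<..<g (Suc r)} = {}" for r
    proof (rule ccontr)
      assume "A \<inter> {g r<..<g (Suc r)} \<noteq> {}"
      then obtain x where x: "x \<in> A" "g r < x" "x < g (Suc r)" by auto
      then obtain j where j: "j \<le> m" "x = xs ! j" using idx by auto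
      then have xg: "x = g j" by (simp add: g_def min_def)
      show False
      proof (cases "j \<le> r")
        case True with \<open>incseq g\<close> xg x show False by (auto dest!: incseqD)
      next
        case False then have "Suc r \<le> j" by simp
        with \<open>incseq g\<close> xg x show False by (auto dest!: incseqD)
      qed
    qed
    show "g r = g m" if "m \<le> r" for r using that by (simp add: g_def min_def)
  qed
qed

text \<open>Adds the Doob bounds of the single blocks, each with its own local index, to one bound
  by the total energy.\<close>

lemma telescope_blocks:
  fixes P :: "nat \<Rightarrow> nat" and f :: "nat \<Rightarrow> real"
  assumes "\<And>i. i < n \<Longrightarrow> P i \<le> P (Suc i)"
  shows "(\<Sum>i<n. \<Sum>q<P (Suc i) - P i. f (P i + q)) = (\<Sum>q=P 0..<P n. f q)"
  using assms
proof (induction n)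
  case 0 then show ?case by simp
next
  case (Suc n)
  have "P 0 \<le> P n" using Suc.prems by (induction n) (auto intro: le_trans)
  have "(\<Sum>q<P (Suc n) - P n. f (P n + q)) = (\<Sum>q=P n..<P (Suc n). f q)"
    using Suc.prems[of n] by (intro sum.reindex_bij_witness[of _ "\<lambda>q. q - P n" "\<lambda>q. P n + q"]) auto
  with Suc \<open>P 0 \<le> P n\<close> show ?case by (simp add: sum.atLeastLessThan_concat)
qed

section \<open>Passing to the limit inside a tail bound, and Markov's inequality\<close>

context prob_space begin

text \<open>The strict inequality is an open condition: if the limit exceeds \<open>e\<close>, then
  so does \<open>X l\<close> from some index on. The increasing events \<open>B m\<close> express
  this, and each has probability at most \<open>c\<close>.\<close>

lemma prob_limit_le:
  fixes X :: "nat \<Rightarrow> 'a \<Rightarrow> real"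
  assumes X: "\<And>l. X l \<in> borel_measurable M" and lim: "AE w in M. (\<lambda>l. X l w) \<longlonglongrightarrow> Y w"
    and c: "\<And>l. prob {w \<in> space M. e < X l w} \<le> c"
  shows "prob {w \<in> space M. e < Y w} \<le> c"
proof -
  define B where "B m = (\<Inter>l\<in>{m..}. {w \<in> space M. e < X l w})" for m
  have B[measurable]: "B m \<in> sets M" for m using X unfolding B_def by (intro sets.countable_INT) auto
  have "incseq B" by (auto simp: B_def incseq_def)
  then have "(\<lambda>m. prob (B m)) \<longlonglongrightarrow> prob (\<Union>m. B m)"
    using B by (intro finite_Lim_measure_incseq) auto
  moreover have "prob (B m) \<le> c" for m
    by (rule order_trans[OF finite_measure_mono c[of m]]) (use X in \<open>auto simp: B_def\<close>)
  ultimately have "prob (\<Union>m. B m) \<le> c" by (intro LIMSEQ_le_const2) auto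
  moreover have "prob {w \<in> space M. e < Y w} \<le> prob (\<Union>m. B m)"
  proof (rule finite_measure_mono_AE)
    show "AE w in M. w \<in> {w \<in> space M. e < Y w} \<longrightarrow> w \<in> (\<Union>m. B m)"
      using lim AE_space
    proof eventually_elim
      case (elim w)
      show ?case
      proof
        assume "w \<in> {w \<in> space M. e < Y w}"
        then have "eventually (\<lambda>l. e < X l w) sequentially" using elim by (intro order_tendstoD) auto
        then show "w \<in> (\<Union>m. B m)" using elim by (auto simp: B_def eventually_sequentially)
      qed
    qed
  qed auto
  ultimately show ?thesis by simp
qed

lemma prob_markov:
  fixes X :: "'a \<Rightarrow> real"
  assumes "integrable M X" "\<And>w. 0 \<le> X w" "0 < e" "expectation X \<le> c"
  shows "prob {w \<in> space M. e < X w} \<le> c / e"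
proof -
  have "prob {w \<in> space M. e < X w} \<le> prob {w \<in> space M. X w \<ge> e}"
    by (rule finite_measure_mono) (use assms(1) in \<open>auto intro!: borel_measurable_le\<close>)
  also have "\<dots> \<le> expectation X / e"
    by (rule integral_Markov_inequality_measure[of _ _ "{}"]) (use assms in auto)
  also have "\<dots> \<le> c / e" using assms by (simp add: divide_right_mono)
  finally show ?thesis .
qed

end

section \<open>Integrals that are elementary between break points\<close>

context brownian_setup begin

text \<open>\<open>H\<close> is prescribed on a left-open interval, as for simple integrands, while
  \<open>J\<close> enters through increments from \<open>u\<close> only. For \<open>u = v\<close>
  the two path conditions are void, so coinciding grid points cause no conflict.\<close>

definition elementary_on :: "real \<Rightarrow> real \<Rightarrow> (real \<Rightarrow> 'a \<Rightarrow> real) \<Rightarrow> (real \<Rightarrow> 'a \<Rightarrow> real) \<Rightarrow> ('a \<Rightarrow> real) \<Rightarrow> bool" where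
  "elementary_on u v H J x \<longleftrightarrow> x \<in> borel_measurable (F u) \<and> (\<exists>C. \<forall>w\<in>space N. \<bar>x w\<bar> \<le> C) \<and>
     (\<forall>w\<in>space N. (\<forall>t\<in>{u<..v}. H t w = x w) \<and> (\<forall>t\<in>{u..v}. J t w - J u w = x w * (W t w - W u w)))"

text \<open>\<open>J\<close> is the stochastic integral of \<open>H\<close>, which is constant in time between points of \<open>G\<close>.\<close>

definition elementary :: "real set \<Rightarrow> (real \<Rightarrow> 'a \<Rightarrow> real) \<Rightarrow> (real \<Rightarrow> 'a \<Rightarrow> real) \<Rightarrow> bool" where
  "elementary G H J \<longleftrightarrow> (\<forall>u v. 0 \<le> u \<longrightarrow> u \<le> v \<longrightarrow> G \<inter> {u<..<v} = {} \<longrightarrow> (\<exists>x. elementary_on u v H J x))"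

text \<open>The reason for working with break points: two simple integrands on unrelated partitions
  can be subtracted by uniting their break points, without rewriting either on a common
  refinement.\<close>

lemma elementary_diff:
  assumes "elementary G H J" "elementary G' H' J'"
  shows "elementary (G \<union> G') (\<lambda>t w. H t w - H' t w) (\<lambda>t w. J t w - J' t w)"
  unfolding elementary_def
proof (intro allI impI)
  fix u v :: real assume uv: "0 \<le> u" "u \<le> v" and "(G \<union> G') \<inter> {u<..<v} = {}"
  then have "G \<inter> {u<..<v} = {}" "G' \<inter> {u<..<v} = {}" by auto
  with assms uv obtain x x' where x: "elementary_on u v H J x" and x': "elementary_on u v H' J' x'"
    unfolding elementary_def by blast
  obtain C C' where C: "\<And>w. w \<in> space N \<Longrightarrow> \<bar>x w\<bar> \<le> C" "\<And>w. w \<in> space N \<Longrightarrow> \<bar>x' w\<bar> \<le> C'"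
    using x x' unfolding elementary_on_def by blast
  have "elementary_on u v (\<lambda>t w. H t w - H' t w) (\<lambda>t w. J t w - J' t w) (\<lambda>w. x w - x' w)"
    unfolding elementary_on_def
  proof (intro conjI exI[of _ "C + C'"] ballI)
    fix w assume w: "w \<in> space N"
    show "\<bar>x w - x' w\<bar> \<le> C + C'" using C(1)[OF w] C(2)[OF w] by linarith
    show "H t w - H' t w = x w - x' w" if "t \<in> {u<..v}" for t
      using that x x' w unfolding elementary_on_def by simp
    fix t assume "t \<in> {u..v}"
    then have "J t w - J u w = x w * (W t w - W u w)" "J' t w - J' u w = x' w * (W t w - W u w)"
      using x x' w unfolding elementary_on_def by blast+
    then show "J t w - J' t w - (J u w - J' u w) = (x w - x' w) * (W t w - W u w)"
      by (simp add: left_diff_distrib)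
  qed (use x x' in \<open>auto simp: elementary_on_def\<close>)
  then show "\<exists>x. elementary_on u v (\<lambda>t w. H t w - H' t w) (\<lambda>t w. J t w - J' t w) x" by (rule exI[where x = "\<lambda>w. x w - x' w"])
qed

lemma elementary_simple:
  assumes "simple_integrand M F k s \<xi>" and sp: "space M = space N"
  shows "elementary (s ` {..k}) (simple_process k s \<xi>) (simple_integral W k s \<xi>)"
  unfolding elementary_def
proof (intro allI impI)
  fix u v :: real assume uv: "0 \<le> u" "u \<le> v" and G: "s ` {..k} \<inter> {u<..<v} = {}"
  have mono: "s j \<le> s (Suc j)" if "j < k" for j
    using assms that by (auto simp: simple_integrand_def dest!: mono_onD[of _ _ j "Suc j"])
  have \<xi>: "\<xi> j \<in> borel_measurable (F (s j))" "\<exists>C. \<forall>w\<in>space N. \<bar>\<xi> j w\<bar> \<le> C" if "j < k" for j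
    using assms that by (auto simp: simple_integrand_def)
  have gap: "s j \<le> u \<or> v \<le> s j" if "j \<le> k" for j
  proof (rule ccontr)
    assume "\<not> ?thesis"
    with that have "s j \<in> s ` {..k} \<inter> {u<..<v}" by auto
    with G show False by blast
  qed
  \<comment> \<open>By \<open>gap\<close>, every partition interval either covers the whole of
    \<open>{u<..v}\<close> or misses it; \<open>x\<close> collects the coefficients of the covering
    ones.\<close>
  define x where "x w = (\<Sum>j<k. if u < v \<and> s j \<le> u \<and> v \<le> s (Suc j) then \<xi> j w else 0)" for w
  obtain C where C: "\<And>j w. j < k \<Longrightarrow> w \<in> space N \<Longrightarrow> \<bar>\<xi> j w\<bar> \<le> C j" using \<xi>(2) by metis
  show "\<exists>x. elementary_on u v (simple_process k s \<xi>) (simple_integral W k s \<xi>) x"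
    unfolding elementary_on_def
  proof (intro exI[of _ x] conjI exI[of _ "\<Sum>j<k. \<bar>C j\<bar>"] ballI)
    show "x \<in> borel_measurable (F u)"
      unfolding x_def
    proof (intro borel_measurable_sum)
      fix j assume "j \<in> {..<k}"
      then show "(\<lambda>w. if u < v \<and> s j \<le> u \<and> v \<le> s (Suc j) then \<xi> j w else 0) \<in> borel_measurable (F u)"
        by (cases "u < v \<and> s j \<le> u \<and> v \<le> s (Suc j)") (auto intro: F_measurable_mono \<xi>)
    qed
    fix w assume w: "w \<in> space N"
    show "\<bar>x w\<bar> \<le> (\<Sum>j<k. \<bar>C j\<bar>)"
      unfolding x_def by (rule order_trans[OF sum_abs sum_mono]) (use C w in force)
    show "simple_process k s \<xi> t w = x w" if t: "t \<in> {u<..v}" for t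
      unfolding x_def simple_process_def
    proof (rule sum.cong[OF refl])
      fix j assume "j \<in> {..<k}"
      with gap[of j] gap[of "Suc j"] t
      show "\<xi> j w * indicator {s j<..s (Suc j)} t = (if u < v \<and> s j \<le> u \<and> v \<le> s (Suc j) then \<xi> j w else 0)"
        by (auto simp: indicator_def)
    qed
    show "simple_integral W k s \<xi> t w - simple_integral W k s \<xi> u w = x w * (W t w - W u w)" if t: "t \<in> {u..v}" for t
      unfolding x_def simple_integral_def sum_subtractf[symmetric] sum_distrib_right
    proof (rule sum.cong[OF refl])
      fix j assume j: "j \<in> {..<k}"
      consider "t = u" | "u < t" "s j \<le> u" "v \<le> s (Suc j)" | "u < t" "v \<le> s j" "v \<le> s (Suc j)" | "u < t" "s j \<le> u" "s (Suc j) \<le> u"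
        using gap[of j] gap[of "Suc j"] mono[of j] j t by fastforce
      then show "\<xi> j w * (W (min t (s (Suc j))) w - W (min t (s j)) w) -
        \<xi> j w * (W (min u (s (Suc j))) w - W (min u (s j)) w) =
        (if u < v \<and> s j \<le> u \<and> v \<le> s (Suc j) then \<xi> j w else 0) * (W t w - W u w)"
        using t by cases (auto simp: min_def algebra_simps)
    qed
  qed
qed

text \<open>The value of \<open>f\<close> at \<open>g 0\<close> is not prescribed by the left-open
  steps. The induction therefore starts from a single point, which is a null set, and this also
  secures measurability there.\<close>

lemma set_integral_step:
  fixes f :: "real \<Rightarrow> real"
  assumes "incseq g" and "\<And>r t. g r < t \<Longrightarrow> t \<le> g (Suc r) \<Longrightarrow> f t = c r"
  shows "set_integrable lborel {g 0..g R} f \<and> (LBINT u:{g 0..g R}. f u) = (\<Sum>q<R. c q * (g (Suc q) - g q))"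
proof (induction R)
  case 0 
  have "AE u in lborel. u \<notin> {g 0}" by (rule AE_not_in) (auto intro: countable_imp_null_set_lborel)
  then have ae: "AE u in lborel. indicator {g 0..g 0} u *\<^sub>R f u = 0" by eventually_elim (auto simp: indicator_def)
  have m: "(\<lambda>u. indicator {g 0..g 0} u *\<^sub>R f u) \<in> borel_measurable lborel"
  proof -
    have "(\<lambda>u. indicator {g 0..g 0} u *\<^sub>R f u) = (\<lambda>u. indicator {g 0..g 0} u *\<^sub>R f (g 0))" by (auto simp: indicator_def)
    then show ?thesis by simp
  qed
  show ?case
    using integrable_cong_AE[OF m _ ae] integral_cong_AE[OF m _ ae]
    by (simp add: set_integrable_def set_lebesgue_integral_def)
next
  case (Suc R)
  have le: "g 0 \<le> g R" "g R \<le> g (Suc R)" using incseqD[OF assms(1)] by auto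
  have eq: "{g 0..g (Suc R)} = {g 0..g R} \<union> {g R<..g (Suc R)}" using le by auto
  have "set_integrable lborel {g R<..g (Suc R)} (\<lambda>u. c R)"
    unfolding set_integrable_def using le by (intro integrable_scaleR_left) (simp add: less_top[symmetric])
  then have i: "set_integrable lborel {g R<..g (Suc R)} f"
    by (subst set_integrable_cong[OF refl]) (use assms(2) in auto)
  have v: "(LBINT u:{g R<..g (Suc R)}. f u) = c R * (g (Suc R) - g R)"
  proof -
    have "(LBINT u:{g R<..g (Suc R)}. f u) = (LBINT u:{g R<..g (Suc R)}. c R)"
      by (rule set_lebesgue_integral_cong) (use assms(2) in auto)
    also have "\<dots> = c R * (g (Suc R) - g R)" using le by (simp add: set_lebesgue_integral_def)
    finally show ?thesis .
  qed
  have "(LBINT u:{g 0..g (Suc R)}. f u) = (LBINT u:{g 0..g R}. f u) + (LBINT u:{g R<..g (Suc R)}. f u)"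
    unfolding eq by (rule set_integral_Un) (use Suc i in auto)
  moreover have "set_integrable lborel {g 0..g (Suc R)} f"
    unfolding eq by (rule set_integrable_Un) (use Suc i in auto)
  ultimately show ?case using Suc v by simp
qed

text \<open>Partial sums increase, so the retained terms form an initial segment up to vanishing
  terms, and its total is a partial sum not exceeding \<open>d\<close>. The induction needs the
  stronger bound by the minimum of partial sum and \<open>d\<close>.\<close>

lemma truncated_sum_le:
  fixes x :: "nat \<Rightarrow> real"
  assumes "\<And>r. 0 \<le> x r" "0 \<le> d"
  shows "(\<Sum>r<R. if (\<Sum>q<Suc r. x q) \<le> d then x r else 0) \<le> d"
proof -
  have "(\<Sum>r<R. if (\<Sum>q<Suc r. x q) \<le> d then x r else 0) \<le> min (\<Sum>q<R. x q) d"
  proof (induction R)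
    case (Suc R)
    have "(\<Sum>q<R. x q) \<le> (\<Sum>q<Suc R. x q)" using assms(1) by simp
    with Suc show ?case by (auto simp: min_def split: if_splits)
  qed (use assms in simp)
  then show ?thesis by simp
qed

text \<open>Lenglart's argument on a grid. The integrand is set to zero as soon as the energy
  including the current interval exceeds \<open>d\<close>. Doob's inequality on every block and
  Markov's inequality give \<open>16 * d / e\<close> for the cut-off integral, and it coincides with
  the original one unless the total energy exceeds \<open>d\<close>.\<close>

lemma elementary_range_grid:
  assumes el: "elementary G H J" and A: "finite A" "A \<subseteq> {0..1}" "G \<inter> {0..1} \<subseteq> A" "\<And>i. i \<le> n \<Longrightarrow> real i / real n \<in> A"
    and n: "0 < n" and e: "0 < e" and d: "0 \<le> d"
  shows "prob {w\<in>space N. e < (\<Sum>i<n. (osc (\<lambda>t. J t w) (A \<inter> block n i))\<^sup>2)}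
    \<le> 16 * d / e + prob {w\<in>space N. d < (LBINT u:{0..1}. (H u w)\<^sup>2)}"
proof -
  have A01: "0 \<in> A" "1 \<in> A" using A(4)[of 0] A(4)[of n] n by auto
  then have "A \<noteq> {}" by auto
  from finite_grid_enumeration[OF A(1) this] obtain g m where
    g: "incseq g" "range g = A" "\<And>r. A \<inter> {g r<..<g (Suc r)} = {}" "\<And>r. m \<le> r \<Longrightarrow> g r = g m" by metis
  have gA: "g r \<in> A" for r using g(2) by auto
  have g01: "0 \<le> g r" "g r \<le> 1" for r using gA[of r] A(2) by auto
  have g0: "g 0 = 0"
  proof -
    obtain r where "g r = 0" using A01(1) g(2) by (metis rangeE)
    with g(1)[THEN incseqD, of 0 r] g01[of 0] show ?thesis by simp
  qed
  have gm: "g m = 1"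
  proof -
    obtain r where r: "g r = 1" using A01(2) g(2) by (metis rangeE)
    have "g r \<le> g m" using g(1)[THEN incseqD, of r m] g(4)[of r] by (cases "r \<le> m") auto
    with r g01[of m] show ?thesis by simp
  qed
  have gs: "g r \<le> g (Suc r)" for r using g(1) by (simp add: incseq_SucD)
  have "\<exists>x. elementary_on (g r) (g (Suc r)) H J x" for r
  proof -
    have "G \<inter> {g r<..<g (Suc r)} \<subseteq> A \<inter> {g r<..<g (Suc r)}"
      using A(3) g01[of r] g01[of "Suc r"] by auto
    then have "G \<inter> {g r<..<g (Suc r)} = {}" using g(3) by blast
    then show ?thesis using el g01(1)[of r] gs[of r] unfolding elementary_def by blast
  qed
  then obtain h where "\<And>r. elementary_on (g r) (g (Suc r)) H J (h r)" by metis
  note h' = this[unfolded elementary_on_def]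
  have h: "h r \<in> borel_measurable (F (g r))" "\<exists>C. \<forall>w\<in>space N. \<bar>h r w\<bar> \<le> C"
    "w \<in> space N \<Longrightarrow> g r < t \<Longrightarrow> t \<le> g (Suc r) \<Longrightarrow> H t w = h r w"
    "w \<in> space N \<Longrightarrow> J (g (Suc r)) w - J (g r) w = h r w * (W (g (Suc r)) w - W (g r) w)" for r w t
    using h'[of r] gs[of r] by auto
  define x where "x r w = (h r w)\<^sup>2 * (g (Suc r) - g r)" for r w
  define V where "V r w = (\<Sum>q<r. x q w)" for r w
  \<comment> \<open>\<open>V (Suc r)\<close> includes the interval that begins at \<open>g r\<close>
    and is still \<open>F (g r)\<close>-measurable, so the cut-off happens before the bound is
    passed and remains adapted.\<close>
  define h' where "h' r w = (if V (Suc r) w \<le> d then h r w else 0)" for r w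
  have x0: "0 \<le> x r w" for r w using gs by (simp add: x_def)
  have xa: "x q \<in> borel_measurable (F (g r))" if "q \<le> r" for q r
    unfolding x_def using F_measurable_mono[OF h(1) g(1)[THEN incseqD, OF that]] by simp
  have Va: "V (Suc r) \<in> borel_measurable (F (g r))" for r
    unfolding V_def by (intro borel_measurable_sum xa) auto
  have h'a: "h' r \<in> borel_measurable (F (g r))" for r
    unfolding h'_def using Va[of r] h(1)[of r] by measurable
  have VN: "V r \<in> borel_measurable N" for r
    unfolding V_def using xa[THEN F_measurable] by (intro borel_measurable_sum) auto
  have int: "(LBINT u:{0..1}. (H u w)\<^sup>2) = V m w" if "w \<in> space N" for w
    using set_integral_step[OF g(1), of "\<lambda>u. (H u w)\<^sup>2" "\<lambda>r. (h r w)\<^sup>2" m] h(3)[OF that] g0 gm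
    by (simp add: V_def x_def)
  interpret h': grid_integrand N F W g h'
  proof
    show "\<exists>C. \<forall>w\<in>space N. \<bar>h' r w\<bar> \<le> C" for r
    proof -
      obtain C where C: "\<And>w. w \<in> space N \<Longrightarrow> \<bar>h r w\<bar> \<le> C" using h(2) by blast
      show ?thesis by (intro exI[of _ "\<bar>C\<bar>"] ballI) (auto simp: h'_def intro: order_trans[OF C])
    qed
  qed (use g(1) g0 h'a in auto)
  \<comment> \<open>An index of the block end \<open>i / n\<close>; any choice will do, and distinct
    ends have strictly increasing indices because \<open>g\<close> is monotone.\<close>
  define P where "P i = (SOME r. g r = real i / real n)" for i
  have P: "g (P i) = real i / real n" if "i \<le> n" for i
    unfolding P_def by (rule someI_ex) (use A(4)[OF that] g(2) in \<open>metis rangeE\<close>)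
  have PS: "P i < P (Suc i)" if "i < n" for i
  proof (rule ccontr)
    assume "\<not> P i < P (Suc i)"
    then have "g (P (Suc i)) \<le> g (P i)" by (intro incseqD[OF g(1)]) simp
    then show False using P[of i] P[of "Suc i"] that n by (simp add: field_simps)
  qed
  let ?w = "\<lambda>q. expectation (\<lambda>w. (h' q w)\<^sup>2) * (g (Suc q) - g q)"
  define Q where "Q i R \<longleftrightarrow> R \<in> borel_measurable N \<and> integrable N (\<lambda>w. (R w)\<^sup>2) \<and>
     expectation (\<lambda>w. (R w)\<^sup>2) \<le> 16 * (\<Sum>q<P (Suc i) - P i. ?w (P i + q)) \<and>
     (\<forall>w. 0 \<le> R w) \<and> (\<forall>w r r'. P i \<le> r \<longrightarrow> r \<le> P (Suc i) \<longrightarrow> P i \<le> r' \<longrightarrow> r' \<le> P (Suc i) \<longrightarrow> h'.S r' w - h'.S r w \<le> R w)" for i R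
  have "\<exists>R. Q i R" if "i < n" for i
  proof -
    \<comment> \<open>Restarting the integral at the left end of the block makes Doob's bound
      involve the energy of this block only.\<close>
    interpret sh: grid_integrand N F W "\<lambda>r. g (P i + r)" "\<lambda>r. h' (P i + r)"
      by unfold_locales (use g(1) g01 h'a h'.h_bdd in \<open>auto simp: incseq_def\<close>)
    have shS: "sh.S r w = h'.S (P i + r) w - h'.S (P i) w" for r w
      by (induction r) (simp_all add: sh.S_def h'.S_def)
    from sh.doob_range[of "P (Suc i) - P i"] obtain R where R0: "R \<in> borel_measurable N"
      and R1: "integrable N (\<lambda>w. (R w)\<^sup>2) \<and>
        expectation (\<lambda>w. (R w)\<^sup>2) \<le> 16 * (\<Sum>q<P (Suc i) - P i. expectation (\<lambda>w. (h' (P i + q) w)\<^sup>2) * (g (P i + Suc q) - g (P i + q))) \<and>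
        (\<forall>w. 0 \<le> R w \<and> (\<forall>r\<le>P (Suc i) - P i. \<forall>r'\<le>P (Suc i) - P i. sh.S r' w - sh.S r w \<le> R w))" ..
    have R: "R \<in> borel_measurable N" "integrable N (\<lambda>w. (R w)\<^sup>2)"
      "expectation (\<lambda>w. (R w)\<^sup>2) \<le> 16 * (\<Sum>q<P (Suc i) - P i. ?w (P i + q))"
      "\<And>w. 0 \<le> R w" "\<And>w r r'. r \<le> P (Suc i) - P i \<Longrightarrow> r' \<le> P (Suc i) - P i \<Longrightarrow> sh.S r' w - sh.S r w \<le> R w"
    proof -
      show "R \<in> borel_measurable N" by (rule R0)
      show "integrable N (\<lambda>w. (R w)\<^sup>2)" using R1 by (rule conjunct1)
      show "expectation (\<lambda>w. (R w)\<^sup>2) \<le> 16 * (\<Sum>q<P (Suc i) - P i. ?w (P i + q))"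
        using R1[THEN conjunct2, THEN conjunct1] unfolding add_Suc_right .
      fix w
      show "0 \<le> R w" using R1[THEN conjunct2, THEN conjunct2] by (rule allE) (erule conjunct1)
      fix r r' assume "r \<le> P (Suc i) - P i" "r' \<le> P (Suc i) - P i"
      with R1[THEN conjunct2, THEN conjunct2, THEN spec, of w] show "sh.S r' w - sh.S r w \<le> R w" by blast
    qed
    show ?thesis unfolding Q_def
    proof (intro exI[of _ R] conjI allI impI R)
      fix w r r' assume "P i \<le> r" "r \<le> P (Suc i)" "P i \<le> r'" "r' \<le> P (Suc i)"
      then show "h'.S r' w - h'.S r w \<le> R w"
        using R(5)[of "r - P i" "r' - P i" w] by (simp add: shS)
    qed
  qed
  then have "\<forall>i. \<exists>R. i < n \<longrightarrow> Q i R" by blast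
  from choice[OF this] obtain R where Q: "\<And>i. i < n \<Longrightarrow> Q i (R i)" by blast
  have R: "\<And>i. i < n \<Longrightarrow> R i \<in> borel_measurable N" "\<And>i. i < n \<Longrightarrow> integrable N (\<lambda>w. (R i w)\<^sup>2)"
    "\<And>i. i < n \<Longrightarrow> expectation (\<lambda>w. (R i w)\<^sup>2) \<le> 16 * (\<Sum>q<P (Suc i) - P i. ?w (P i + q))"
    "\<And>i w. i < n \<Longrightarrow> 0 \<le> R i w"
    "\<And>i w r r'. i < n \<Longrightarrow> P i \<le> r \<Longrightarrow> r \<le> P (Suc i) \<Longrightarrow> P i \<le> r' \<Longrightarrow> r' \<le> P (Suc i) \<Longrightarrow> h'.S r' w - h'.S r w \<le> R i w"
    using Q unfolding Q_def by simp_all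
  let ?R = "\<lambda>w. \<Sum>i<n. (R i w)\<^sup>2"
  have iR: "integrable N ?R" using R(2) by auto
  have ih: "integrable N (\<lambda>w. (h' q w)\<^sup>2)" for q by (rule h'.h_sq_integrable)
  have "expectation ?R = (\<Sum>i<n. expectation (\<lambda>w. (R i w)\<^sup>2))"
    using R(2) by (intro Bochner_Integration.integral_sum) auto
  also have "\<dots> \<le> (\<Sum>i<n. 16 * (\<Sum>q<P (Suc i) - P i. ?w (P i + q)))"
    using R(3) by (intro sum_mono) auto
  also have "\<dots> = 16 * (\<Sum>q=P 0..<P n. ?w q)"
    using telescope_blocks[of n P ?w] PS by (simp add: sum_distrib_left[symmetric] less_imp_le)
  also have "(\<Sum>q=P 0..<P n. ?w q) \<le> (\<Sum>q<P n. ?w q)"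
    by (rule sum_mono2) (use gs in \<open>auto intro!: mult_nonneg_nonneg\<close>)
  also have "(\<Sum>q<P n. ?w q) = expectation (\<lambda>w. \<Sum>q<P n. (h' q w)\<^sup>2 * (g (Suc q) - g q))"
    using ih by (simp add: Bochner_Integration.integral_sum)
  also have "\<dots> \<le> expectation (\<lambda>w. d)"
  proof (rule integral_mono)
    fix w
    have "(\<Sum>q<P n. (h' q w)\<^sup>2 * (g (Suc q) - g q)) = (\<Sum>r<P n. if (\<Sum>q<Suc r. x q w) \<le> d then x r w else 0)"
      by (rule sum.cong) (auto simp: h'_def V_def x_def)
    also have "\<dots> \<le> d" by (rule truncated_sum_le[OF x0 d])
    finally show "(\<Sum>q<P n. (h' q w)\<^sup>2 * (g (Suc q) - g q)) \<le> d" .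
  qed (use ih in auto)
  finally have ER: "expectation ?R \<le> 16 * d" by (simp add: prob_space)
  have le: "(\<Sum>i<n. (osc (\<lambda>t. J t w) (A \<inter> block n i))\<^sup>2) \<le> ?R w" if w: "w \<in> space N" and V: "V m w \<le> d" for w
  proof (rule sum_mono)
    \<comment> \<open>Beyond \<open>m\<close> the grid repeats its last point and no energy is
      added, so \<open>V m w \<le> d\<close> prevents the cut-off at every index.\<close>
    have "V r w \<le> V m w" for r
    proof (cases "r \<le> m")
      case True then show ?thesis unfolding V_def using x0 by (intro sum_mono2) auto
    next
      case False
      have "x q w = 0" if "m \<le> q" for q
        unfolding x_def g(4)[OF that] g(4)[OF le_SucI[OF that]] by simp
      then have "V r w = V m w" unfolding V_def
        by (intro sum.mono_neutral_right) (use False in auto)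
      then show ?thesis by simp
    qed
    with V have hh: "h' r w = h r w" for r by (auto simp: h'_def intro: order_trans)
    have JS: "J (g r) w = J (g 0) w + h'.S r w" for r
    proof (induction r)
      case (Suc r) with h(4)[OF w, of r] show ?case by (simp add: h'.S_def hh)
    qed (simp add: h'.S_def)
    fix i assume "i \<in> {..<n}"
    then have i: "i < n" by simp
    \<comment> \<open>An index outside the range from \<open>P i\<close> to \<open>P (Suc i)\<close>
      can only represent an end point of the block, since \<open>g\<close> is monotone; it is then
      replaced by the corresponding end index.\<close>
    have idx: "\<exists>r. P i \<le> r \<and> r \<le> P (Suc i) \<and> g r = t" if t: "t \<in> A \<inter> block n i" for t
    proof -
      obtain r where r: "g r = t" using t g(2) by (metis IntD1 rangeE)
      have b: "g (P i) \<le> g r" "g r \<le> g (P (Suc i))" using t r P[of i] P[of "Suc i"] i by auto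
      consider "r < P i" | "P (Suc i) < r" | "P i \<le> r" "r \<le> P (Suc i)" by linarith
      then show ?thesis
      proof cases
        case 1
        with g(1)[THEN incseqD, of r "P i"] b r PS[OF i] show ?thesis by (intro exI[of _ "P i"]) auto
      next
        case 2
        with g(1)[THEN incseqD, of "P (Suc i)" r] b r PS[OF i] show ?thesis by (intro exI[of _ "P (Suc i)"]) auto
      next
        case 3 with r show ?thesis by auto
      qed
    qed
    have ne: "A \<inter> block n i \<noteq> {}" using A(4)[of i] i block_nonempty[of i n] by auto
    have up: "osc (\<lambda>t. J t w) (A \<inter> block n i) \<le> R i w"
    proof (rule osc_least[OF ne])
      fix s t assume "s \<in> A \<inter> block n i" "t \<in> A \<inter> block n i"
      with idx obtain r r' where "P i \<le> r" "r \<le> P (Suc i)" "g r = s" "P i \<le> r'" "r' \<le> P (Suc i)" "g r' = t" by metis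
      then show "J t w - J s w \<le> R i w" using R(5)[OF i, of r r' w] JS[of r] JS[of r'] by auto
    qed
    have "0 \<le> osc (\<lambda>t. J t w) (A \<inter> block n i)"
      by (rule osc_nonneg[OF _ ne]) (use A(1) in \<open>auto intro: finite_imp_bounded\<close>)
    with up show "(osc (\<lambda>t. J t w) (A \<inter> block n i))\<^sup>2 \<le> (R i w)\<^sup>2" by (rule power_mono)
  qed
  have "prob {w\<in>space N. e < (\<Sum>i<n. (osc (\<lambda>t. J t w) (A \<inter> block n i))\<^sup>2)}
      \<le> prob ({w\<in>space N. e < ?R w} \<union> {w\<in>space N. d < V m w})"
  proof (rule finite_measure_mono)
    show "{w\<in>space N. e < (\<Sum>i<n. (osc (\<lambda>t. J t w) (A \<inter> block n i))\<^sup>2)}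
      \<subseteq> {w\<in>space N. e < ?R w} \<union> {w\<in>space N. d < V m w}"
    proof
      fix w assume *: "w \<in> {w\<in>space N. e < (\<Sum>i<n. (osc (\<lambda>t. J t w) (A \<inter> block n i))\<^sup>2)}"
      then have w: "w \<in> space N" by simp
      show "w \<in> {w\<in>space N. e < ?R w} \<union> {w\<in>space N. d < V m w}"
      proof (cases "V m w \<le> d")
        case True
        from le[OF w True] * have "e < ?R w" by simp
        with w show ?thesis by simp
      next
        case False with w show ?thesis by simp
      qed
    qed
  qed (use iR VN in measurable)
  also have "\<dots> \<le> prob {w\<in>space N. e < ?R w} + prob {w\<in>space N. d < V m w}"
    by (rule measure_Un_le) (use iR VN in measurable)
  also have "prob {w\<in>space N. e < ?R w} \<le> 16 * d / e"
    by (rule prob_markov[OF iR _ e ER]) (simp add: sum_nonneg)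
  also have "{w\<in>space N. d < V m w} = {w\<in>space N. d < (LBINT u:{0..1}. (H u w)\<^sup>2)}"
    using int by auto
  finally show ?thesis by simp
qed

text \<open>The grid bound does not depend on the grid. Applied to grids made of the dyadic points
  of all blocks together with \<open>G\<close>, it survives the limit, in which the grid ranges
  become the ranges of the continuous path.\<close>

lemma elementary_range_prob:
  assumes el: "elementary G H J" and G: "finite G"
    and J: "\<And>t. 0 \<le> t \<Longrightarrow> J t \<in> borel_measurable N" "AE w in N. continuous_on {0..1} (\<lambda>t. J t w)"
    and n: "0 < n" and e: "0 < e" and d: "0 \<le> d"
  shows "prob {w\<in>space N. e < (block_norm n (\<lambda>t. J t w))\<^sup>2}
    \<le> 16 * d / e + prob {w\<in>space N. d < (LBINT u:{0..1}. (H u w)\<^sup>2)}"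
proof -
  define A where "A l = (\<Union>i<n. dyad (real i / real n) (real (Suc i) / real n) l) \<union> (G \<inter> {0..1})" for l
  have Af: "finite (A l)" for l using G by (auto simp: A_def)
  have A01: "A l \<subseteq> {0..1}" for l
  proof -
    have "dyad (real i / real n) (real (Suc i) / real n) l \<subseteq> {0..1}" if "i < n" for i
      using dyad_subset[OF block_nonempty[of i n]] block_subset[OF that] by (rule subset_trans)
    then show ?thesis by (auto simp: A_def)
  qed
  have Ai: "real i / real n \<in> A l" if "i \<le> n" for i l
  proof (cases "i < n")
    case True
    have "real i / real n \<in> dyad (real i / real n) (real (Suc i) / real n) l"
      unfolding dyad_def by (rule image_eqI[of _ _ 0]) auto
    with True show ?thesis by (auto simp: A_def)
  next
    case False
    with that n have i: "i = Suc (n - 1)" by simp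
    have "real (Suc (n - 1)) / real n \<in> dyad (real (n - 1) / real n) (real (Suc (n - 1)) / real n) l"
      unfolding dyad_def by (rule image_eqI[of _ _ "2 ^ l"]) auto
    then have "real (Suc (n - 1)) / real n \<in> A l" unfolding A_def using n by (intro UnI1 UN_I[of "n - 1"]) simp
    then show ?thesis using i by metis
  qed
  show ?thesis
  proof (rule prob_limit_le[where X = "\<lambda>l w. \<Sum>i<n. (osc (\<lambda>t. J t w) (A l \<inter> block n i))\<^sup>2"])
    show "(\<lambda>w. \<Sum>i<n. (osc (\<lambda>t. J t w) (A l \<inter> block n i))\<^sup>2) \<in> borel_measurable N" for l
      using Af[of l] A01[of l] J(1) by (intro borel_measurable_sum borel_measurable_power osc_measurable_finite) auto
    show "AE w in N. (\<lambda>l. \<Sum>i<n. (osc (\<lambda>t. J t w) (A l \<inter> block n i))\<^sup>2) \<longlonglongrightarrow> (block_norm n (\<lambda>t. J t w))\<^sup>2"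
      using J(2)
    proof eventually_elim
      case (elim w)
      show ?case unfolding block_norm_square
      proof (intro tendsto_sum tendsto_power osc_grid_tendsto)
        fix i l assume "i \<in> {..<n}"
        then show "continuous_on (block n i) (\<lambda>t. J t w)"
          using elim block_subset[of i n] continuous_on_subset by blast
        show "dyad (real i / real n) (real (Suc i) / real n) l \<subseteq> A l \<inter> block n i"
          using \<open>i \<in> {..<n}\<close> dyad_subset[OF block_nonempty[of i n], of l] by (auto simp: A_def)
      qed (use block_nonempty in auto)
    qed
    show "prob {w\<in>space N. e < (\<Sum>i<n. (osc (\<lambda>t. J t w) (A l \<inter> block n i))\<^sup>2)}
      \<le> 16 * d / e + prob {w\<in>space N. d < (LBINT u:{0..1}. (H u w)\<^sup>2)}" for l
      by (rule elementary_range_grid[OF el Af A01 _ Ai n e d]) (auto simp: A_def)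
  qed
qed

end

section \<open>Grid ranges of Brownian motion\<close>

lemma osc_image: "osc f (g ` A) = osc (\<lambda>x. f (g x)) A"
proof -
  have "(\<lambda>(s, t). f t - f s) ` (g ` A \<times> g ` A) = (\<lambda>(s, t). f (g t) - f (g s)) ` (A \<times> A)"
    by (force simp: image_iff)
  then show ?thesis by (simp add: osc_def)
qed

text \<open>Adding one variable produces a cross term that factorises by independence and vanishes
  by centring; the new square is at most \<open>K\<^sup>2\<close>.\<close>

lemma (in prob_space) indep_centered_sum_square:
  fixes Y :: "'i \<Rightarrow> 'a \<Rightarrow> real" and K :: real
  assumes "finite I" "indep_vars (\<lambda>_. borel) Y I"
    and "\<And>i w. i \<in> I \<Longrightarrow> \<bar>Y i w\<bar> \<le> K" and "\<And>i. i \<in> I \<Longrightarrow> expectation (Y i) = 0"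
  shows "expectation (\<lambda>w. (\<Sum>i\<in>I. Y i w)\<^sup>2) \<le> card I * K\<^sup>2"
  using assms
proof (induction I)
  case empty then show ?case by simp
next
  case (insert i I)
  let ?T = "\<lambda>w. \<Sum>i\<in>I. Y i w"
  have m: "Y j \<in> borel_measurable M" if "j \<in> insert i I" for j
    using insert.prems(1) that by (auto simp: indep_vars_def)
  have mT: "?T \<in> borel_measurable M" using m by auto
  have iY: "integrable M (Y j)" if "j \<in> insert i I" for j
    by (rule integrable_const_bound[of _ K]) (use m that insert.prems(2) in auto)
  have "\<bar>?T w\<bar> \<le> card I * K" for w
  proof -
    have "\<bar>?T w\<bar> \<le> (\<Sum>i\<in>I. \<bar>Y i w\<bar>)" by (rule sum_abs)
    also have "\<dots> \<le> (\<Sum>i\<in>I. K)" using insert.prems(2) by (intro sum_mono) auto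
    finally show ?thesis by simp
  qed
  note Tb = this
  have iT: "integrable M ?T" using iY by auto
  have iT2: "integrable M (\<lambda>w. (?T w)\<^sup>2)"
  proof (rule integrable_const_bound[of _ "(card I * K)\<^sup>2"])
    show "AE w in M. norm ((?T w)\<^sup>2) \<le> (card I * K)\<^sup>2"
    proof (rule AE_I2)
      fix w
      have "\<bar>?T w\<bar>\<^sup>2 \<le> (card I * K)\<^sup>2" using Tb[of w] by (intro power_mono) auto
      then show "norm ((?T w)\<^sup>2) \<le> (card I * K)\<^sup>2" by simp
    qed
  qed (use mT in auto)
  have Y2: "(Y i w)\<^sup>2 \<le> K\<^sup>2" for w
    using power_mono[of "\<bar>Y i w\<bar>" K 2] insert.prems(2)[of i w] by simp
  have iY2: "integrable M (\<lambda>w. (Y i w)\<^sup>2)"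
    by (rule integrable_const_bound[of _ "K\<^sup>2"]) (use m Y2 in auto)
  have ind: "indep_var borel (Y i) borel ?T"
    by (rule indep_vars_sum) (use insert in auto)
  have cross: "integrable M (\<lambda>w. Y i w * ?T w)" "expectation (\<lambda>w. Y i w * ?T w) = 0"
    using indep_var_integrable[OF ind iY iT] indep_var_lebesgue_integral[OF ind iY iT] insert.prems(3)[of i] by auto
  have IH: "expectation (\<lambda>w. (?T w)\<^sup>2) \<le> card I * K\<^sup>2"
    by (rule insert.IH) (use insert.prems in \<open>auto intro: indep_vars_subset\<close>)
  have "expectation (\<lambda>w. (Y i w)\<^sup>2) \<le> expectation (\<lambda>w. K\<^sup>2)"
    by (intro integral_mono iY2 Y2) auto
  then have "expectation (\<lambda>w. (Y i w)\<^sup>2) \<le> K\<^sup>2" by (simp add: prob_space)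
  moreover have "(\<lambda>w. (\<Sum>i\<in>insert i I. Y i w)\<^sup>2) = (\<lambda>w. (Y i w)\<^sup>2 + 2 * (Y i w * ?T w) + (?T w)\<^sup>2)"
    using insert.hyps by (auto simp: power2_eq_square algebra_simps)
  ultimately show ?case
    using iY2 cross iT2 IH insert.hyps by (simp add: algebra_simps)
qed

context brownian_setup begin

text \<open>The pointwise \<open>lim\<close> is measurable everywhere and differs from
  \<open>Y\<close> only inside a null set, all of whose subsets are measurable by completeness. With
  a constant sequence this covers functions that agree almost everywhere with a measurable
  one.\<close>

lemma AE_limit_measurable:
  fixes X :: "nat \<Rightarrow> 'a \<Rightarrow> real"
  assumes X: "\<And>l. X l \<in> borel_measurable N" and lim: "AE w in N. (\<lambda>l. X l w) \<longlonglongrightarrow> Y w"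
  shows "Y \<in> borel_measurable N"
proof -
  define Z where "Z w = lim (\<lambda>l. X l w)" for w
  have Z: "Z \<in> borel_measurable N" unfolding Z_def by (rule borel_measurable_lim_metric[OF X])
  obtain E where E: "{w\<in>space N. \<not> (\<lambda>l. X l w) \<longlonglongrightarrow> Y w} \<subseteq> E" "emeasure N E = 0" "E \<in> sets N"
    using AE_E[OF lim] by blast
  then have E0: "E \<in> null_sets N" by auto
  have YZ: "Y w = Z w" if "w \<in> space N - E" for w
    using that E(1) unfolding Z_def by (intro limI[symmetric]) blast
  show ?thesis
  proof (rule measurableI)
    fix A :: "real set" assume A: "A \<in> sets borel"
    have "Y -` A \<inter> space N = (Z -` A \<inter> space N - E) \<union> (Y -` A \<inter> space N \<inter> E)"
      using YZ by auto
    also have "\<dots> \<in> sets N"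
      using measurable_sets[OF Z A] E(3) complete[OF E0, of "Y -` A \<inter> space N \<inter> E"] by auto
    finally show "Y -` A \<inter> space N \<in> sets N" .
  qed auto
qed

lemma osc_path_measurable:
  fixes X :: "real \<Rightarrow> 'a \<Rightarrow> real"
  assumes X: "\<And>t. t \<in> {a..b} \<Longrightarrow> X t \<in> borel_measurable N" and c: "AE w in N. continuous_on {a..b} (\<lambda>t. X t w)" and ab: "a \<le> b"
  shows "(\<lambda>w. osc (\<lambda>t. X t w) {a..b}) \<in> borel_measurable N"
proof (rule AE_limit_measurable)
  show "(\<lambda>w. osc (\<lambda>t. X t w) (dyad a b l)) \<in> borel_measurable N" for l
    by (rule osc_measurable_finite) (use X dyad_subset[OF ab, of l] in auto)
  show "AE w in N. (\<lambda>l. osc (\<lambda>t. X t w) (dyad a b l)) \<longlonglongrightarrow> osc (\<lambda>t. X t w) {a..b}"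
    using c by eventually_elim (rule osc_grid_tendsto; use ab dyad_subset[OF ab] in simp)
qed

abbreviation W_osc :: "'a \<Rightarrow> real set \<Rightarrow> real" where
  "W_osc w \<equiv> osc (\<lambda>t. W t w)"

lemma W_cont_Icc: "0 \<le> a \<Longrightarrow> AE w in N. continuous_on {a..b} (\<lambda>t. W t w)"
  using W_cont by eventually_elim (rule continuous_path_Icc)

text \<open>Events about the first n increments lie in the filtration at the start of the next one,
  so the product formula can be iterated. The induction carries the membership in \<open>F\<close>
  along for this purpose.\<close>

lemma increments_indep:
  assumes "0 \<le> a" "0 < d" "0 < m"
  shows "indep_vars (\<lambda>_. borel) (\<lambda>k w. W (a + d * real (Suc k)) w - W (a + d * real k) w) {..<m::nat}"
proof -
  let ?X = "\<lambda>k w. W (a + d * real (Suc k)) w - W (a + d * real k) w"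
  have t: "0 \<le> a + d * real k" for k using assms by simp
  have mX: "?X k \<in> borel_measurable N" for k using W_measurable[OF t[of k]] W_measurable[OF t[of "Suc k"]] by (rule borel_measurable_diff[rotated])
  have step: "a + d * real k < a + d * real (Suc k)" for k using assms by (simp add: algebra_simps)
  have mono: "a + d * real k \<le> a + d * real l" if "k \<le> l" for k l using that assms by simp
  have main: "(space N \<inter> (\<Inter>k<n. A k)) \<in> sets (F (a + d * real n)) \<and>
      prob (space N \<inter> (\<Inter>k<n. A k)) = (\<Prod>k<n. prob (A k))"
    if "\<And>k. k < n \<Longrightarrow> A k \<in> {?X k -` B \<inter> space N |B. B \<in> sets borel}" for n A
    using that
  proof (induction n)
    case 0
    have "space N \<in> sets (F a)" using sets.top[of "F a"] space_F by simp
    then show ?case by (simp add: prob_space)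
  next
    case (Suc n)
    then have IH: "(space N \<inter> (\<Inter>k<n. A k)) \<in> sets (F (a + d * real n))"
      "prob (space N \<inter> (\<Inter>k<n. A k)) = (\<Prod>k<n. prob (A k))" by auto
    obtain B where B: "A n = ?X n -` B \<inter> space N" "B \<in> sets borel" using Suc.prems[of n] by auto
    have "?X n \<in> borel_measurable (F (a + d * real (Suc n)))"
      by (intro borel_measurable_diff W_adapted t F_measurable_mono[OF W_adapted[OF t]] mono) auto
    then have An: "A n \<in> sets (F (a + d * real (Suc n)))"
      using measurable_sets[of "?X n" "F (a + d * real (Suc n))" borel B] B space_F by simp
    have eq: "space N \<inter> (\<Inter>k<Suc n. A k) = (space N \<inter> (\<Inter>k<n. A k)) \<inter> A n"
      by (auto simp: lessThan_Suc)
    have "(space N \<inter> (\<Inter>k<n. A k)) \<in> sets (F (a + d * real (Suc n)))" using IH(1) F_mono[OF mono[of n "Suc n"]] by auto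
    then have "space N \<inter> (\<Inter>k<Suc n. A k) \<in> sets (F (a + d * real (Suc n)))" unfolding eq using An by (rule sets.Int)
    moreover have "prob (space N \<inter> (\<Inter>k<Suc n. A k)) = (\<Prod>k<Suc n. prob (A k))"
      unfolding eq B(1) using W_indep[OF t step IH(1) B(2)] IH(2) by (simp add: B(1) mult.commute)
    ultimately show ?case by blast
  qed
  \<comment> \<open>Each system of preimages contains the whole space, so it suffices to test
    intersections over the full index set.\<close>
  show ?thesis unfolding indep_vars_def2
  proof (intro conjI ballI mX indep_sets_finite[THEN iffD2])
    fix A assume A: "A \<in> Pi {..<m} (\<lambda>k. {?X k -` B \<inter> space N |B. B \<in> sets borel})"
    have *: "\<And>k. k < m \<Longrightarrow> A k \<in> {?X k -` B \<inter> space N |B. B \<in> sets borel}" using Pi_mem[OF A] by blast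
    have "A 0 \<subseteq> space N" using *[of 0] assms by auto
    then have "(\<Inter>k\<in>{..<m}. A k) = space N \<inter> (\<Inter>k<m. A k)" using assms(3) by auto
    then show "prob (\<Inter>k\<in>{..<m}. A k) = (\<Prod>k\<in>{..<m}. prob (A k))" using main[of m A, OF *] by simp
  next
    fix k show "{?X k -` A \<inter> space N |A. A \<in> sets borel} \<subseteq> events"
      using measurable_sets[OF mX] by auto
    show "space N \<in> {?X k -` A \<inter> space N |A. A \<in> sets borel}"
      by (auto intro!: exI[of _ UNIV])
  qed (use assms in auto)
qed

text \<open>Brownian scaling for vectors: increments over a mesh of \<open>h / m\<close>, divided by
  \<open>sqrt h\<close>, are independent normal variables of variance \<open>1 / m\<close>. The
  right-hand side mentions neither \<open>a\<close> nor \<open>h\<close>.\<close>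

lemma scaled_increments_law:
  assumes "0 \<le> a" "0 < h" "0 < m" and \<phi>: "\<phi> \<in> borel_measurable (PiM {..<m} (\<lambda>_. borel))"
  shows "expectation (\<lambda>w. \<phi> (\<lambda>k\<in>{..<m}. (W (a + h / m * real (Suc k)) w - W (a + h / m * real k) w) / sqrt h))
    = (\<integral>x. \<phi> x \<partial>PiM {..<m} (\<lambda>_. density lborel (normal_density 0 (sqrt (1 / real m)))) :: real)"
proof -
  let ?X = "\<lambda>k w. W (a + h / m * real (Suc k)) w - W (a + h / m * real k) w"
  let ?Z = "\<lambda>k w. ?X k w / sqrt h"
  have "indep_vars (\<lambda>_. borel) ?X {..<m}" using assms by (intro increments_indep) auto
  from indep_vars_compose2[OF this, of "\<lambda>_ x. x / sqrt h"]
  have ind: "indep_vars (\<lambda>_. borel) ?Z {..<m}" by simp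
  then have mZ: "?Z k \<in> borel_measurable N" if "k \<in> {..<m}" for k using that by (auto simp: indep_vars_def)
  have law: "distr N borel (?Z k) = density lborel (normal_density 0 (sqrt (1 / real m)))" for k
  proof -
    have D: "distributed N lborel (?X k) (normal_density 0 (sqrt (h / m)))"
      using W_distr[of "a + h / m * real k" "a + h / m * real (Suc k)"] assms by (simp add: algebra_simps add_divide_distrib)
    have "distributed N lborel (\<lambda>w. 0 + (1 / sqrt h) * ?X k w) (normal_density (0 + (1 / sqrt h) * 0) (\<bar>1 / sqrt h\<bar> * sqrt (h / m)))"
      by (rule normal_density_affine[OF D]) (use assms in auto)
    then have "distributed N lborel (?Z k) (normal_density 0 (sqrt (1 / real m)))"
      using assms by (simp add: real_sqrt_divide)
    from distributed_distr_eq_density[OF this] distr_cong[of N N borel lborel "?Z k" "?Z k"] show ?thesis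
      by simp
  qed
  have ne: "{..<m} \<noteq> {}" using assms by auto
  have "distr N (PiM {..<m} (\<lambda>_. borel)) (\<lambda>w. \<lambda>k\<in>{..<m}. ?Z k w) = PiM {..<m} (\<lambda>k. distr N borel (?Z k))"
    by (rule indep_vars_iff_distr_eq_PiM'[THEN iffD1, OF ne mZ ind])
  also have "\<dots> = PiM {..<m} (\<lambda>_. density lborel (normal_density 0 (sqrt (1 / real m))))"
    by (intro PiM_cong refl law)
  finally have "distr N (PiM {..<m} (\<lambda>_. borel)) (\<lambda>w. \<lambda>k\<in>{..<m}. ?Z k w) =
    PiM {..<m} (\<lambda>_. density lborel (normal_density 0 (sqrt (1 / real m))))" .
  note D = this[symmetric]
  have mV: "(\<lambda>w. \<lambda>k\<in>{..<m}. ?Z k w) \<in> N \<rightarrow>\<^sub>M PiM {..<m} (\<lambda>_. borel)"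
    by (rule measurable_restrict) (rule mZ)
  show ?thesis unfolding D by (rule integral_distr[symmetric, OF mV \<phi>])
qed

lemma W_grid_sum:
  "W (a + d * real j) w - W a w = (\<Sum>k<j. W (a + d * real (Suc k)) w - W (a + d * real k) w)"
  by (induction j) auto

text \<open>Only differences enter \<open>osc\<close>, so the path may be replaced by partial sums
  of its increments. The restriction to \<open>{..<2 ^ l}\<close> presents the vector in the form
  required by the product measure.\<close>

lemma osc_W_dyad:
  assumes "0 < h"
  shows "(W_osc w (dyad a (a + h) l))\<^sup>2 / h =
    (osc (\<lambda>j. \<Sum>k<j. (\<lambda>k\<in>{..<2 ^ l}. (W (a + h / real (2 ^ l) * real (Suc k)) w - W (a + h / real (2 ^ l) * real k) w) / sqrt h) k) {..2 ^ l})\<^sup>2"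
proof -
  let ?d = "h / real (2 ^ l)"
  let ?X = "\<lambda>k. W (a + ?d * real (Suc k)) w - W (a + ?d * real k) w"
  have "W_osc w (dyad a (a + h) l) = osc (\<lambda>j. W (a + ?d * real j) w) {..2 ^ l}"
    by (simp add: dyad_def osc_image)
  also have "\<dots> = osc (\<lambda>j. sqrt h * (\<Sum>k<j. (\<lambda>k\<in>{..<2 ^ l}. ?X k / sqrt h) k)) {..2 ^ l}"
  proof (rule osc_cong)
    fix i j :: nat assume ij: "i \<in> {..2 ^ l}" "j \<in> {..2 ^ l}"
    have *: "W (a + ?d * real j) w - W a w = sqrt h * (\<Sum>k<j. (\<lambda>k\<in>{..<2 ^ l}. ?X k / sqrt h) k)" if "j \<in> {..2 ^ l}" for j
    proof -
      have e1: "(\<Sum>k<j. (\<lambda>k\<in>{..<2 ^ l}. ?X k / sqrt h) k) = (\<Sum>k<j. ?X k / sqrt h)"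
        using that by (intro sum.cong) auto
      have e2: "sqrt h * (\<Sum>k<j. ?X k / sqrt h) = (\<Sum>k<j. ?X k)" using assms by (simp add: sum_distrib_left)
      show ?thesis unfolding e1 e2 by (rule W_grid_sum)
    qed
    show "W (a + ?d * real j) w - W (a + ?d * real i) w =
      sqrt h * (\<Sum>k<j. (\<lambda>k\<in>{..<2 ^ l}. ?X k / sqrt h) k) - sqrt h * (\<Sum>k<i. (\<lambda>k\<in>{..<2 ^ l}. ?X k / sqrt h) k)"
      using *[OF ij(1)] *[OF ij(2)] by linarith
  qed
  also have "\<dots> = sqrt h * osc (\<lambda>j. \<Sum>k<j. (\<lambda>k\<in>{..<2 ^ l}. ?X k / sqrt h) k) {..2 ^ l}"
    by (subst osc_cmult) (use assms in \<open>auto intro: finite_imp_bounded\<close>)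
  finally show ?thesis using assms by (simp add: power_mult_distrib)
qed

text \<open>The offset \<open>c\<close> selects the increments of one block from the vector of all
  increments.\<close>

lemma osc_partial_sums_measurable:
  assumes "\<And>k. k < m \<Longrightarrow> c + k \<in> K"
  shows "(\<lambda>x. osc (\<lambda>j. \<Sum>k<j. x (c + k)) {..m::nat}) \<in> borel_measurable (PiM K (\<lambda>_. borel :: real measure))"
  unfolding osc_def case_prod_beta
proof (intro borel_measurable_cSUP borel_measurable_diff borel_measurable_sum)
  fix i k assume "i \<in> {..m} \<times> {..m}" 
  { assume "k \<in> {..<snd i}"
    then have "c + k \<in> K" using \<open>i \<in> _\<close> by (intro assms) auto
    then show "(\<lambda>x. x (c + k)) \<in> borel_measurable (PiM K (\<lambda>_. borel :: real measure))" by (rule measurable_component_singleton) }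
  { assume "k \<in> {..<fst i}"
    then have "c + k \<in> K" using \<open>i \<in> _\<close> by (intro assms) auto
    then show "(\<lambda>x. x (c + k)) \<in> borel_measurable (PiM K (\<lambda>_. borel :: real measure))" by (rule measurable_component_singleton) }
qed (auto intro: countable_finite)

definition trunc_moment :: "nat \<Rightarrow> real \<Rightarrow> real" where
  "trunc_moment l K = expectation (\<lambda>w. min ((W_osc w (dyad 0 1 l))\<^sup>2) K)"

lemma osc_W_dyad_moment:
  assumes "0 \<le> a" "0 < h"
  shows "expectation (\<lambda>w. min ((W_osc w (dyad a (a + h) l))\<^sup>2 / h) K) = trunc_moment l K"
proof -
  let ?\<phi> = "\<lambda>x. min ((osc (\<lambda>j. \<Sum>k<j. x k) {..(2::nat) ^ l})\<^sup>2) K :: real"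
  have \<phi>: "?\<phi> \<in> borel_measurable (PiM {..<(2::nat) ^ l} (\<lambda>_. borel))"
    using osc_partial_sums_measurable[of "2 ^ l" 0 "{..<2 ^ l}"] by simp
  have *: "expectation (\<lambda>w. min ((W_osc w (dyad a (a + h) l))\<^sup>2 / h) K) =
    (\<integral>x. ?\<phi> x \<partial>PiM {..<(2::nat) ^ l} (\<lambda>_. density lborel (normal_density 0 (sqrt (1 / real (2 ^ l))))))"
    if "0 \<le> a" "0 < h" for a h
    unfolding osc_W_dyad[OF that(2)] by (rule scaled_increments_law[OF that _ \<phi>]) simp
  show ?thesis
    unfolding *[OF assms] trunc_moment_def using *[of 0 1] by simp
qed

end

section \<open>Law of large numbers for squared ranges\<close>

lemma min_centered_bound: "0 \<le> x \<Longrightarrow> 0 \<le> c \<Longrightarrow> c \<le> K \<Longrightarrow> \<bar>min x K - c\<bar> \<le> (K :: real)"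
  by (auto simp: min_def)

context brownian_setup begin

text \<open>If the square were not integrable, this integral would be 0 by convention; integrability
  is supplied by \<open>osc_W_second_moment\<close>.\<close>

definition lam2 :: real where
  "lam2 = expectation (\<lambda>w. (W_osc w {0..1})\<^sup>2)"

definition trunc_lam2 :: "real \<Rightarrow> real" where
  "trunc_lam2 K = expectation (\<lambda>w. min ((W_osc w {0..1})\<^sup>2) K)"

lemma osc_W_measurable: "0 \<le> a \<Longrightarrow> a \<le> b \<Longrightarrow> (\<lambda>w. W_osc w {a..b}) \<in> borel_measurable N"
  by (rule osc_path_measurable) (auto intro: W_measurable W_cont_Icc)

lemma osc_W_dyad_measurable: "0 \<le> a \<Longrightarrow> a \<le> b \<Longrightarrow> (\<lambda>w. W_osc w (dyad a b l)) \<in> borel_measurable N"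
  by (rule osc_measurable_finite) (use dyad_subset[of a b l] in \<open>auto intro!: W_measurable\<close>)

lemma osc_W_dyad_tendsto:
  assumes "0 \<le> a" "a \<le> b"
  shows "AE w in N. (\<lambda>l. W_osc w (dyad a b l)) \<longlonglongrightarrow> W_osc w {a..b}"
  using W_cont_Icc[OF assms(1)] by eventually_elim (rule osc_grid_tendsto; use assms dyad_subset[OF assms(2)] in simp)

lemma trunc_moment_tendsto:
  assumes "0 \<le> a" "0 < h" "0 \<le> K"
  shows "(\<lambda>l. trunc_moment l K) \<longlonglongrightarrow> expectation (\<lambda>w. min ((W_osc w {a..a + h})\<^sup>2 / h) K)"
proof -
  have ah: "a \<le> a + h" using assms by simp
  have "(\<lambda>l. expectation (\<lambda>w. min ((W_osc w (dyad a (a + h) l))\<^sup>2 / h) K)) \<longlonglongrightarrow>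
    expectation (\<lambda>w. min ((W_osc w {a..a + h})\<^sup>2 / h) K)"
  proof (rule integral_dominated_convergence[where w = "\<lambda>_. K"])
    show "AE w in N. (\<lambda>l. min ((W_osc w (dyad a (a + h) l))\<^sup>2 / h) K) \<longlonglongrightarrow> min ((W_osc w {a..a + h})\<^sup>2 / h) K"
      using osc_W_dyad_tendsto[OF assms(1) ah] by eventually_elim (intro tendsto_intros; use assms in simp)
    show "AE w in N. norm (min ((W_osc w (dyad a (a + h) l))\<^sup>2 / h) K) \<le> K" for l
      using assms by (intro AE_I2) (auto simp: min_def)
  qed (use osc_W_measurable[OF assms(1) ah] osc_W_dyad_measurable[OF assms(1) ah] in auto)
  then show ?thesis using osc_W_dyad_moment[OF assms(1,2)] by simp
qed

lemma trunc_moment_tendsto_trunc_lam2: "0 \<le> K \<Longrightarrow> (\<lambda>l. trunc_moment l K) \<longlonglongrightarrow> trunc_lam2 K"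
  using trunc_moment_tendsto[of 0 1 K] by (simp add: trunc_lam2_def)

text \<open>Scaling passes from grids to intervals: the sequence \<open>trunc_moment l K\<close>
  converges to the truncated moment of every interval alike, and limits are unique.\<close>

lemma osc_W_trunc:
  assumes "0 \<le> a" "0 < h" "0 \<le> K"
  shows "expectation (\<lambda>w. min ((W_osc w {a..a + h})\<^sup>2 / h) K) = trunc_lam2 K"
  by (rule LIMSEQ_unique[OF trunc_moment_tendsto[OF assms] trunc_moment_tendsto_trunc_lam2[OF assms(3)]])

text \<open>Doob's range bound for the integrand 1, whose energy on the unit interval is 1. Its
  uniformity in \<open>l\<close> and \<open>K\<close> makes \<open>lam2\<close> finite.\<close>

lemma trunc_moment_bound: "trunc_moment l K \<le> 16"
proof -
  interpret grid_integrand N F W "\<lambda>r. real r / 2 ^ l" "\<lambda>_ _. 1"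
    by unfold_locales (auto simp: incseq_def divide_right_mono)
  have SW: "S r w = W (real r / 2 ^ l) w - W 0 w" for r w
    by (induction r) (simp_all add: S_def)
  from doob_range[of "2 ^ l"] obtain R where R0: "R \<in> borel_measurable N"
    and R1: "integrable N (\<lambda>w. (R w)\<^sup>2) \<and>
     expectation (\<lambda>w. (R w)\<^sup>2) \<le> 16 * (\<Sum>q<2 ^ l. expectation (\<lambda>w. 1\<^sup>2) * (real (Suc q) / 2 ^ l - real q / 2 ^ l)) \<and>
     (\<forall>w. 0 \<le> R w \<and> (\<forall>r\<le>2 ^ l. \<forall>r'\<le>2 ^ l. S r' w - S r w \<le> R w))" ..
  have "(\<Sum>q<2 ^ l. expectation (\<lambda>w. 1\<^sup>2) * (real (Suc q) / 2 ^ l - real q / 2 ^ l)) = real (2 ^ l) / 2 ^ l - real 0 / 2 ^ l"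
    using sum_lessThan_telescope[of "\<lambda>q. real q / 2 ^ l" "2 ^ l"] by (simp add: prob_space)
  then have ER: "expectation (\<lambda>w. (R w)\<^sup>2) \<le> 16" using R1 by simp
  have le: "(W_osc w (dyad 0 1 l))\<^sup>2 \<le> (R w)\<^sup>2" for w
  proof (rule power_mono)
    show "0 \<le> W_osc w (dyad 0 1 l)" by (rule osc_nonneg) (auto intro: finite_imp_bounded)
    show "W_osc w (dyad 0 1 l) \<le> R w"
    proof (rule osc_least[OF dyad_nonempty])
      fix s t assume "s \<in> dyad 0 1 l" "t \<in> dyad 0 1 l"
      then obtain r r' where r: "r \<le> 2 ^ l" "r' \<le> 2 ^ l" "s = real r / 2 ^ l" "t = real r' / 2 ^ l"
        by (auto simp: dyad_def)
      then have "S r' w - S r w \<le> R w" using R1[THEN conjunct2, THEN conjunct2, THEN spec, of w] by blast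
      then show "W t w - W s w \<le> R w" using r by (simp add: SW)
    qed
  qed
  have "trunc_moment l K \<le> expectation (\<lambda>w. (R w)\<^sup>2)"
    unfolding trunc_moment_def by (rule integral_mono') (use R1 le in \<open>auto intro: min.coboundedI1\<close>)
  with ER show ?thesis by simp
qed

lemma trunc_moment_range: assumes "0 \<le> K" shows "0 \<le> trunc_moment l K" "trunc_moment l K \<le> K"
proof -
  show "0 \<le> trunc_moment l K" unfolding trunc_moment_def using assms by (intro integral_nonneg_AE AE_I2) auto
  have "trunc_moment l K \<le> expectation (\<lambda>w. K)"
    unfolding trunc_moment_def by (rule integral_mono') (use assms in auto)
  then show "trunc_moment l K \<le> K" by (simp add: prob_space)
qed

lemma trunc_lam2_bounds: "0 \<le> K \<Longrightarrow> 0 \<le> trunc_lam2 K" "0 \<le> K \<Longrightarrow> trunc_lam2 K \<le> K"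
  using LIMSEQ_le_const[OF trunc_moment_tendsto_trunc_lam2] LIMSEQ_le_const2[OF trunc_moment_tendsto_trunc_lam2]
    trunc_moment_range by blast+

text \<open>Monotone convergence in the truncation level, bounded by 16. The limit \<open>x\<close>
  is fixed before the interval and serves all intervals, so the unit interval identifies it as
  \<open>lam2\<close>.\<close>

lemma osc_W_second_moment:
  assumes "0 \<le> a" "0 < h"
  shows "integrable N (\<lambda>w. (W_osc w {a..a + h})\<^sup>2 / h)"
    "expectation (\<lambda>w. (W_osc w {a..a + h})\<^sup>2 / h) = lam2"
    and trunc_lam2_tendsto: "(\<lambda>K::nat. trunc_lam2 (real K)) \<longlonglongrightarrow> lam2"
proof -
  have i: "integrable N (\<lambda>w. min ((W_osc w {a..a + h})\<^sup>2 / h) (real K))" if "0 \<le> a" "0 < h" for K :: nat and a h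
    by (rule integrable_const_bound[of _ K]) (use that osc_W_measurable[of a "a + h"] in \<open>auto simp: min_def\<close>)
  have inc: "incseq (\<lambda>K::nat. trunc_lam2 (real K))"
  proof (rule incseq_SucI)
    fix K :: nat
    show "trunc_lam2 (real K) \<le> trunc_lam2 (real (Suc K))"
      unfolding trunc_lam2_def by (rule integral_mono) (use i[of 0 1 K] i[of 0 1 "Suc K"] in auto)
  qed
  have "trunc_lam2 (real K) \<le> 16" for K :: nat
    by (rule LIMSEQ_le_const2[OF trunc_moment_tendsto_trunc_lam2]) (use trunc_moment_bound in auto)
  then obtain x where x: "(\<lambda>K::nat. trunc_lam2 (real K)) \<longlonglongrightarrow> x"
    using incseq_convergent[OF inc] by metis
  have mc: "integrable N (\<lambda>w. (W_osc w {a..a + h})\<^sup>2 / h) \<and>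
    expectation (\<lambda>w. (W_osc w {a..a + h})\<^sup>2 / h) = x" if ah: "0 \<le> a" "0 < h" for a h
  proof -
    have mono: "AE w in N. mono (\<lambda>K::nat. min ((W_osc w {a..a + h})\<^sup>2 / h) (real K))"
      by (intro AE_I2) (auto simp: mono_def min_def)
    have lim: "AE w in N. (\<lambda>K::nat. min ((W_osc w {a..a + h})\<^sup>2 / h) (real K)) \<longlonglongrightarrow> (W_osc w {a..a + h})\<^sup>2 / h"
    proof (intro AE_I2 tendsto_eventually)
      fix w
      obtain K0 :: nat where "(W_osc w {a..a + h})\<^sup>2 / h \<le> K0" using real_arch_simple by blast
      then show "eventually (\<lambda>K::nat. min ((W_osc w {a..a + h})\<^sup>2 / h) (real K) = (W_osc w {a..a + h})\<^sup>2 / h) sequentially"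
        by (intro eventually_sequentiallyI[of K0]) auto
    qed
    have il: "(\<lambda>K::nat. expectation (\<lambda>w. min ((W_osc w {a..a + h})\<^sup>2 / h) (real K))) \<longlonglongrightarrow> x"
      using x by (simp add: osc_W_trunc[OF ah])
    have m: "(\<lambda>w. (W_osc w {a..a + h})\<^sup>2 / h) \<in> borel_measurable N"
      using osc_W_measurable[of a "a + h"] ah by simp
    show ?thesis
      using integrable_monotone_convergence[OF i[OF ah] mono lim il m] integral_monotone_convergence[OF i[OF ah] mono lim il m] by simp
  qed
  from mc[of 0 1] have "lam2 = x" by (simp add: lam2_def)
  with x mc[OF assms] show "integrable N (\<lambda>w. (W_osc w {a..a + h})\<^sup>2 / h)"
    "expectation (\<lambda>w. (W_osc w {a..a + h})\<^sup>2 / h) = lam2" "(\<lambda>K::nat. trunc_lam2 (real K)) \<longlonglongrightarrow> lam2" by auto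
qed

text \<open>The range dominates the increment over the unit interval, whose second moment is 1.
  Positivity permits the division by \<open>lam2\<close> in the conclusion.\<close>

lemma lam2_pos: "0 < lam2"
proof -
  have "expectation (\<lambda>w. (W 1 w - W 0 w)\<^sup>2) \<le> lam2"
    unfolding lam2_def
  proof (rule integral_mono_AE)
    show "AE w in N. (W 1 w - W 0 w)\<^sup>2 \<le> (W_osc w {0..1})\<^sup>2"
      using W_cont_Icc[of 0 1, OF order_refl]
    proof eventually_elim
      case (elim w)
      note b = continuous_bounded_Icc[OF elim]
      have "\<bar>W 1 w - W 0 w\<bar> \<le> W_osc w {0..1}"
        by (rule osc_upper_abs[OF b]) auto
      then show ?case by (metis abs_le_square_iff abs_of_nonneg abs_ge_zero order_trans)
    qed
  qed (use increment_moments[of 0 1] osc_W_second_moment(1)[of 0 1] in auto)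
  then show ?thesis using increment_moments[of 0 1] by simp
qed

text \<open>All blocks draw their increments from one grid of mesh \<open>1 / (n * 2 ^ l)\<close>,
  and different blocks use disjoint index sets. The right end is written
  \<open>real i / n + 1 / n\<close> to match the form \<open>a + h\<close> of the scaling
  lemmas.\<close>

lemma block_ranges_indep:
  assumes n: "0 < n"
  shows "indep_vars (\<lambda>_. borel) (\<lambda>i w. min ((W_osc w (dyad (real i / n) (real i / n + 1 / n) l))\<^sup>2 / (1 / n)) K) {..<n::nat}"
proof -
  define L where "L = (2::nat) ^ l"
  have L: "0 < L" by (simp add: L_def)
  define d where "d = 1 / (real n * real L)"
  let ?X = "\<lambda>k w. W (0 + d * real (Suc k)) w - W (0 + d * real k) w"
  let ?K = "\<lambda>i. {i * L..<i * L + L}"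
  let ?\<phi> = "\<lambda>i x. min ((osc (\<lambda>j. \<Sum>k<j. x (i * L + k)) {..L})\<^sup>2 / (1 / n)) K :: real"
  have "indep_vars (\<lambda>_. borel) ?X {..<n * L}" using n L by (intro increments_indep) (auto simp: d_def)
  then have "indep_vars (\<lambda>i. PiM (?K i) (\<lambda>_. borel)) (\<lambda>i w. restrict (\<lambda>k. ?X k w) (?K i)) {..<n}"
  proof (rule indep_vars_restrict)
    fix i assume "i \<in> {..<n}"
    then have "(i + 1) * L \<le> n * L" by (intro mult_le_mono1) simp
    then show "?K i \<subseteq> {..<n * L}" by auto
  next
    show "disjoint_family_on ?K {..<n}"
      unfolding disjoint_family_on_def
    proof (intro ballI impI)
      fix i j :: nat assume "i \<noteq> j"
      have *: "?K i \<inter> ?K j = {}" if "i < j" for i j :: nat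
      proof -
        have "(i + 1) * L \<le> j * L" using that by (intro mult_le_mono1) simp
        then show ?thesis by auto
      qed
      from \<open>i \<noteq> j\<close> *[of i j] *[of j i] show "?K i \<inter> ?K j = {}" by (metis inf_commute nat_neq_iff)
    qed
  qed
  then have "indep_vars (\<lambda>_. borel) (\<lambda>i w. ?\<phi> i (restrict (\<lambda>k. ?X k w) (?K i))) {..<n}"
  proof (rule indep_vars_compose2)
    fix i
    have "(\<lambda>x. osc (\<lambda>j. \<Sum>k<j. x (i * L + k)) {..L}) \<in> borel_measurable (PiM (?K i) (\<lambda>_. borel :: real measure))"
      by (rule osc_partial_sums_measurable) auto
    then show "?\<phi> i \<in> borel_measurable (PiM (?K i) (\<lambda>_. borel))" by simp
  qed
  moreover have "?\<phi> i (restrict (\<lambda>k. ?X k w) (?K i)) =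
    min ((W_osc w (dyad (real i / n) (real i / n + 1 / n) l))\<^sup>2 / (1 / n)) K" for i w
  proof -
    have grid: "real i / n + (1 / n) * real j / 2 ^ l = d * real (i * L + j)" for j
      using n L unfolding d_def by (simp add: L_def field_simps)
    have "dyad (real i / n) (real i / n + 1 / n) l = (\<lambda>j. d * real (i * L + j)) ` {..L}"
      unfolding dyad_def L_def[symmetric] by (rule image_cong[OF refl]) (use grid in simp)
    then have "W_osc w (dyad (real i / n) (real i / n + 1 / n) l) = osc (\<lambda>j. W (d * real (i * L + j)) w) {..L}"
      by (simp add: osc_image)
    also have "\<dots> = osc (\<lambda>j. \<Sum>k<j. restrict (\<lambda>k. ?X k w) (?K i) (i * L + k)) {..L}"
    proof (rule osc_cong)
      have *: "W (d * real (i * L + j)) w - W (d * real (i * L)) w = (\<Sum>k<j. restrict (\<lambda>k. ?X k w) (?K i) (i * L + k))" if "j \<in> {..L}" for j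
        using that by (induction j) auto
      fix j j' assume "j \<in> {..L}" "j' \<in> {..L}"
      with *[of j] *[of j'] show "W (d * real (i * L + j')) w - W (d * real (i * L + j)) w =
        (\<Sum>k<j'. restrict (\<lambda>k. ?X k w) (?K i) (i * L + k)) - (\<Sum>k<j. restrict (\<lambda>k. ?X k w) (?K i) (i * L + k))" by linarith
    qed
    finally show ?thesis by simp
  qed
  ultimately show ?thesis by simp
qed

text \<open>Independence has been shown for grid ranges, so the variance bound is proved there first
  and carried to the interval ranges by dominated convergence; truncation supplies the constant
  majorant.\<close>

lemma block_ranges_variance:
  fixes n m :: nat and K :: real
  assumes n: "0 < n" and m: "m \<le> n" and K: "0 \<le> K"
  shows "expectation (\<lambda>w. (\<Sum>i<m. min ((W_osc w {real i / n..real i / n + 1 / n})\<^sup>2 / (1 / n)) K - trunc_lam2 K)\<^sup>2) \<le> m * K\<^sup>2"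
proof -
  let ?a = "\<lambda>i. real i / n"
  let ?Y = "\<lambda>l i w. min ((W_osc w (dyad (?a i) (?a i + 1 / n) l))\<^sup>2 / (1 / n)) K - trunc_moment l K"
  let ?Z = "\<lambda>i w. min ((W_osc w {?a i..?a i + 1 / n})\<^sup>2 / (1 / n)) K - trunc_lam2 K"
  have h: "0 \<le> ?a i" "?a i \<le> ?a i + 1 / n" "0 < 1 / real n" for i using n by auto
  have Yb: "\<bar>?Y l i w\<bar> \<le> K" for l i w
  proof -
    have "0 \<le> (W_osc w (dyad (?a i) (?a i + 1 / n) l))\<^sup>2 / (1 / n)" by simp
    from min_centered_bound[OF this trunc_moment_range[OF K]] show ?thesis .
  qed
  have mY: "?Y l i \<in> borel_measurable N" for l i using osc_W_dyad_measurable[OF h(1,2)] by simp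
  have mZ: "?Z i \<in> borel_measurable N" for i using osc_W_measurable[OF h(1,2)] by simp
  have iY: "integrable N (\<lambda>w. min ((W_osc w (dyad (?a i) (?a i + 1 / n) l))\<^sup>2 / (1 / n)) K)" for l i
    by (rule integrable_const_bound[of _ K]) (use K osc_W_dyad_measurable[OF h(1,2)] in \<open>auto simp: min_def\<close>)
  have E: "expectation (\<lambda>w. (\<Sum>i<m. ?Y l i w)\<^sup>2) \<le> m * K\<^sup>2" for l
  proof -
    have "indep_vars (\<lambda>_. borel) (?Y l) {..<n}"
      using indep_vars_compose2[OF block_ranges_indep[OF n, of l K], of "\<lambda>_ x. x - trunc_moment l K" "\<lambda>_. borel"] by simp
    then have "indep_vars (\<lambda>_. borel) (?Y l) {..<m}" by (rule indep_vars_subset) (use m in auto)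
    moreover have "expectation (?Y l i) = 0" for i
      using osc_W_dyad_moment[OF h(1) h(3), of i l K] iY[of i l] by (simp add: prob_space)
    ultimately show ?thesis using indep_centered_sum_square[of "{..<m}" "?Y l" K] Yb by simp
  qed
  have "(\<lambda>l. expectation (\<lambda>w. (\<Sum>i<m. ?Y l i w)\<^sup>2)) \<longlonglongrightarrow> expectation (\<lambda>w. (\<Sum>i<m. ?Z i w)\<^sup>2)"
  proof (rule integral_dominated_convergence[where w = "\<lambda>_. (m * K)\<^sup>2"])
    show "AE w in N. (\<lambda>l. (\<Sum>i<m. ?Y l i w)\<^sup>2) \<longlonglongrightarrow> (\<Sum>i<m. ?Z i w)\<^sup>2"
    proof -
      have "AE w in N. \<forall>i\<in>{..<m}. (\<lambda>l. W_osc w (dyad (?a i) (?a i + 1 / n) l)) \<longlonglongrightarrow> W_osc w {?a i..?a i + 1 / n}"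
        using osc_W_dyad_tendsto[OF h(1,2)] by (intro AE_finite_allI) auto
      then show ?thesis
      proof eventually_elim
        case (elim w)
        show ?case
          by (intro tendsto_power tendsto_sum tendsto_diff tendsto_min tendsto_divide tendsto_const trunc_moment_tendsto_trunc_lam2 K)
            (use elim n in auto)
      qed
    qed
    show "AE w in N. norm ((\<Sum>i<m. ?Y l i w)\<^sup>2) \<le> (m * K)\<^sup>2" for l
    proof (rule AE_I2)
      fix w
      have "\<bar>\<Sum>i<m. ?Y l i w\<bar> \<le> (\<Sum>i<m. K)" by (rule order_trans[OF sum_abs sum_mono]) (rule Yb)
      then have "\<bar>\<Sum>i<m. ?Y l i w\<bar>\<^sup>2 \<le> (m * K)\<^sup>2" by (intro power_mono) auto
      then show "norm ((\<Sum>i<m. ?Y l i w)\<^sup>2) \<le> (m * K)\<^sup>2" by simp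
    qed
    show "(\<lambda>w. (\<Sum>i<m. ?Z i w)\<^sup>2) \<in> borel_measurable N"
      by (rule borel_measurable_power[OF borel_measurable_sum]) (rule mZ)
    show "(\<lambda>w. (\<Sum>i<m. ?Y l i w)\<^sup>2) \<in> borel_measurable N" for l
      by (rule borel_measurable_power[OF borel_measurable_sum]) (rule mY)
  qed simp
  from LIMSEQ_le_const2[OF this] E show ?thesis by blast
qed

text \<open>Each scaled squared range splits into its truncation and an excess. The excess costs
  \<open>lam2 - trunc_lam2 K\<close> in mean, replacing the centring by \<open>lam2\<close> costs
  the same again, and the truncated fluctuations contribute \<open>K / sqrt n\<close>. Enlarging
  \<open>m\<close> to \<open>n\<close> in the bounds makes them uniform in \<open>m\<close>.\<close>

lemma range_sum_L1:
  fixes n m :: nat and K :: real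
  assumes n: "0 < n" and m: "m \<le> n" and K: "0 < K"
  shows "expectation (\<lambda>w. \<bar>(\<Sum>i<m. (W_osc w (block n i))\<^sup>2) - real m / n * lam2\<bar>) \<le> 2 * (lam2 - trunc_lam2 K) + K / sqrt n"
    "integrable N (\<lambda>w. \<Sum>i<m. (W_osc w (block n i))\<^sup>2)"
proof -
  let ?a = "\<lambda>i. real i / n"
  let ?r = "\<lambda>i w. (W_osc w {?a i..?a i + 1 / n})\<^sup>2 / (1 / n)"
  let ?Z = "\<lambda>w. \<Sum>i<m. min (?r i w) K - trunc_lam2 K"
  let ?d = "\<lambda>w. \<bar>(\<Sum>i<m. (W_osc w (block n i))\<^sup>2) - real m / n * lam2\<bar>"
  let ?g = "\<lambda>w. \<Sum>i<m. ?r i w - min (?r i w) K"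
  have h: "0 \<le> ?a i" "?a i \<le> ?a i + 1 / n" "0 < 1 / real n" for i using n by auto
  have blk: "(W_osc w (block n i))\<^sup>2 = ?r i w / n" for i w
    using n by (simp add: add_divide_distrib add.commute)
  have ir: "integrable N (?r i)" for i by (rule osc_W_second_moment(1)[OF h(1,3)])
  have Er: "expectation (?r i) = lam2" for i by (rule osc_W_second_moment(2)[OF h(1,3)])
  have im: "integrable N (\<lambda>w. min (?r i w) K)" for i
    by (rule integrable_const_bound[of _ K]) (use K osc_W_measurable[OF h(1,2)] in \<open>auto simp: min_def\<close>)
  have Em: "expectation (\<lambda>w. min (?r i w) K) = trunc_lam2 K" for i
    by (rule osc_W_trunc[OF h(1,3)]) (use K in simp)
  show "integrable N (\<lambda>w. \<Sum>i<m. (W_osc w (block n i))\<^sup>2)"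
    unfolding blk by (intro Bochner_Integration.integrable_sum integrable_divide ir)
  have iZ: "integrable N ?Z" using im by (intro Bochner_Integration.integrable_sum Bochner_Integration.integrable_diff) auto
  have cl: "trunc_lam2 K \<le> lam2"
    using integral_mono[OF im ir, of 0 0] unfolding Em Er by auto
  \<comment> \<open>The choice balancing the two terms of \<open>amgm\<close> when the second moment
    is at most \<open>n * K\<^sup>2\<close>; it takes the place of the Cauchy-Schwarz
    inequality.\<close>
  define c where "c = sqrt n * K"
  have c: "0 < c" using n K by (simp add: c_def)
  have amgm: "\<bar>z\<bar> \<le> z\<^sup>2 / (2 * c) + c / 2" for z
  proof -
    have "0 \<le> (\<bar>z\<bar> - c)\<^sup>2" by simp
    then have "2 * c * \<bar>z\<bar> \<le> z\<^sup>2 + c\<^sup>2" by (simp add: power2_eq_square algebra_simps)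
    then show ?thesis using c by (simp add: field_simps power2_eq_square)
  qed
  have pw: "?d w
    \<le> (?g w + ((?Z w)\<^sup>2 / (2 * c) + c / 2) + m * (lam2 - trunc_lam2 K)) / n" for w
  proof -
    have eq: "(\<Sum>i<m. (W_osc w (block n i))\<^sup>2) - real m / n * lam2 =
      (?g w + ?Z w - m * (lam2 - trunc_lam2 K)) / n"
    proof -
      have "(\<Sum>i<m. x i / n) - real m / n * l = ((\<Sum>i<m. x i - y i) + (\<Sum>i<m. y i - k) - m * (l - k)) / n"
        for x y :: "nat \<Rightarrow> real" and l k :: real
        using n by (simp add: sum_subtractf sum_divide_distrib[symmetric] field_simps)
      then show ?thesis unfolding blk .
    qed
    have "0 \<le> ?g w" by (rule sum_nonneg) auto
    moreover have "0 \<le> m * (lam2 - trunc_lam2 K)" using cl by simp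
    ultimately have "\<bar>?g w + ?Z w - m * (lam2 - trunc_lam2 K)\<bar>
      \<le> ?g w + ((?Z w)\<^sup>2 / (2 * c) + c / 2) + m * (lam2 - trunc_lam2 K)"
      using amgm[of "?Z w"] by linarith
    then show ?thesis unfolding eq using n by (simp add: abs_divide divide_right_mono)
  qed
  have mZ: "?Z \<in> borel_measurable N" using iZ by auto
  have Zb: "\<bar>?Z w\<bar> \<le> m * K" for w
  proof -
    have "\<bar>?Z w\<bar> \<le> (\<Sum>i<m. K)"
    proof (rule order_trans[OF sum_abs sum_mono])
      fix i
      have "0 \<le> ?r i w" by simp
      from min_centered_bound[OF this trunc_lam2_bounds] K show "\<bar>min (?r i w) K - trunc_lam2 K\<bar> \<le> K" by simp
    qed
    then show ?thesis by simp
  qed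
  have iZ2: "integrable N (\<lambda>w. (?Z w)\<^sup>2)"
  proof (rule integrable_const_bound[of _ "(m * K)\<^sup>2"])
    show "AE w in N. norm ((?Z w)\<^sup>2) \<le> (m * K)\<^sup>2"
    proof (rule AE_I2)
      fix w have "\<bar>?Z w\<bar>\<^sup>2 \<le> (m * K)\<^sup>2" using Zb[of w] by (intro power_mono) auto
      then show "norm ((?Z w)\<^sup>2) \<le> (m * K)\<^sup>2" by simp
    qed
  qed (use mZ in simp)
  have "expectation (\<lambda>w. ?d w)
    \<le> expectation (\<lambda>w. (?g w + ((?Z w)\<^sup>2 / (2 * c) + c / 2) + m * (lam2 - trunc_lam2 K)) / n)"
  proof (rule integral_mono[OF _ _ pw])
    show "integrable N (\<lambda>w. ?d w)"
      unfolding blk by (intro integrable_abs Bochner_Integration.integrable_diff Bochner_Integration.integrable_sum integrable_divide ir) simp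
    show "integrable N (\<lambda>w. (?g w + ((?Z w)\<^sup>2 / (2 * c) + c / 2) + m * (lam2 - trunc_lam2 K)) / n)"
      by (intro integrable_divide Bochner_Integration.integrable_add Bochner_Integration.integrable_sum Bochner_Integration.integrable_diff ir im iZ2) auto
  qed
  also have "\<dots> = (expectation (\<lambda>w. \<Sum>i<m. ?r i w - min (?r i w) K) + (expectation (\<lambda>w. (?Z w)\<^sup>2) / (2 * c) + c / 2) + m * (lam2 - trunc_lam2 K)) / n"
  proof -
    have 1: "integrable N (\<lambda>w. \<Sum>i<m. ?r i w - min (?r i w) K)"
      by (intro Bochner_Integration.integrable_sum Bochner_Integration.integrable_diff ir im)
    have 2: "integrable N (\<lambda>w. (?Z w)\<^sup>2 / (2 * c))" by (intro integrable_divide iZ2)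
    show ?thesis using 1 2 by (simp add: prob_space)
  qed
  also have "expectation (\<lambda>w. \<Sum>i<m. ?r i w - min (?r i w) K) = m * (lam2 - trunc_lam2 K)"
  proof -
    have "expectation (\<lambda>w. \<Sum>i<m. ?r i w - min (?r i w) K) = (\<Sum>i<m. expectation (\<lambda>w. ?r i w - min (?r i w) K))"
      by (rule Bochner_Integration.integral_sum) (intro Bochner_Integration.integrable_diff ir im)
    also have "\<dots> = (\<Sum>i<m. lam2 - trunc_lam2 K)"
      by (intro sum.cong refl) (subst Bochner_Integration.integral_diff[OF ir im], simp only: Er Em)
    finally show ?thesis by simp
  qed
  also have "(m * (lam2 - trunc_lam2 K) + (expectation (\<lambda>w. (?Z w)\<^sup>2) / (2 * c) + c / 2) + m * (lam2 - trunc_lam2 K)) / n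
    \<le> (n * (lam2 - trunc_lam2 K) + (n * K\<^sup>2 / (2 * c) + c / 2) + n * (lam2 - trunc_lam2 K)) / n"
  proof (intro divide_right_mono add_mono)
    show "m * (lam2 - trunc_lam2 K) \<le> n * (lam2 - trunc_lam2 K)" using m cl by (intro mult_right_mono) auto
    then show "m * (lam2 - trunc_lam2 K) \<le> n * (lam2 - trunc_lam2 K)" .
    have "expectation (\<lambda>w. (?Z w)\<^sup>2) \<le> m * K\<^sup>2" by (rule block_ranges_variance[OF n m]) (use K in simp)
    also have "\<dots> \<le> n * K\<^sup>2" using m by (intro mult_right_mono) auto
    finally show "expectation (\<lambda>w. (?Z w)\<^sup>2) \<le> n * K\<^sup>2" .
  qed (use c in auto)
  also have "\<dots> = 2 * (lam2 - trunc_lam2 K) + K / sqrt n"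
  proof -
    have s: "sqrt n * sqrt n = n" "sqrt n > 0" using n by auto
    have e1: "n * K\<^sup>2 / (2 * c) = c / 2"
      unfolding c_def using s K by (simp add: field_simps power2_eq_square)
    have e2: "c / n = K / sqrt n"
      unfolding c_def using s n by (simp add: field_simps)
    show ?thesis unfolding e1 using n e2 by (simp add: add_divide_distrib)
  qed
  finally show "expectation (\<lambda>w. ?d w) \<le> 2 * (lam2 - trunc_lam2 K) + K / sqrt n" .
qed

text \<open>The truncation level is fixed first, so that twice the truncation error is below
  \<open>e / 2\<close>; only then is n made large enough for the fluctuation term to fall below
  \<open>e / 4\<close>.\<close>

lemma range_sum_lln:
  assumes m: "\<And>n. m n \<le> n"
  shows "(\<lambda>n. expectation (\<lambda>w. \<bar>(\<Sum>i<m n. (W_osc w (block n i))\<^sup>2) - real (m n) / n * lam2\<bar>)) \<longlonglongrightarrow> 0"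
proof (rule LIMSEQ_I)
  let ?E = "\<lambda>n. expectation (\<lambda>w. \<bar>(\<Sum>i<m n. (W_osc w (block n i))\<^sup>2) - real (m n) / n * lam2\<bar>)"
  fix e :: real assume e: "0 < e"
  have "eventually (\<lambda>K::nat. lam2 - e / 4 < trunc_lam2 (real K) \<and> 0 < K) sequentially"
    using order_tendstoD(1)[OF trunc_lam2_tendsto[OF order_refl zero_less_one], of "lam2 - e / 4"] e by (intro eventually_conj eventually_gt_at_top) auto
  from eventually_happens'[OF sequentially_bot this]
  obtain K :: nat where K: "lam2 - e / 4 < trunc_lam2 (real K)" "0 < K" by blast
  have "(\<lambda>n. real K / sqrt (real n)) \<longlonglongrightarrow> 0"
    by (intro tendsto_divide_0[OF tendsto_const] filterlim_at_top_imp_at_infinity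
        filterlim_compose[OF sqrt_at_top filterlim_real_sequentially])
  then have "eventually (\<lambda>n. real K / sqrt (real n) < e / 4) sequentially"
    using e by (intro order_tendstoD(2)) auto
  then obtain n0 where n0: "\<And>n. n \<ge> n0 \<Longrightarrow> real K / sqrt (real n) < e / 4" by (auto simp: eventually_sequentially)
  show "\<exists>no. \<forall>n\<ge>no. norm (?E n - 0) < e"
  proof (intro exI[of _ "Suc n0"] allI impI)
    fix n assume n: "n \<ge> Suc n0"
    have "0 \<le> ?E n"
      by (intro integral_nonneg_AE AE_I2) auto
    moreover have "?E n < e"
    proof -
      have *: "x < e" if "x \<le> 2 * (lam2 - trunc_lam2 (real K)) + y" "y < e / 4" for x y
      proof -
        have "2 * (l - c) + y < e" if "l - e / 4 < c" "y < e / 4" for l c y :: real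
          using that e by (simp add: field_simps)
        from this[OF K(1) that(2)] that(1) show ?thesis by (rule le_less_trans[rotated])
      qed
      have "0 < n" "n \<ge> n0" "0 < real K" using n K by auto
      from range_sum_L1(1)[OF this(1) m this(3)] n0[OF this(2)] show ?thesis
        by (rule *)
    qed
    ultimately show "norm (?E n - 0) < e"
      by simp
  qed
qed

end

section \<open>Ranges of simple stochastic integrals\<close>

lemma osc_block_small:
  fixes f :: "real \<Rightarrow> real"
  assumes f: "continuous_on {0..1} f" and e: "0 < e"
  shows "\<exists>n0. \<forall>n\<ge>n0. \<forall>i<n. osc f (block n i) \<le> e"
proof -
  have "uniformly_continuous_on {0..1} f" by (rule compact_uniformly_continuous[OF f]) simp
  from this[unfolded uniformly_continuous_on_def, rule_format, OF e]
  obtain d where d: "d > 0" "\<And>x y. x \<in> {0..1} \<Longrightarrow> y \<in> {0..1} \<Longrightarrow> dist y x < d \<Longrightarrow> dist (f y) (f x) < e" by auto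
  obtain n0 :: nat where n0: "1 / d < n0" using reals_Archimedean2 by blast
  show ?thesis
  proof (intro exI[of _ n0] allI impI osc_least)
    fix n i s t assume n: "n0 \<le> n" "i < n" and st: "s \<in> block n i" "t \<in> block n i"
    have "1 / d < n" using n0 n by linarith
    then have "1 / real n < d" using d(1) n by (simp add: field_simps)
    moreover have "\<bar>t - s\<bar> \<le> 1 / n" using st by (auto simp: add_divide_distrib abs_le_iff)
    ultimately have "dist t s < d" by (simp add: dist_real_def)
    moreover have "s \<in> {0..1}" "t \<in> {0..1}" using st block_subset[OF n(2)] by blast+
    ultimately have "dist (f t) (f s) < e" by (intro d(2))
    then show "f t - f s \<le> e" by (simp add: dist_real_def)
  qed (use block_nonempty in auto)
qed

text \<open>Each point of \<open>G\<close> is interior to at most one block, so all but \<open>card G\<close> terms cancel.\<close>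

lemma range_square_sum_diff_tendsto:
  assumes f: "continuous_on {0..1} f" and w: "continuous_on {0..1} w" and G: "finite G"
    and H: "\<And>t. \<bar>H t\<bar> \<le> C"
    and eq: "\<And>n i. i < n \<Longrightarrow> G \<inter> {real i / n<..<real (Suc i) / n} = {} \<Longrightarrow>
      osc f (block n i) = \<bar>H (real (Suc i) / n)\<bar> * osc w (block n i)"
  shows "(\<lambda>n. (\<Sum>i<n. (osc f (block n i))\<^sup>2) - (\<Sum>i<n. (H (real (Suc i) / n))\<^sup>2 * (osc w (block n i))\<^sup>2)) \<longlonglongrightarrow> 0"
proof (rule LIMSEQ_I)
  fix e :: real assume e: "0 < e"
  \<comment> \<open>A bad block contributes at most \<open>(1 + C\<^sup>2) * r\<^sup>2\<close>, and
    there are at most \<open>card G\<close> of them; the extra 1 keeps \<open>D\<close> positive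
    when \<open>G\<close> is empty.\<close>
  define D where "D = real (card G + 1) * (1 + C\<^sup>2)"
  have D: "0 < D" unfolding D_def by (intro mult_pos_pos add_pos_nonneg) auto
  define r where "r = sqrt (e / (2 * D))"
  have r: "0 < r" "r\<^sup>2 = e / (2 * D)" using e D by (auto simp: r_def)
  obtain n1 where n1: "\<And>n i. n \<ge> n1 \<Longrightarrow> i < n \<Longrightarrow> osc f (block n i) \<le> r" using osc_block_small[OF f r(1)] by blast
  obtain n2 where n2: "\<And>n i. n \<ge> n2 \<Longrightarrow> i < n \<Longrightarrow> osc w (block n i) \<le> r" using osc_block_small[OF w r(1)] by blast
  show "\<exists>no. \<forall>n\<ge>no. norm ((\<Sum>i<n. (osc f (block n i))\<^sup>2) - (\<Sum>i<n. (H (real (Suc i) / n))\<^sup>2 * (osc w (block n i))\<^sup>2) - 0) < e"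
  proof (intro exI[of _ "max n1 n2"] allI impI)
    fix n assume n: "n \<ge> max n1 n2"
    define bad where "bad = {i. i < n \<and> G \<inter> {real i / n<..<real (Suc i) / n} \<noteq> {}}"
    have "bad \<subseteq> (\<lambda>g. nat \<lfloor>g * n\<rfloor>) ` G"
    proof
      fix i assume "i \<in> bad"
      then obtain g where g: "i < n" "g \<in> G" "real i / n < g" "g < real (Suc i) / n" by (auto simp: bad_def)
      then have "real i < g * n" "g * n < real i + 1" by (auto simp: field_simps)
      then have "nat \<lfloor>g * n\<rfloor> = i" by linarith
      with g show "i \<in> (\<lambda>g. nat \<lfloor>g * n\<rfloor>) ` G" by blast
    qed
    then have cb: "card bad \<le> card G" by (rule surj_card_le[OF G])
    have fb: "finite bad" by (simp add: bad_def)
    let ?t = "\<lambda>i. (osc f (block n i))\<^sup>2 - (H (real (Suc i) / n))\<^sup>2 * (osc w (block n i))\<^sup>2"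
    have "(\<Sum>i<n. (osc f (block n i))\<^sup>2) - (\<Sum>i<n. (H (real (Suc i) / n))\<^sup>2 * (osc w (block n i))\<^sup>2) = (\<Sum>i<n. ?t i)"
      by (simp add: sum_subtractf)
    also have "\<dots> = (\<Sum>i\<in>bad. ?t i)"
      by (rule sum.mono_neutral_right) (auto simp: bad_def eq power_mult_distrib simp del: of_nat_Suc)
    also have "\<bar>\<dots>\<bar> \<le> (\<Sum>i\<in>bad. (1 + C\<^sup>2) * r\<^sup>2)"
    proof (rule order_trans[OF sum_abs sum_mono])
      fix i assume "i \<in> bad"
      then have i: "i < n" by (simp add: bad_def)
      have ne: "block n i \<noteq> {}" using block_nonempty[of i n] by auto
      have b: "bounded (f ` block n i)" "bounded (w ` block n i)"
        using bounded_subset[OF continuous_bounded_Icc[OF f] image_mono[OF block_subset[OF i]]]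
          bounded_subset[OF continuous_bounded_Icc[OF w] image_mono[OF block_subset[OF i]]] by auto
      have 1: "(osc f (block n i))\<^sup>2 \<le> r\<^sup>2" "(osc w (block n i))\<^sup>2 \<le> r\<^sup>2"
        using osc_nonneg[OF b(1) ne] osc_nonneg[OF b(2) ne] n1[of n i] n2[of n i] n i by (auto intro: power_mono)
      have "(H (real (Suc i) / n))\<^sup>2 \<le> C\<^sup>2" using H[of "real (Suc i) / n"] abs_le_square_iff[of "H (real (Suc i) / n)" C]
        by (smt (verit) abs_ge_zero)
      then have 2: "(H (real (Suc i) / n))\<^sup>2 * (osc w (block n i))\<^sup>2 \<le> C\<^sup>2 * r\<^sup>2" using 1 by (intro mult_mono) auto
      have 3: "0 \<le> (osc f (block n i))\<^sup>2" "0 \<le> (H (real (Suc i) / n))\<^sup>2 * (osc w (block n i))\<^sup>2" by auto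
      have 4: "(1 + C\<^sup>2) * r\<^sup>2 = r\<^sup>2 + C\<^sup>2 * r\<^sup>2" "0 \<le> C\<^sup>2 * r\<^sup>2" "0 \<le> r\<^sup>2" by (auto simp: algebra_simps)
      have "\<bar>x - y\<bar> \<le> z" if "x \<le> a" "y \<le> b" "0 \<le> x" "0 \<le> y" "z = a + b" "0 \<le> b" "0 \<le> a" for x y z a b :: real
        using that by linarith
      from this[OF 1(1) 2 3 4] show "\<bar>?t i\<bar> \<le> (1 + C\<^sup>2) * r\<^sup>2" .
    qed
    also have "\<dots> = card bad * (1 + C\<^sup>2) * r\<^sup>2" by simp
    also have "\<dots> \<le> D * r\<^sup>2"
      unfolding D_def using cb by (intro mult_right_mono) auto
    also have "\<dots> < e" using r D e by simp
    finally show "norm ((\<Sum>i<n. (osc f (block n i))\<^sup>2) - (\<Sum>i<n. (H (real (Suc i) / n))\<^sup>2 * (osc w (block n i))\<^sup>2) - 0) < e"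
      by simp
  qed
qed

section \<open>Convergence in probability\<close>

context prob_space begin

abbreviation dev :: "real \<Rightarrow> ('a \<Rightarrow> real) \<Rightarrow> ('a \<Rightarrow> real) \<Rightarrow> 'a set" where
  "dev e X Y \<equiv> {w \<in> space M. e < \<bar>X w - Y w\<bar>}"

definition conv_prob :: "(nat \<Rightarrow> 'a \<Rightarrow> real) \<Rightarrow> ('a \<Rightarrow> real) \<Rightarrow> bool" where
  "conv_prob X Y \<longleftrightarrow> (\<forall>n. X n \<in> borel_measurable M) \<and> Y \<in> borel_measurable M \<and>
     (\<forall>e>0. (\<lambda>n. prob (dev e (X n) Y)) \<longlonglongrightarrow> 0)"

lemma conv_probD:
  assumes "conv_prob X Y"
  shows "X n \<in> borel_measurable M" "Y \<in> borel_measurable M"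
    "0 < e \<Longrightarrow> (\<lambda>n. prob (dev e (X n) Y)) \<longlonglongrightarrow> 0"
  using assms by (auto simp: conv_prob_def)

text \<open>A modulus of continuity uniform over the space and in n turns deviations of
  \<open>X'\<close> into deviations of \<open>X\<close>, so the probabilities are compared by
  inclusion of events.\<close>

lemma conv_prob_transfer:
  assumes "conv_prob X Y" and m: "\<And>n. X' n \<in> borel_measurable M" "Y' \<in> borel_measurable M"
    and "\<And>e. 0 < e \<Longrightarrow> \<exists>d>0. \<forall>n. \<forall>w\<in>space M. e < \<bar>X' n w - Y' w\<bar> \<longrightarrow> d < \<bar>X n w - Y w\<bar>"
  shows "conv_prob X' Y'"
  unfolding conv_prob_def
proof (intro conjI allI impI m)
  fix e :: real assume "0 < e"
  from assms(4)[OF this] obtain d where d: "d > 0"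
    "\<And>n w. w \<in> space M \<Longrightarrow> e < \<bar>X' n w - Y' w\<bar> \<Longrightarrow> d < \<bar>X n w - Y w\<bar>" by blast
  show "(\<lambda>n. prob (dev e (X' n) Y')) \<longlonglongrightarrow> 0"
  proof (rule tendsto_sandwich[OF _ _ tendsto_const conv_probD(3)[OF assms(1) d(1)]])
    show "\<forall>\<^sub>F n in sequentially. prob (dev e (X' n) Y') \<le> prob (dev d (X n) Y)"
      using d(2) conv_probD(1,2)[OF assms(1)] by (intro always_eventually allI finite_measure_mono) auto
  qed auto
qed

lemma conv_prob_add:
  assumes "conv_prob X Y" "conv_prob X' Y'"
  shows "conv_prob (\<lambda>n w. X n w + X' n w) (\<lambda>w. Y w + Y' w)"
  unfolding conv_prob_def
proof (intro conjI allI impI)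
  note [measurable] = conv_probD(1,2)[OF assms(1)] conv_probD(1,2)[OF assms(2)]
  show "(\<lambda>w. X n w + X' n w) \<in> borel_measurable M" for n by measurable
  show "(\<lambda>w. Y w + Y' w) \<in> borel_measurable M" by measurable
  fix e :: real assume "0 < e"
  then have e: "0 < e / 2" by simp
  have "(\<lambda>n. prob (dev (e / 2) (X n) Y) + prob (dev (e / 2) (X' n) Y')) \<longlonglongrightarrow> 0 + 0"
    by (intro tendsto_add conv_probD(3)[OF assms(1) e] conv_probD(3)[OF assms(2) e])
  then have lim: "(\<lambda>n. prob (dev (e / 2) (X n) Y) + prob (dev (e / 2) (X' n) Y')) \<longlonglongrightarrow> 0" by simp
  have "prob {w \<in> space M. e < \<bar>X n w + X' n w - (Y w + Y' w)\<bar>} \<le>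
    prob (dev (e / 2) (X n) Y) + prob (dev (e / 2) (X' n) Y')" for n
    by (rule order_trans[OF finite_measure_mono measure_Un_le]) (auto simp: abs_if split: if_splits)
  then show "(\<lambda>n. prob {w \<in> space M. e < \<bar>X n w + X' n w - (Y w + Y' w)\<bar>}) \<longlonglongrightarrow> 0"
    by (intro tendsto_sandwich[OF _ _ tendsto_const lim]) auto
qed

lemma conv_prob_const: "Y \<in> borel_measurable M \<Longrightarrow> conv_prob (\<lambda>_. Y) Y"
  by (simp add: conv_prob_def)

lemma conv_prob_sum:
  assumes "finite I" "\<And>i. i \<in> I \<Longrightarrow> conv_prob (X i) (Y i)"
  shows "conv_prob (\<lambda>n w. \<Sum>i\<in>I. X i n w) (\<lambda>w. \<Sum>i\<in>I. Y i w)"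
  using assms by (induction I) (auto intro: conv_prob_add simp: conv_prob_const)

lemma conv_prob_mult_bounded:
  assumes X: "conv_prob X Y" and c: "c \<in> borel_measurable M" "\<And>w. w \<in> space M \<Longrightarrow> \<bar>c w\<bar> \<le> C"
  shows "conv_prob (\<lambda>n w. c w * X n w) (\<lambda>w. c w * Y w)"
proof (rule conv_prob_transfer[OF X])
  note [measurable] = conv_probD(1,2)[OF X] c(1)
  show "(\<lambda>w. c w * X n w) \<in> borel_measurable M" for n by measurable
  show "(\<lambda>w. c w * Y w) \<in> borel_measurable M" by measurable
  fix e :: real assume e: "0 < e"
  define D where "D = \<bar>C\<bar> + 1"
  have D: "0 < D" by (simp add: D_def)
  show "\<exists>d>0. \<forall>n. \<forall>w\<in>space M. e < \<bar>c w * X n w - c w * Y w\<bar> \<longrightarrow> d < \<bar>X n w - Y w\<bar>"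
  proof (intro exI[of _ "e / D"] conjI allI ballI impI)
    fix n w assume w: "w \<in> space M" and *: "e < \<bar>c w * X n w - c w * Y w\<bar>"
    have "\<bar>c w * X n w - c w * Y w\<bar> = \<bar>c w\<bar> * \<bar>X n w - Y w\<bar>" by (simp add: abs_mult[symmetric] right_diff_distrib)
    also have "\<dots> \<le> D * \<bar>X n w - Y w\<bar>" using c(2)[OF w] by (intro mult_right_mono) (auto simp: D_def)
    finally show "e / D < \<bar>X n w - Y w\<bar>" using * D by (simp add: field_simps)
  qed (use e D in auto)
qed

text \<open>The square root satisfies a Hoelder condition of order 1/2 with constant 1, whence the
  witness \<open>e\<^sup>2\<close>.\<close>

lemma conv_prob_sqrt:
  assumes X: "conv_prob X Y" and nonneg: "\<And>n w. 0 \<le> X n w" "\<And>w. 0 \<le> Y w"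
  shows "conv_prob (\<lambda>n w. sqrt (X n w)) (\<lambda>w. sqrt (Y w))"
proof (rule conv_prob_transfer[OF X])
  note [measurable] = conv_probD(1,2)[OF X]
  show "(\<lambda>w. sqrt (X n w)) \<in> borel_measurable M" for n by measurable
  show "(\<lambda>w. sqrt (Y w)) \<in> borel_measurable M" by measurable
  have le: "\<bar>sqrt x - sqrt y\<bar>\<^sup>2 \<le> \<bar>x - y\<bar>" if "0 \<le> x" "0 \<le> y" for x y
  proof -
    have "\<bar>sqrt x - sqrt y\<bar> * \<bar>sqrt x - sqrt y\<bar> \<le> \<bar>sqrt x - sqrt y\<bar> * \<bar>sqrt x + sqrt y\<bar>"
      using that by (intro mult_left_mono) (auto simp: abs_le_iff)
    also have "\<dots> = \<bar>(sqrt x - sqrt y) * (sqrt x + sqrt y)\<bar>" by (rule abs_mult[symmetric])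
    also have "(sqrt x - sqrt y) * (sqrt x + sqrt y) = x - y" using that by (simp add: algebra_simps)
    finally show ?thesis by (simp add: power2_eq_square)
  qed
  fix e :: real assume e: "0 < e"
  show "\<exists>d>0. \<forall>n. \<forall>w\<in>space M. e < \<bar>sqrt (X n w) - sqrt (Y w)\<bar> \<longrightarrow> d < \<bar>X n w - Y w\<bar>"
  proof (intro exI[of _ "e\<^sup>2"] conjI allI ballI impI)
    fix n w assume "e < \<bar>sqrt (X n w) - sqrt (Y w)\<bar>"
    then have "e\<^sup>2 < \<bar>sqrt (X n w) - sqrt (Y w)\<bar>\<^sup>2" using e by (intro power_strict_mono) auto
    also note le[OF nonneg]
    finally show "e\<^sup>2 < \<bar>X n w - Y w\<bar>" .
  qed (use e in auto)
qed

lemma conv_prob_AE: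
  assumes X: "\<And>n. X n \<in> borel_measurable M" and Y: "Y \<in> borel_measurable M"
    and lim: "AE w in M. (\<lambda>n. X n w) \<longlonglongrightarrow> Y w"
  shows "conv_prob X Y"
  unfolding conv_prob_def
proof (intro conjI allI impI X Y)
  note [measurable] = X Y
  fix e :: real assume e: "0 < e"
  have "(\<lambda>n. expectation (indicator (dev e (X n) Y) :: 'a \<Rightarrow> real)) \<longlonglongrightarrow> expectation (\<lambda>_. 0)"
  proof (rule integral_dominated_convergence[where w = "\<lambda>_. 1"])
    show "AE w in M. (\<lambda>n. indicator (dev e (X n) Y) w :: real) \<longlonglongrightarrow> 0"
      using lim
    proof eventually_elim
      case (elim w)
      have "eventually (\<lambda>n. \<bar>X n w - Y w\<bar> < e) sequentially"
        using tendstoD[OF elim e] by (simp add: dist_real_def)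
      then have "eventually (\<lambda>n. (indicator (dev e (X n) Y) w :: real) = 0) sequentially"
        by eventually_elim auto
      then show ?case by (rule tendsto_eventually)
    qed
  qed (auto simp: indicator_def)
  then show "(\<lambda>n. prob (dev e (X n) Y)) \<longlonglongrightarrow> 0" by simp
qed

lemma conv_prob_L1:
  assumes X: "\<And>n. X n \<in> borel_measurable M" and Y: "Y \<in> borel_measurable M"
    and i: "\<And>n. integrable M (\<lambda>w. \<bar>X n w - Y w\<bar>)"
    and lim: "(\<lambda>n. expectation (\<lambda>w. \<bar>X n w - Y w\<bar>)) \<longlonglongrightarrow> 0"
  shows "conv_prob X Y"
  unfolding conv_prob_def
proof (intro conjI allI impI X Y)
  fix e :: real assume e: "0 < e"
  have lim': "(\<lambda>n. expectation (\<lambda>w. \<bar>X n w - Y w\<bar>) / e) \<longlonglongrightarrow> 0"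
    using tendsto_divide[OF lim tendsto_const[of e]] e by simp
  show "(\<lambda>n. prob (dev e (X n) Y)) \<longlonglongrightarrow> 0"
    by (rule tendsto_sandwich[OF _ _ tendsto_const lim'])
      (use prob_markov[OF i _ e order_refl] in auto)
qed

end

lemma nat_floor_div_tendsto:
  assumes "0 \<le> b" shows "(\<lambda>n. real (nat \<lfloor>real n * b\<rfloor>) / real n) \<longlonglongrightarrow> b"
proof (rule tendsto_sandwich[where f = "\<lambda>n. b - 1 / real n" and h = "\<lambda>n. b"])
  show "(\<lambda>n. b - 1 / real n) \<longlonglongrightarrow> b" using tendsto_diff[OF tendsto_const lim_1_over_n, of b] by simp
  have *: "real n * b - 1 \<le> real (nat \<lfloor>real n * b\<rfloor>)" "real (nat \<lfloor>real n * b\<rfloor>) \<le> real n * b" for n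
  proof -
    have "0 \<le> real n * b" using assms by simp
    then show "real n * b - 1 \<le> real (nat \<lfloor>real n * b\<rfloor>)" "real (nat \<lfloor>real n * b\<rfloor>) \<le> real n * b" by linarith+
  qed
  show "\<forall>\<^sub>F n in sequentially. b - 1 / real n \<le> real (nat \<lfloor>real n * b\<rfloor>) / real n"
    using eventually_gt_at_top[of 0]
  proof eventually_elim
    case (elim n)
    then have "b - 1 / real n = (real n * b - 1) / real n" by (simp add: field_simps)
    then show ?case using *(1)[of n] by (simp only: divide_right_mono of_nat_0_le_iff)
  qed
  show "\<forall>\<^sub>F n in sequentially. real (nat \<lfloor>real n * b\<rfloor>) / real n \<le> b"
    using eventually_gt_at_top[of 0]
  proof eventually_elim
    case (elim n)
    then show ?case using divide_right_mono[OF *(2)[of n], of "real n"] by simp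
  qed
qed auto

context brownian_setup begin

text \<open>The floor counts exactly the blocks lying in \<open>{0..b}\<close>, that is, those with
  right end at most \<open>b\<close>.\<close>

definition U :: "real \<Rightarrow> nat \<Rightarrow> 'a \<Rightarrow> real" where
  "U b n w = (\<Sum>i<nat \<lfloor>real n * b\<rfloor>. (W_osc w (block n i))\<^sup>2)"

lemma U_conv_prob:
  assumes b: "0 \<le> b" "b \<le> 1"
  shows "conv_prob (U b) (\<lambda>_. b * lam2)"
proof -
  let ?m = "\<lambda>n. nat \<lfloor>real n * b\<rfloor>"
  have m: "?m n \<le> n" for n
  proof -
    have "real n * b \<le> real n" using b by (simp add: mult_left_le)
    then show ?thesis by linarith
  qed
  have mU: "U b n \<in> borel_measurable N" for n
    unfolding U_def using block_nonempty
    by (intro borel_measurable_sum borel_measurable_power osc_W_measurable) auto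
  have iU: "integrable N (U b n)" for n
  proof (cases "n = 0")
    case True then show ?thesis unfolding U_def by simp
  next
    case False then show ?thesis unfolding U_def using range_sum_L1(2)[OF _ m zero_less_one] by blast
  qed
  \<comment> \<open>The random error is handled with the exact fraction of counted blocks; the
    convergence of that fraction to \<open>b\<close> is deterministic and added afterwards.\<close>
  have c1: "conv_prob (\<lambda>n w. U b n w - real (?m n) / n * lam2) (\<lambda>_. 0)"
  proof (rule conv_prob_L1)
    show "(\<lambda>n. expectation (\<lambda>w. \<bar>U b n w - real (?m n) / n * lam2 - 0\<bar>)) \<longlonglongrightarrow> 0"
      using range_sum_lln[of ?m, OF m] by (simp add: U_def)
    show "integrable N (\<lambda>w. \<bar>U b n w - real (?m n) / n * lam2 - 0\<bar>)" for n
      using iU[of n] by (intro integrable_abs Bochner_Integration.integrable_diff) auto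
  qed (use mU in auto)
  have c2: "conv_prob (\<lambda>n w. real (?m n) / n * lam2) (\<lambda>_. b * lam2)"
    by (rule conv_prob_AE) (use tendsto_mult[OF nat_floor_div_tendsto[OF b(1)] tendsto_const] in auto)
  from conv_prob_add[OF c1 c2] show ?thesis by simp
qed

end

section \<open>The energy of integrands and the limit for simple integrals\<close>

abbreviation sqint :: "(real \<Rightarrow> real) \<Rightarrow> real" where
  "sqint f \<equiv> (LBINT u:{0..1}. (f u)\<^sup>2)"

lemma sqint_nonneg: "0 \<le> sqint f"
  unfolding set_lebesgue_integral_def by (intro integral_nonneg_AE AE_I2) (auto simp: indicator_def)

text \<open>The left-open intervals of a monotone partition are disjoint, so at most one summand is
  nonzero and squaring produces no cross terms.\<close>

lemma simple_process_square:
  assumes "mono_on {..k} s"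
  shows "(simple_process k s \<xi> t w)\<^sup>2 = (\<Sum>j<k. (\<xi> j w)\<^sup>2 * indicator {s j<..s (Suc j)} t)"
proof (cases "\<exists>j<k. t \<in> {s j<..s (Suc j)}")
  case True
  then obtain j where j: "j < k" "t \<in> {s j<..s (Suc j)}" by blast
  have other: "indicator {s i<..s (Suc i)} t = (0::real)" if i: "i < k" "i \<noteq> j" for i
  proof (cases "i < j")
    case True
    then have "s (Suc i) \<le> s j" using assms j i by (auto intro!: mono_onD[OF assms])
    with j show ?thesis by (auto simp: indicator_def)
  next
    case False
    then have "s (Suc j) \<le> s i" using assms j i by (auto intro!: mono_onD[OF assms])
    with j show ?thesis by (auto simp: indicator_def)
  qed
  have pick: "(\<Sum>i<k. f i * indicator {s i<..s (Suc i)} t) = f j" for f :: "nat \<Rightarrow> real"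
  proof -
    have "(\<Sum>i<k. f i * indicator {s i<..s (Suc i)} t) = (\<Sum>i\<in>{j}. f i * indicator {s i<..s (Suc i)} t)"
      by (rule sum.mono_neutral_right) (use j other in auto)
    also have "\<dots> = f j" by (subst sum.insert) (use j in auto)
    finally show ?thesis .
  qed
  show ?thesis unfolding simple_process_def pick by simp
next
  case False
  then have "indicator {s j<..s (Suc j)} t = (0::real)" if "j < k" for j using that by (auto simp: indicator_def)
  then show ?thesis by (simp add: simple_process_def)
qed

text \<open>Partition points may exceed 1; capping them at 1 cuts the intervals down to the unit
  interval and makes those beyond it empty.\<close>

lemma simple_process_square_integral:
  assumes s: "mono_on {..k} s" "0 \<le> s 0"
  shows "set_integrable lborel {0..1} (\<lambda>u. (simple_process k s \<xi> u w)\<^sup>2)"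
    and "(LBINT u:{0..1}. (simple_process k s \<xi> u w)\<^sup>2) = (\<Sum>j<k. (\<xi> j w)\<^sup>2 * (min 1 (s (Suc j)) - min 1 (s j)))"
proof -
  have mono: "s j \<le> s (Suc j)" "0 \<le> s j" if "j < k" for j
    using mono_onD[OF s(1), of j "Suc j"] mono_onD[OF s(1), of 0 j] s(2) that by auto
  have eq: "indicator {0..1} u *\<^sub>R (simple_process k s \<xi> u w)\<^sup>2 =
    (\<Sum>j<k. (\<xi> j w)\<^sup>2 * indicator {min 1 (s j)<..min 1 (s (Suc j))} u)" for u
    unfolding simple_process_square[OF s(1)] scaleR_sum_right
  proof (rule sum.cong[OF refl])
    fix j assume "j \<in> {..<k}"
    then show "indicator {0..1} u *\<^sub>R ((\<xi> j w)\<^sup>2 * indicator {s j<..s (Suc j)} u) = (\<xi> j w)\<^sup>2 * indicator {min 1 (s j)<..min 1 (s (Suc j))} u"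
      using mono[of j] by (auto simp: indicator_def)
  qed
  have i: "integrable lborel (\<lambda>u. (\<xi> j w)\<^sup>2 * indicator {min 1 (s j)<..min 1 (s (Suc j))} u)" if "j < k" for j
    using mono[OF that] by (intro integrable_mult_right integrable_real_indicator) (auto simp: emeasure_lborel_Ioc min.coboundedI2)
  show "set_integrable lborel {0..1} (\<lambda>u. (simple_process k s \<xi> u w)\<^sup>2)"
    unfolding set_integrable_def eq using i by (intro Bochner_Integration.integrable_sum) auto
  have "(LBINT u:{0..1}. (simple_process k s \<xi> u w)\<^sup>2) = (\<Sum>j<k. LBINT u. (\<xi> j w)\<^sup>2 * indicator {min 1 (s j)<..min 1 (s (Suc j))} u)"
    unfolding set_lebesgue_integral_def eq using i by (intro Bochner_Integration.integral_sum) auto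
  also have "\<dots> = (\<Sum>j<k. (\<xi> j w)\<^sup>2 * (min 1 (s (Suc j)) - min 1 (s j)))"
  proof (rule sum.cong[OF refl])
    fix j assume "j \<in> {..<k}"
    then have "min 1 (s j) \<le> min 1 (s (Suc j))" using mono[of j] by auto
    then show "(LBINT u. (\<xi> j w)\<^sup>2 * indicator {min 1 (s j)<..min 1 (s (Suc j))} u) = (\<xi> j w)\<^sup>2 * (min 1 (s (Suc j)) - min 1 (s j))"
      by simp
  qed
  finally show "(LBINT u:{0..1}. (simple_process k s \<xi> u w)\<^sup>2) = (\<Sum>j<k. (\<xi> j w)\<^sup>2 * (min 1 (s (Suc j)) - min 1 (s j)))" .
qed

context brownian_setup begin

lemma simple_integrand_times:
  assumes si: "simple_integrand M F k s \<xi>"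
  shows "mono_on {..k} s" "0 \<le> s 0" "j \<le> k \<Longrightarrow> 0 \<le> s j" "j < k \<Longrightarrow> s j \<le> s (Suc j)"
proof -
  show s: "mono_on {..k} s" "0 \<le> s 0" using si by (auto simp: simple_integrand_def)
  show "j \<le> k \<Longrightarrow> 0 \<le> s j" "j < k \<Longrightarrow> s j \<le> s (Suc j)"
    using mono_onD[OF s(1), of 0 j] mono_onD[OF s(1), of j "Suc j"] s(2) by auto
qed

lemma simple_integral_measurable:
  assumes si: "simple_integrand M F k s \<xi>" and sp: "space M = space N" and t: "0 \<le> t"
  shows "simple_integral W k s \<xi> t \<in> borel_measurable N"
proof -
  note s0 = simple_integrand_times(3)[OF si]
  have "(\<lambda>w. \<xi> j w * (W (min t (s (Suc j))) w - W (min t (s j)) w)) \<in> borel_measurable N" if "j < k" for j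
  proof -
    have "\<xi> j \<in> borel_measurable N" using si that F_measurable[of "\<xi> j" "s j"] by (auto simp: simple_integrand_def)
    moreover have "W (min t (s (Suc j))) \<in> borel_measurable N" "W (min t (s j)) \<in> borel_measurable N"
      using s0[of j] s0[of "Suc j"] that t by (auto intro!: W_measurable)
    ultimately show ?thesis by simp
  qed
  then have "(\<lambda>w. simple_integral W k s \<xi> t w) \<in> borel_measurable N"
    unfolding simple_integral_def by (intro borel_measurable_sum) auto
  then show ?thesis by simp
qed

lemma simple_integral_continuous:
  assumes si: "simple_integrand M F k s \<xi>"
  shows "AE w in N. continuous_on {0..} (\<lambda>t. simple_integral W k s \<xi> t w)"
  using W_cont
proof eventually_elim
  case (elim w)
  note s0 = simple_integrand_times(3)[OF si]
  have c: "continuous_on {0..} (\<lambda>t. W (min t (s j)) w)" if "j \<le> k" for j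
    by (rule continuous_on_compose2[OF elim]) (use s0[OF that] in \<open>auto intro!: continuous_intros\<close>)
  show ?case unfolding simple_integral_def
    by (intro continuous_on_sum continuous_on_mult continuous_on_const continuous_on_diff c) auto
qed

lemma block_norm_measurable:
  assumes X: "\<And>t. 0 \<le> t \<Longrightarrow> X t \<in> borel_measurable N" and c: "AE w in N. continuous_on {0..1} (\<lambda>t. X t w)"
  shows "(\<lambda>w. block_norm n (\<lambda>t. X t w)) \<in> borel_measurable N"
proof -
  have "(\<lambda>w. (block_norm n (\<lambda>t. X t w))\<^sup>2) \<in> borel_measurable N"
    unfolding block_norm_square
  proof (intro borel_measurable_sum borel_measurable_power osc_path_measurable)
    fix i t assume "t \<in> block n i"
    then have "0 \<le> t" by (auto intro: order_trans[rotated])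
    then show "X t \<in> borel_measurable N" by (rule X)
  next
    fix i assume "i \<in> {..<n}"
    then have blk: "block n i \<subseteq> {0..1}" using block_subset by simp
    show "AE w in N. continuous_on (block n i) (\<lambda>t. X t w)"
      using c
    proof eventually_elim
      case (elim w)
      then show ?case using blk by (rule continuous_on_subset)
    qed
  qed (rule block_nonempty)
  then have "(\<lambda>w. sqrt ((block_norm n (\<lambda>t. X t w))\<^sup>2)) \<in> borel_measurable N" by (rule measurable_compose) measurable
  then show ?thesis by (simp add: block_norm_nonneg)
qed

text \<open>On a block without interior break points the integral is a multiple of \<open>W\<close>,
  so its squared range is that of \<open>W\<close> times the squared coefficient, read off at the
  right end. The sum \<open>?V\<close> of these products is a combination of the sums
  \<open>U\<close> at the partition times, whose limits add up to the energy times
  \<open>lam2\<close>.\<close>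

lemma simple_integral_block_norm_conv_prob:
  assumes si: "simple_integrand M F k s \<xi>" and sp: "space M = space N"
  shows "conv_prob (\<lambda>n w. block_norm n (\<lambda>t. simple_integral W k s \<xi> t w))
    (\<lambda>w. sqrt (lam2 * (LBINT u:{0..1}. (simple_process k s \<xi> u w)\<^sup>2)))"
proof -
  note s = simple_integrand_times[OF si]
  have mono: "s j \<le> s (Suc j)" "0 \<le> s j" "0 \<le> s (Suc j)" if "j < k" for j
    using s(3)[of j] s(3)[of "Suc j"] s(4)[of j] that by auto
  have \<xi>: "\<xi> j \<in> borel_measurable N" "\<exists>C. \<forall>w\<in>space N. \<bar>\<xi> j w\<bar> \<le> C" if "j < k" for j
    using si that F_measurable[of "\<xi> j" "s j"] by (auto simp: simple_integrand_def sp)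
  let ?H = "simple_process k s \<xi>" and ?J = "simple_integral W k s \<xi>"
  let ?V = "\<lambda>n w. \<Sum>i<n. (?H (real (Suc i) / n) w)\<^sup>2 * (W_osc w (block n i))\<^sup>2"
  let ?m = "\<lambda>j. min 1 (s j)"
  have V: "?V n w = (\<Sum>j<k. (\<xi> j w)\<^sup>2 * (U (?m (Suc j)) n w - U (?m j) n w))" for n w
  proof -
    let ?r = "\<lambda>i. (W_osc w (block n i))\<^sup>2"
    have U: "U b n w = (\<Sum>i<n. (if real (Suc i) / n \<le> b then 1 else 0) * ?r i)" if b: "0 \<le> b" "b \<le> 1" for b
    proof -
      \<comment> \<open>The off-by-one of the floor: block \<open>i\<close> is counted precisely
        when its right end \<open>(i + 1) / n\<close> does not pass \<open>b\<close>.\<close>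
      have iff: "i < nat \<lfloor>real n * b\<rfloor> \<longleftrightarrow> i < n \<and> real (Suc i) / n \<le> b" for i
      proof (cases "n = 0")
        case False
        have "i < nat \<lfloor>real n * b\<rfloor> \<longleftrightarrow> real (Suc i) \<le> real n * b" by linarith
        also have "\<dots> \<longleftrightarrow> real (Suc i) / n \<le> b" using False by (simp add: field_simps)
        also have "\<dots> \<longleftrightarrow> i < n \<and> real (Suc i) / n \<le> b"
        proof -
          have "i < n" if "real (Suc i) / n \<le> b"
          proof -
            have "real (Suc i) / n \<le> 1" using that b by linarith
            then show ?thesis using False by (simp add: field_simps)
          qed
          then show ?thesis by blast
        qed
        finally show ?thesis .
      qed simp
      have "U b n w = (\<Sum>i\<in>{i. i < n \<and> real (Suc i) / n \<le> b}. ?r i)"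
        unfolding U_def by (rule sum.cong) (use iff in auto)
      also have "\<dots> = (\<Sum>i<n. (if real (Suc i) / n \<le> b then 1 else 0) * ?r i)"
        by (rule sum.mono_neutral_cong_left) auto
      finally show ?thesis .
    qed
    have "?V n w = (\<Sum>i<n. \<Sum>j<k. (\<xi> j w)\<^sup>2 * (indicator {s j<..s (Suc j)} (real (Suc i) / n) * ?r i))"
      unfolding simple_process_square[OF s(1)] by (simp only: sum_distrib_right mult.assoc)
    also have "\<dots> = (\<Sum>j<k. \<Sum>i<n. (\<xi> j w)\<^sup>2 * (indicator {s j<..s (Suc j)} (real (Suc i) / n) * ?r i))"
      by (rule sum.swap)
    also have "\<dots> = (\<Sum>j<k. (\<xi> j w)\<^sup>2 * (U (?m (Suc j)) n w - U (?m j) n w))"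
    proof (rule sum.cong[OF refl])
      fix j assume "j \<in> {..<k}"
      then have j: "s j \<le> s (Suc j)" "0 \<le> s j" "0 \<le> s (Suc j)" using mono by auto
      have "U (?m (Suc j)) n w - U (?m j) n w = (\<Sum>i<n. indicator {s j<..s (Suc j)} (real (Suc i) / n) * ?r i)"
      proof -
        have "U (?m (Suc j)) n w - U (?m j) n w =
          (\<Sum>i<n. (if real (Suc i) / n \<le> ?m (Suc j) then 1 else 0) * ?r i - (if real (Suc i) / n \<le> ?m j then 1 else 0) * ?r i)"
          using j by (subst (1 2) U) (auto simp: sum_subtractf)
        also have "\<dots> = (\<Sum>i<n. indicator {s j<..s (Suc j)} (real (Suc i) / n) * ?r i)"
        proof (rule sum.cong[OF refl])
          fix i assume "i \<in> {..<n}"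
          then have "real (Suc i) / n \<le> 1" by (simp add: divide_le_eq_1)
          with j show "(if real (Suc i) / n \<le> ?m (Suc j) then 1 else 0) * ?r i - (if real (Suc i) / n \<le> ?m j then 1 else 0) * ?r i =
            indicator {s j<..s (Suc j)} (real (Suc i) / n) * ?r i" by (auto simp del: of_nat_Suc simp: indicator_def)
        qed
        finally show ?thesis .
      qed
      then show "(\<Sum>i<n. (\<xi> j w)\<^sup>2 * (indicator {s j<..s (Suc j)} (real (Suc i) / n) * ?r i)) = (\<xi> j w)\<^sup>2 * (U (?m (Suc j)) n w - U (?m j) n w)"
        by (simp only: sum_distrib_left)
    qed
    finally show ?thesis .
  qed
  have cV: "conv_prob (\<lambda>n w. ?V n w) (\<lambda>w. lam2 * sqint (\<lambda>u. ?H u w))"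
  proof -
    have "conv_prob (\<lambda>n w. \<Sum>j<k. (\<xi> j w)\<^sup>2 * (U (?m (Suc j)) n w - U (?m j) n w)) (\<lambda>w. \<Sum>j<k. (\<xi> j w)\<^sup>2 * (?m (Suc j) * lam2 - ?m j * lam2))"
    proof (rule conv_prob_sum)
      fix j assume "j \<in> {..<k}"
      then have j: "j < k" by simp
      obtain C where C: "\<And>w. w \<in> space N \<Longrightarrow> \<bar>\<xi> j w\<bar> \<le> C" using \<xi>(2)[OF j] by blast
      have neg: "conv_prob (\<lambda>n w. - 1 * U (?m j) n w) (\<lambda>w. - 1 * (?m j * lam2))"
        by (rule conv_prob_mult_bounded[OF U_conv_prob, where C = 1]) (use mono[OF j] in auto)
      have pos: "conv_prob (U (?m (Suc j))) (\<lambda>w. ?m (Suc j) * lam2)" by (rule U_conv_prob) (use mono[OF j] in auto)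
      have d: "conv_prob (\<lambda>n w. U (?m (Suc j)) n w - U (?m j) n w) (\<lambda>w. ?m (Suc j) * lam2 - ?m j * lam2)"
        using conv_prob_add[OF pos neg] by simp
      show "conv_prob (\<lambda>n w. (\<xi> j w)\<^sup>2 * (U (?m (Suc j)) n w - U (?m j) n w)) (\<lambda>w. (\<xi> j w)\<^sup>2 * (?m (Suc j) * lam2 - ?m j * lam2))"
      proof (rule conv_prob_mult_bounded[OF d, where C = "C\<^sup>2"])
        show "(\<lambda>w. (\<xi> j w)\<^sup>2) \<in> borel_measurable N" using \<xi>(1)[OF j] by simp
        show "\<bar>(\<xi> j w)\<^sup>2\<bar> \<le> C\<^sup>2" if "w \<in> space N" for w
          using power_mono[OF C[OF that], of 2] by simp
      qed
    qed simp
    then show ?thesis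
      unfolding V simple_process_square_integral(2)[OF s(1,2)] by (simp add: sum_distrib_left algebra_simps)
  qed
  have Jc: "AE w in N. continuous_on {0..} (\<lambda>t. ?J t w)" by (rule simple_integral_continuous[OF si])
  have Jc1: "AE w in N. continuous_on {0..1} (\<lambda>t. ?J t w)"
    using Jc by eventually_elim (rule continuous_path_Icc; simp)
  have mq: "(\<lambda>w. (block_norm n (\<lambda>t. ?J t w))\<^sup>2) \<in> borel_measurable N" for n
    by (rule borel_measurable_power[OF block_norm_measurable[OF simple_integral_measurable[OF si sp] Jc1]])
  \<comment> \<open>The blocks that contain break points disappear almost surely, path by path, by
    continuity of \<open>W\<close> and of the integral.\<close>
  have cD: "conv_prob (\<lambda>n w. (block_norm n (\<lambda>t. ?J t w))\<^sup>2 - ?V n w) (\<lambda>_. 0)"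
  proof (rule conv_prob_AE)
    show "(\<lambda>w. (block_norm n (\<lambda>t. ?J t w))\<^sup>2 - ?V n w) \<in> borel_measurable N" for n
      using mq[of n] conv_probD(1)[OF cV, of n] by (rule borel_measurable_diff)
    show "AE w in N. (\<lambda>n. (block_norm n (\<lambda>t. ?J t w))\<^sup>2 - ?V n w) \<longlonglongrightarrow> 0"
      using Jc W_cont AE_space
    proof eventually_elim
      case (elim w)
      show ?case unfolding block_norm_square
      proof (rule range_square_sum_diff_tendsto[where G = "s ` {..k}" and C = "\<Sum>j<k. \<bar>\<xi> j w\<bar>"])
        show "continuous_on {0..1} (\<lambda>t. ?J t w)" "continuous_on {0..1} (\<lambda>t. W t w)"
          using elim by (auto intro: continuous_path_Icc)
        show "\<bar>?H t w\<bar> \<le> (\<Sum>j<k. \<bar>\<xi> j w\<bar>)" for t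
          unfolding simple_process_def
          by (rule order_trans[OF sum_abs sum_mono]) (auto simp: indicator_def)
        fix n i :: nat assume i: "i < n" and gap: "s ` {..k} \<inter> {real i / n<..<real (Suc i) / n} = {}"
        have "0 \<le> real i / n" by simp
        with elementary_simple[OF si sp] block_nonempty[of i n] gap
        obtain x where x: "elementary_on (real i / n) (real (Suc i) / n) ?H ?J x"
          unfolding elementary_def by blast
        have J: "?J t w - ?J (real i / n) w = x w * (W t w - W (real i / n) w)" if "t \<in> block n i" for t
          using x that elim(3) unfolding elementary_on_def by blast
        \<comment> \<open>The right end belongs to the left-open interval on which \<open>H\<close>
          is constant, whereas the left end may still carry the preceding value.\<close>
        have "real (Suc i) / n \<in> {real i / n<..real (Suc i) / n}" using i by (simp add: divide_strict_right_mono)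
        then have H: "?H (real (Suc i) / n) w = x w" using x elim(3) unfolding elementary_on_def by blast
        have "osc (\<lambda>t. ?J t w) (block n i) = osc (\<lambda>t. x w * W t w) (block n i)"
        proof (rule osc_cong)
          fix u t assume "u \<in> block n i" "t \<in> block n i"
          then show "?J t w - ?J u w = x w * W t w - x w * W u w"
            using J[of t] J[of u] by (simp add: algebra_simps)
        qed
        also have "\<dots> = \<bar>x w\<bar> * W_osc w (block n i)"
        proof (rule osc_cmult)
          have "continuous_on (block n i) (\<lambda>t. W t w)" using elim(2) by (rule continuous_path_Icc) simp
          then show "bounded ((\<lambda>t. W t w) ` block n i)" by (rule continuous_bounded_Icc)
        qed (use block_nonempty in auto)
        finally show "osc (\<lambda>t. ?J t w) (block n i) = \<bar>?H (real (Suc i) / n) w\<bar> * W_osc w (block n i)" unfolding H .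
      qed simp
    qed
  qed simp
  have "conv_prob (\<lambda>n w. (block_norm n (\<lambda>t. ?J t w))\<^sup>2) (\<lambda>w. lam2 * sqint (\<lambda>u. ?H u w))"
    using conv_prob_add[OF cD cV] by simp
  from conv_prob_sqrt[OF this] show ?thesis using block_norm_nonneg lam2_pos sqint_nonneg by (simp add: less_imp_le)
qed

end

section \<open>Approximation of general integrands\<close>

text \<open>Measurability is listed separately because integrability of the square does not
  determine the sign of \<open>f\<close> measurably, and sums must remain measurable.\<close>

definition square_int :: "(real \<Rightarrow> real) \<Rightarrow> bool" where
  "square_int f \<longleftrightarrow> set_borel_measurable lborel {0..1} f \<and> set_integrable lborel {0..1} (\<lambda>u. (f u)\<^sup>2)"

text \<open>A weighted Cauchy-Schwarz inequality. Weights 1 give the factor 2; weights close to the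
  two norms give Minkowski's inequality for \<open>sqint\<close>.\<close>

lemma square_add_le:
  fixes x y :: real assumes "0 < a" "0 < b"
  shows "(x + y)\<^sup>2 \<le> (a + b) * (x\<^sup>2 / a + y\<^sup>2 / b)"
proof -
  have "0 \<le> (b * x - a * y)\<^sup>2" by simp
  then have "2 * (a * b) * (x * y) \<le> b\<^sup>2 * x\<^sup>2 + a\<^sup>2 * y\<^sup>2" by (simp add: power2_eq_square algebra_simps)
  then have "2 * (x * y) \<le> (b\<^sup>2 * x\<^sup>2 + a\<^sup>2 * y\<^sup>2) / (a * b)" using assms by (simp add: field_simps)
  also have "\<dots> = b * x\<^sup>2 / a + a * y\<^sup>2 / b" using assms by (simp add: field_simps power2_eq_square)
  finally have "(x + y)\<^sup>2 \<le> x\<^sup>2 + y\<^sup>2 + b * x\<^sup>2 / a + a * y\<^sup>2 / b" by (simp add: power2_sum)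
  also have "\<dots> = (a + b) * (x\<^sup>2 / a + y\<^sup>2 / b)" using assms by (simp add: field_simps)
  finally show ?thesis .
qed

lemma square_int_add:
  assumes f: "square_int f" and g: "square_int g"
  shows "square_int (\<lambda>u. f u + g u)"
proof -
  have m: "set_borel_measurable lborel {0..1} (\<lambda>u. f u + g u)"
    using f g unfolding square_int_def set_borel_measurable_def by (auto simp: distrib_left intro!: borel_measurable_add)
  have eq: "indicator {0..1} u *\<^sub>R (f u + g u)\<^sup>2 = (indicator {0..1} u *\<^sub>R (f u + g u))\<^sup>2" for u
    by (simp add: indicator_def)
  have "set_integrable lborel {0..1} (\<lambda>u. 2 * (f u)\<^sup>2 + 2 * (g u)\<^sup>2)"
    using f g unfolding square_int_def by (intro set_integral_add set_integrable_mult_right) auto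
  then have "set_integrable lborel {0..1} (\<lambda>u. (f u + g u)\<^sup>2)"
    unfolding set_integrable_def
  proof (rule Bochner_Integration.integrable_bound)
    show "(\<lambda>u. indicator {0..1} u *\<^sub>R (f u + g u)\<^sup>2) \<in> borel_measurable lborel"
      unfolding eq using m unfolding set_borel_measurable_def by simp
    show "AE u in lborel. norm (indicator {0..1} u *\<^sub>R (f u + g u)\<^sup>2) \<le> norm (indicator {0..1} u *\<^sub>R (2 * (f u)\<^sup>2 + 2 * (g u)\<^sup>2))"
      using square_add_le[of 1 1] by (intro AE_I2) (auto simp: indicator_def)
  qed
  with m show ?thesis by (simp add: square_int_def)
qed

lemma square_int_uminus: "square_int f \<Longrightarrow> square_int (\<lambda>u. - f u)"
  by (simp add: square_int_def set_borel_measurable_def)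

lemma square_int_diff: "square_int f \<Longrightarrow> square_int g \<Longrightarrow> square_int (\<lambda>u. f u - g u)"
  using square_int_add[OF _ square_int_uminus] by fastforce

lemma sqint_add_le:
  assumes f: "square_int f" and g: "square_int g" and ab: "0 < a" "0 < b"
  shows "sqint (\<lambda>u. f u + g u) \<le> (a + b) * (sqint f / a + sqint g / b)"
proof -
  have i: "set_integrable lborel {0..1} (\<lambda>u. (f u)\<^sup>2)" "set_integrable lborel {0..1} (\<lambda>u. (g u)\<^sup>2)"
    using f g by (auto simp: square_int_def)
  have "sqint (\<lambda>u. f u + g u) \<le> (LBINT u:{0..1}. (a + b) * ((f u)\<^sup>2 / a + (g u)\<^sup>2 / b))"
  proof (rule set_integral_mono)
    show "set_integrable lborel {0..1} (\<lambda>u. (f u + g u)\<^sup>2)" using square_int_add[OF f g] by (simp add: square_int_def)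
    show "set_integrable lborel {0..1} (\<lambda>u. (a + b) * ((f u)\<^sup>2 / a + (g u)\<^sup>2 / b))"
      using i by (intro set_integrable_mult_right set_integral_add set_integrable_divide) auto
  qed (rule square_add_le[OF ab])
  also have "\<dots> = (a + b) * (sqint f / a + sqint g / b)"
    using i by (simp add: set_integral_add set_integrable_divide)
  finally show ?thesis .
qed

text \<open>The weights are the two norms, raised by \<open>e / 2\<close> so that division is
  possible when a norm is zero.\<close>

lemma sqrt_sqint_triangle:
  assumes f: "square_int f" and g: "square_int g"
  shows "sqrt (sqint (\<lambda>u. f u + g u)) \<le> sqrt (sqint f) + sqrt (sqint g)"
proof (rule field_le_epsilon)
  fix e :: real assume e: "0 < e"
  define a b where "a = sqrt (sqint f) + e / 2" and "b = sqrt (sqint g) + e / 2"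
  have ab: "0 < a" "0 < b" using e sqint_nonneg by (auto simp: a_def b_def intro!: add_nonneg_pos)
  have le: "sqrt (sqint f) \<le> a" "sqrt (sqint g) \<le> b" using e by (auto simp: a_def b_def)
  have "(sqrt (sqint f))\<^sup>2 \<le> a\<^sup>2" by (rule power_mono[OF le(1)]) (simp add: sqint_nonneg)
  moreover have "(sqrt (sqint g))\<^sup>2 \<le> b\<^sup>2" by (rule power_mono[OF le(2)]) (simp add: sqint_nonneg)
  ultimately have "sqint f / a \<le> a" "sqint g / b \<le> b" using ab sqint_nonneg by (auto simp: field_simps power2_eq_square)
  then have "(a + b) * (sqint f / a + sqint g / b) \<le> (a + b) * (a + b)" using ab by (intro mult_left_mono add_mono) auto
  with sqint_add_le[OF f g ab] have "sqint (\<lambda>u. f u + g u) \<le> (a + b)\<^sup>2" by (simp add: power2_eq_square)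
  then have "sqrt (sqint (\<lambda>u. f u + g u)) \<le> a + b" using ab by (intro real_le_lsqrt) auto
  then show "sqrt (sqint (\<lambda>u. f u + g u)) \<le> sqrt (sqint f) + sqrt (sqint g) + e" by (simp add: a_def b_def)
qed

lemma sqint_minus_commute: "sqint (\<lambda>u. f u - g u) = sqint (\<lambda>u. g u - f u)"
  by (simp add: power2_commute)

lemma sqrt_sqint_diff:
  assumes f: "square_int f" and g: "square_int g"
  shows "\<bar>sqrt (sqint f) - sqrt (sqint g)\<bar> \<le> sqrt (sqint (\<lambda>u. f u - g u))"
proof -
  have "sqrt (sqint f) \<le> sqrt (sqint (\<lambda>u. f u - g u)) + sqrt (sqint g)"
    using sqrt_sqint_triangle[OF square_int_diff[OF f g] g] by simp
  moreover have "sqrt (sqint g) \<le> sqrt (sqint (\<lambda>u. f u - g u)) + sqrt (sqint f)"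
    using sqrt_sqint_triangle[OF square_int_diff[OF g f] f] sqint_minus_commute[of f g] by simp
  ultimately show ?thesis by linarith
qed

lemma sqint_diff_le:
  assumes "square_int f" "square_int g" "square_int h"
  shows "sqint (\<lambda>u. f u - g u) \<le> 2 * sqint (\<lambda>u. f u - h u) + 2 * sqint (\<lambda>u. g u - h u)"
proof -
  have "sqint (\<lambda>u. (f u - h u) + (h u - g u)) \<le> (1 + 1) * (sqint (\<lambda>u. f u - h u) / 1 + sqint (\<lambda>u. h u - g u) / 1)"
    by (intro sqint_add_le square_int_diff assms) auto
  then show ?thesis using sqint_minus_commute[of h g] by simp
qed

lemma square_int_simple:
  assumes "mono_on {..k} s" "0 \<le> s 0"
  shows "square_int (\<lambda>u. simple_process k s \<xi> u w)"
proof -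
  have "(\<lambda>u. simple_process k s \<xi> u w) \<in> borel_measurable lborel"
    unfolding simple_process_def by measurable
  then have "set_borel_measurable lborel {0..1} (\<lambda>u. simple_process k s \<xi> u w)"
    unfolding set_borel_measurable_def by measurable
  with simple_process_square_integral(1)[OF assms] show ?thesis by (simp add: square_int_def)
qed

text \<open>Squaring is not uniformly continuous, so \<open>conv_prob_transfer\<close> does not
  apply. Outside an event of small probability \<open>Y\<close> is bounded by some \<open>K\<close>,
  and there \<open>X + Y\<close> is at most \<open>1 + 2 * K\<close> once \<open>X\<close> and
  \<open>Y\<close> differ by at most 1.\<close>

lemma (in prob_space) conv_prob_square:
  assumes X: "conv_prob X Y"
  shows "conv_prob (\<lambda>n w. (X n w)\<^sup>2) (\<lambda>w. (Y w)\<^sup>2)"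
  unfolding conv_prob_def
proof (intro conjI allI impI)
  note [measurable] = conv_probD(1,2)[OF X]
  show "(\<lambda>w. (X n w)\<^sup>2) \<in> borel_measurable M" for n by measurable
  show "(\<lambda>w. (Y w)\<^sup>2) \<in> borel_measurable M" by measurable
  fix e :: real assume e: "0 < e"
  show "(\<lambda>n. prob {w \<in> space M. e < \<bar>(X n w)\<^sup>2 - (Y w)\<^sup>2\<bar>}) \<longlonglongrightarrow> 0"
  proof (rule LIMSEQ_I)
    fix \<eta> :: real assume \<eta>: "0 < \<eta>"
    \<comment> \<open>Tightness of the single variable \<open>Y\<close>, expressed as convergence of
      \<open>Y / n\<close> to zero; \<open>K\<close> is then a suitable n.\<close>
    have "conv_prob (\<lambda>n w. Y w / real n) (\<lambda>_. 0)"
      by (rule conv_prob_AE) (auto intro!: AE_I2 tendsto_divide_0[OF tendsto_const] filterlim_at_top_imp_at_infinity filterlim_real_sequentially)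
    from conv_probD(3)[OF this zero_less_one]
    have "eventually (\<lambda>n. prob {w \<in> space M. 1 < \<bar>Y w / real n - 0\<bar>} < \<eta> / 2 \<and> 0 < n) sequentially"
      using \<eta> by (intro eventually_conj order_tendstoD(2) eventually_gt_at_top) auto
    from eventually_happens'[OF sequentially_bot this]
    obtain K :: nat where K: "prob {w \<in> space M. 1 < \<bar>Y w / real K\<bar>} < \<eta> / 2" "0 < K" by auto
    define d where "d = min 1 (e / (1 + 2 * K))"
    have d: "0 < d" "d \<le> 1" "d * (1 + 2 * K) \<le> e"
    proof -
      have "d \<le> e / (1 + 2 * K)" by (simp add: d_def)
      then show "d * (1 + 2 * K) \<le> e" by (simp add: pos_le_divide_eq add_pos_nonneg)
    qed (use e in \<open>auto simp: d_def\<close>)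
    have "eventually (\<lambda>n. prob (dev d (X n) Y) < \<eta> / 2) sequentially"
      using conv_probD(3)[OF X d(1)] \<eta> by (intro order_tendstoD(2)) auto
    then obtain n0 where n0: "\<And>n. n \<ge> n0 \<Longrightarrow> prob (dev d (X n) Y) < \<eta> / 2" by (auto simp: eventually_sequentially)
    show "\<exists>no. \<forall>n\<ge>no. norm (prob {w \<in> space M. e < \<bar>(X n w)\<^sup>2 - (Y w)\<^sup>2\<bar>} - 0) < \<eta>"
    proof (intro exI[of _ n0] allI impI)
      fix n assume n: "n \<ge> n0"
      have "prob {w \<in> space M. e < \<bar>(X n w)\<^sup>2 - (Y w)\<^sup>2\<bar>} \<le>
        prob ((dev d (X n) Y) \<union> {w \<in> space M. 1 < \<bar>Y w / real K\<bar>})"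
      proof (rule finite_measure_mono)
        show "{w \<in> space M. e < \<bar>(X n w)\<^sup>2 - (Y w)\<^sup>2\<bar>} \<subseteq> (dev d (X n) Y) \<union> {w \<in> space M. 1 < \<bar>Y w / real K\<bar>}"
        proof safe
          fix w assume w: "w \<in> space M" "e < \<bar>(X n w)\<^sup>2 - (Y w)\<^sup>2\<bar>" and "\<not> 1 < \<bar>Y w / real K\<bar>"
          then have Y: "\<bar>Y w\<bar> \<le> K" using K(2) by (simp add: field_simps)
          show "d < \<bar>X n w - Y w\<bar>"
          proof (rule ccontr)
            assume "\<not> ?thesis"
            then have XY: "\<bar>X n w - Y w\<bar> \<le> d" by simp
            have "\<bar>X n w + Y w\<bar> \<le> 1 + 2 * K" using XY d(2) Y by linarith
            then have "\<bar>X n w - Y w\<bar> * \<bar>X n w + Y w\<bar> \<le> d * (1 + 2 * K)" using XY d(1) by (intro mult_mono) auto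
            moreover have "\<bar>(X n w)\<^sup>2 - (Y w)\<^sup>2\<bar> = \<bar>X n w - Y w\<bar> * \<bar>X n w + Y w\<bar>"
              by (simp add: abs_mult[symmetric] power2_eq_square algebra_simps)
            ultimately show False using w(2) d(3) by linarith
          qed
        qed
      qed measurable
      also have "\<dots> \<le> prob (dev d (X n) Y) + prob {w \<in> space M. 1 < \<bar>Y w / real K\<bar>}"
        by (rule measure_Un_le) measurable
      also have "\<dots> < \<eta>" using n0[OF n] K(1) by linarith
      finally show "norm (prob {w \<in> space M. e < \<bar>(X n w)\<^sup>2 - (Y w)\<^sup>2\<bar>} - 0) < \<eta>" by simp
    qed
  qed
qed

context brownian_setup begin

text \<open>The right-hand side is free of \<open>n\<close>. This uniformity allows one approximant
  to be fixed before n tends to infinity.\<close>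

lemma simple_integral_diff_prob:
  assumes si: "simple_integrand M F k s \<xi>" "simple_integrand M F k' s' \<xi>'" and sp: "space M = space N"
    and n: "0 < n" and e: "0 < e" and d: "0 \<le> d"
  shows "prob {w\<in>space N. e < (block_norm n (\<lambda>t. simple_integral W k s \<xi> t w - simple_integral W k' s' \<xi>' t w))\<^sup>2}
    \<le> 16 * d / e + prob {w\<in>space N. d < sqint (\<lambda>u. simple_process k s \<xi> u w - simple_process k' s' \<xi>' u w)}"
proof (rule elementary_range_prob[OF elementary_diff[OF elementary_simple[OF si(1) sp] elementary_simple[OF si(2) sp]]])
  show "AE w in N. continuous_on {0..1} (\<lambda>t. simple_integral W k s \<xi> t w - simple_integral W k' s' \<xi>' t w)"
    using simple_integral_continuous[OF si(1)] simple_integral_continuous[OF si(2)]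
    by eventually_elim (intro continuous_on_diff continuous_path_Icc; simp)
  show "(\<lambda>w. simple_integral W k s \<xi> t w - simple_integral W k' s' \<xi>' t w) \<in> borel_measurable N" if "0 \<le> t" for t
    using simple_integral_measurable[OF si(1) sp that] simple_integral_measurable[OF si(2) sp that] by simp
qed (use assms in auto)

text \<open>The order of choices is decisive: \<open>m\<close> and \<open>j\<close> depend on the
  tolerances only, then n is large, and \<open>l\<close> is chosen last, depending on n. The drift
  enters through any \<open>D\<close> that is Lipschitz off events \<open>B j\<close> of vanishing
  probability, with a constant depending on \<open>j\<close>.\<close>

lemma block_norm_converges:
  fixes p I D \<sigma> :: "real \<Rightarrow> 'a \<Rightarrow> real"
  assumes sp: "space M = space N" and si: "\<And>m. simple_integrand M F (k m) (s m) (\<xi> m)"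
    and Z: "conv_prob (\<lambda>m w. sqint (\<lambda>u. simple_process (k m) (s m) (\<xi> m) u w - \<sigma> u w)) (\<lambda>_. 0)"
    and J: "conv_prob (\<lambda>m w. SUP t\<in>{0..1}. \<bar>simple_integral W (k m) (s m) (\<xi> m) t w - I t w\<bar>) (\<lambda>_. 0)"
    and \<sigma>: "AE w in N. square_int (\<lambda>u. \<sigma> u w)" and iv: "(\<lambda>w. sqint (\<lambda>u. \<sigma> u w)) \<in> borel_measurable N"
    and I: "AE w in N. continuous_on {0..1} (\<lambda>t. I t w)"
    and p: "\<And>t. 0 \<le> t \<Longrightarrow> p t \<in> borel_measurable N" "AE w in N. continuous_on {0..1} (\<lambda>t. p t w)"
    and pD: "AE w in N. \<forall>t\<in>{0..1}. p t w = D t w + I t w"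
    and B: "\<And>j. B j \<in> sets N" "(\<lambda>j. prob (B j)) \<longlonglongrightarrow> 0"
      "\<And>j. AE w in N. w \<notin> B j \<longrightarrow> (\<forall>u\<in>{0..1}. \<forall>t\<in>{0..1}. \<bar>D t w - D u w\<bar> \<le> K j * \<bar>t - u\<bar>)"
  shows "conv_prob (\<lambda>n w. block_norm n (\<lambda>t. p t w)) (\<lambda>w. sqrt (lam2 * sqint (\<lambda>u. \<sigma> u w)))"
  unfolding conv_prob_def
proof (intro conjI allI impI)
  show mq: "(\<lambda>w. block_norm n (\<lambda>t. p t w)) \<in> borel_measurable N" for n by (rule block_norm_measurable[OF p])
  show ma: "(\<lambda>w. sqrt (lam2 * sqint (\<lambda>u. \<sigma> u w))) \<in> borel_measurable N" using iv by simp
  fix e0 :: real assume "0 < e0"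
  \<comment> \<open>Five errors: the drift, \<open>I\<close> against \<open>J l\<close>,
    \<open>J l\<close> against \<open>J m\<close>, \<open>J m\<close> against its own limit, and
    that limit against the target.\<close>
  define e where "e = e0 / 5"
  have e: "0 < e" "e0 = 5 * e" using \<open>0 < e0\<close> by (auto simp: e_def)
  let ?E = "\<lambda>n. {w \<in> space N. e0 < \<bar>block_norm n (\<lambda>t. p t w) - sqrt (lam2 * sqint (\<lambda>u. \<sigma> u w))\<bar>}"
  let ?H = "\<lambda>m u w. simple_process (k m) (s m) (\<xi> m) u w"
  let ?J = "\<lambda>m t w. simple_integral W (k m) (s m) (\<xi> m) t w"
  let ?Z = "\<lambda>m w. sqint (\<lambda>u. ?H m u w - \<sigma> u w)"
  let ?S = "\<lambda>m w. SUP t\<in>{0..1}. \<bar>?J m t w - I t w\<bar>"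
  note s = simple_integrand_times(1,2)[OF si]
  have Jc: "AE w in N. continuous_on {0..1} (\<lambda>t. ?J m t w)" for m
    using simple_integral_continuous[OF si[of m]] by eventually_elim (rule continuous_path_Icc; simp)
  show "(\<lambda>n. prob (?E n)) \<longlonglongrightarrow> 0"
  proof (rule LIMSEQ_I)
    fix \<eta>0 :: real assume "0 < \<eta>0"
    \<comment> \<open>The exceptional events have total probability below \<open>7 * \<eta>\<close>:
      the comparison of \<open>J l\<close> with \<open>J m\<close> accounts for 3 of these, the
      other four events for one each.\<close>
    define \<eta> where "\<eta> = \<eta>0 / 8"
    have \<eta>: "0 < \<eta>" "\<eta>0 = 8 * \<eta>" using \<open>0 < \<eta>0\<close> by (auto simp: \<eta>_def)
    define d where "d = e\<^sup>2 * \<eta> / 16"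
    have d: "0 < d" "16 * d / e\<^sup>2 = \<eta>" using e \<eta> by (auto simp: d_def)
    \<comment> \<open>The bound \<open>d / 4\<close> makes the energy between \<open>l\<close> and
      \<open>m\<close> at most \<open>d\<close>, through \<open>2 * ?Z l w + 2 * ?Z m w\<close>; the
      bound \<open>e\<^sup>2 / lam2\<close> makes the two limits differ by at most
      \<open>e\<close>.\<close>
    define \<rho> where "\<rho> = min (d / 4) (e\<^sup>2 / lam2)"
    have \<rho>: "0 < \<rho>" "\<rho> \<le> d / 4" "\<rho> \<le> e\<^sup>2 / lam2"
    proof -
      show "0 < \<rho>" using d(1) e lam2_pos by (simp add: \<rho>_def)
      show "\<rho> \<le> d / 4" unfolding \<rho>_def by (rule min.cobounded1)
      show "\<rho> \<le> e\<^sup>2 / lam2" unfolding \<rho>_def by (rule min.cobounded2)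
    qed
    have Zsmall: "eventually (\<lambda>m. prob {w \<in> space N. \<rho> < ?Z m w} < \<eta>) sequentially"
    proof -
      have "eventually (\<lambda>m. prob {w \<in> space N. \<rho> < \<bar>?Z m w - 0\<bar>} < \<eta>) sequentially"
        using conv_probD(3)[OF Z \<rho>(1)] \<eta>(1) by (rule order_tendstoD(2))
      then show ?thesis using sqint_nonneg by simp
    qed
    have mZ: "{w \<in> space N. \<rho> < ?Z m w} \<in> sets N" for m using conv_probD(1)[OF Z, of m] by measurable
    from eventually_happens'[OF sequentially_bot Zsmall]
    obtain m where m: "prob {w \<in> space N. \<rho> < ?Z m w} < \<eta>" by blast
    have "eventually (\<lambda>j. prob (B j) < \<eta>) sequentially" using B(2) \<eta>(1) by (rule order_tendstoD(2))
    from eventually_happens'[OF sequentially_bot this] obtain j where j: "prob (B j) < \<eta>" by blast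
    have "(\<lambda>n. \<bar>K j\<bar> / sqrt (real n)) \<longlonglongrightarrow> 0"
      by (intro tendsto_divide_0[OF tendsto_const] filterlim_at_top_imp_at_infinity
          filterlim_compose[OF sqrt_at_top filterlim_real_sequentially])
    then have ev1: "eventually (\<lambda>n. \<bar>K j\<bar> / sqrt (real n) < e) sequentially" using e(1) by (rule order_tendstoD(2))
    let ?A4 = "\<lambda>n. {w \<in> space N. e < \<bar>block_norm n (\<lambda>t. ?J m t w) - sqrt (lam2 * sqint (\<lambda>u. ?H m u w))\<bar>}"
    note Jm = simple_integral_block_norm_conv_prob[OF si[of m] sp]
    have ev2: "eventually (\<lambda>n. prob (?A4 n) < \<eta>) sequentially"
      using conv_probD(3)[OF Jm e(1)] \<eta>(1) by (rule order_tendstoD(2))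
    have mA4: "?A4 n \<in> sets N" for n using conv_probD(1)[OF Jm, of n] conv_probD(2)[OF Jm] by measurable
    have "eventually (\<lambda>n. \<bar>K j\<bar> / sqrt (real n) < e \<and> prob (?A4 n) < \<eta> \<and> 0 < n) sequentially"
      by (intro eventually_conj ev1 ev2 eventually_gt_at_top)
    then obtain n0 where n0: "\<And>n. n \<ge> n0 \<Longrightarrow> \<bar>K j\<bar> / sqrt (real n) < e \<and> prob (?A4 n) < \<eta> \<and> 0 < n"
      unfolding eventually_sequentially by blast
    show "\<exists>no. \<forall>n\<ge>no. norm (prob (?E n) - 0) < \<eta>0"
    proof (intro exI[of _ n0] allI impI)
      fix n assume "n0 \<le> n"
      with n0 have n: "\<bar>K j\<bar> / sqrt (real n) < e" "prob (?A4 n) < \<eta>" "0 < n" by blast+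
      \<comment> \<open>A uniform error \<open>r\<close> gives range at most \<open>2 * r\<close> on
        each of the n blocks, hence seminorm at most \<open>sqrt n * (2 * r) = e\<close>.\<close>
      define r where "r = e / (2 * sqrt n)"
      have r: "0 < r" using e n by (simp add: r_def)
      have "eventually (\<lambda>l. prob {w \<in> space N. r < \<bar>?S l w - 0\<bar>} < \<eta>) sequentially"
        using conv_probD(3)[OF J r] \<eta>(1) by (rule order_tendstoD(2))
      from eventually_happens'[OF sequentially_bot eventually_conj[OF this Zsmall]]
      obtain l where l: "prob {w \<in> space N. r < \<bar>?S l w\<bar>} < \<eta>" "prob {w \<in> space N. \<rho> < ?Z l w} < \<eta>" by auto
      let ?A2 = "{w \<in> space N. r < \<bar>?S l w\<bar>}"
      let ?A3 = "{w \<in> space N. e\<^sup>2 < (block_norm n (\<lambda>t. ?J l t w - ?J m t w))\<^sup>2}"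
      let ?Am = "{w \<in> space N. \<rho> < ?Z m w}" and ?Al = "{w \<in> space N. \<rho> < ?Z l w}"
      have mA2: "?A2 \<in> sets N" using conv_probD(1)[OF J, of l] by measurable
      have mA3: "?A3 \<in> sets N"
      proof -
        have "(\<lambda>w. block_norm n (\<lambda>t. ?J l t w - ?J m t w)) \<in> borel_measurable N"
        proof (rule block_norm_measurable)
          show "(\<lambda>w. ?J l t w - ?J m t w) \<in> borel_measurable N" if "0 \<le> t" for t
            using simple_integral_measurable[OF si[of l] sp that] simple_integral_measurable[OF si[of m] sp that] by simp
          show "AE w in N. continuous_on {0..1} (\<lambda>t. ?J l t w - ?J m t w)"
            using Jc[of l] Jc[of m] by eventually_elim (rule continuous_on_diff)
        qed
        then show ?thesis by measurable
      qed
      have pA3: "prob ?A3 \<le> 3 * \<eta>"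
      proof -
        \<comment> \<open>The two simple integrands are compared through \<sigma>, to which both are
          close in energy outside events of probability below \<eta>.\<close>
        have "prob {w\<in>space N. d < sqint (\<lambda>u. ?H l u w - ?H m u w)} \<le> prob (?Al \<union> ?Am)"
        proof (rule finite_measure_mono_AE)
          show "AE w in N. w \<in> {w\<in>space N. d < sqint (\<lambda>u. ?H l u w - ?H m u w)} \<longrightarrow> w \<in> ?Al \<union> ?Am"
            using \<sigma>
          proof eventually_elim
            case (elim w)
            have "sqint (\<lambda>u. ?H l u w - ?H m u w) \<le> 2 * ?Z l w + 2 * ?Z m w"
              by (rule sqint_diff_le[OF square_int_simple[OF s] square_int_simple[OF s] elim])
            with \<rho>(2) show ?case by auto
          qed
        qed (use mZ in auto)
        also have "\<dots> \<le> prob ?Al + prob ?Am" by (rule measure_Un_le[OF mZ mZ])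
        finally have "prob {w\<in>space N. d < sqint (\<lambda>u. ?H l u w - ?H m u w)} \<le> 2 * \<eta>" using l(2) m by linarith
        moreover have "prob ?A3 \<le> 16 * d / e\<^sup>2 + prob {w\<in>space N. d < sqint (\<lambda>u. ?H l u w - ?H m u w)}"
          by (rule simple_integral_diff_prob[OF si si sp n(3)]) (use e d in auto)
        ultimately show ?thesis using d(2) by linarith
      qed
      have "prob (?E n)
        \<le> prob (B j \<union> (?A2 \<union> (?A3 \<union> (?A4 n \<union> ?Am))))"
      proof (rule finite_measure_mono_AE)
        show "AE w in N. w \<in> ?E n \<longrightarrow>
          w \<in> B j \<union> (?A2 \<union> (?A3 \<union> (?A4 n \<union> ?Am)))"
          using \<sigma> I p(2) pD B(3)[of j] Jc[of l] Jc[of m]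
        proof eventually_elim
          case (elim w)
          show ?case
          proof (rule impI, rule ccontr)
            assume "w \<in> ?E n"
            then have w: "w \<in> space N" and big: "e0 < \<bar>block_norm n (\<lambda>t. p t w) - sqrt (lam2 * sqint (\<lambda>u. \<sigma> u w))\<bar>" by auto
            assume "w \<notin> B j \<union> (?A2 \<union> (?A3 \<union> (?A4 n \<union> ?Am)))"
            with w have nB: "w \<notin> B j" and n2: "\<bar>?S l w\<bar> \<le> r" and n3: "(block_norm n (\<lambda>t. ?J l t w - ?J m t w))\<^sup>2 \<le> e\<^sup>2"
              and n4: "\<bar>block_norm n (\<lambda>t. ?J m t w) - sqrt (lam2 * sqint (\<lambda>u. ?H m u w))\<bar> \<le> e" and n5: "?Z m w \<le> \<rho>"
              by auto
            have cD: "continuous_on {0..1} (\<lambda>t. p t w - I t w)" by (intro continuous_on_diff elim)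
            note bd = continuous_bounded_Icc
            have bI: "bounded ((\<lambda>t. I t w) ` {0..1})" "bounded ((\<lambda>t. p t w) ` {0..1})"
              "bounded ((\<lambda>t. ?J l t w) ` {0..1})" "bounded ((\<lambda>t. ?J m t w) ` {0..1})"
              "bounded ((\<lambda>t. p t w - I t w) ` {0..1})" "bounded ((\<lambda>t. ?J l t w - I t w) ` {0..1})"
              "bounded ((\<lambda>t. I t w - ?J l t w) ` {0..1})" "bounded ((\<lambda>t. ?J l t w - ?J m t w) ` {0..1})"
              by (rule bd, (rule elim continuous_on_diff)+)+
            have d1: "block_norm n (\<lambda>t. p t w - I t w) \<le> e"
            proof -
              have "block_norm n (\<lambda>t. p t w - I t w) \<le> sqrt n * (\<bar>K j\<bar> / n)"
              proof (rule block_norm_le[OF _ bI(5)])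
                fix i assume i: "i < n"
                show "osc (\<lambda>t. p t w - I t w) (block n i) \<le> \<bar>K j\<bar> / n"
                proof (rule osc_least)
                  fix u t assume ut: "u \<in> block n i" "t \<in> block n i"
                  then have ut01: "u \<in> {0..1}" "t \<in> {0..1}" using block_subset[OF i] by blast+
                  have "\<bar>t - u\<bar> \<le> 1 / n" using ut by (auto simp: add_divide_distrib abs_le_iff)
                  then have "\<bar>K j\<bar> * \<bar>t - u\<bar> \<le> \<bar>K j\<bar> * (1 / n)" by (intro mult_left_mono) auto
                  moreover have "\<bar>D t w - D u w\<bar> \<le> K j * \<bar>t - u\<bar>" using elim(5) nB ut01 by blast
                  moreover have "K j * \<bar>t - u\<bar> \<le> \<bar>K j\<bar> * \<bar>t - u\<bar>" by (intro mult_right_mono) auto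
                  moreover have "p t w = D t w + I t w" "p u w = D u w + I u w" using elim(4) ut01 by blast+
                  ultimately show "p t w - I t w - (p u w - I u w) \<le> \<bar>K j\<bar> / n" by simp
                qed (use block_nonempty in auto)
              qed auto
              also have "\<dots> = \<bar>K j\<bar> / sqrt n"
              proof -
                have "real n = sqrt n * sqrt n" "sqrt n > 0" using n(3) by auto
                then show ?thesis by (metis nonzero_mult_divide_mult_cancel_left less_irrefl times_divide_eq_right)
              qed
              finally show ?thesis using n(1) by linarith
            qed
            have d2: "block_norm n (\<lambda>t. I t w - ?J l t w) \<le> e"
            proof -
              have bdd: "bdd_above ((\<lambda>t. \<bar>?J l t w - I t w\<bar>) ` {0..1})"
                using bI(6) by (auto simp: bounded_iff bdd_above_def)
              have pt: "\<bar>I t w - ?J l t w\<bar> \<le> r" if "t \<in> {0..1}" for t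
                using cSUP_upper[OF that bdd] n2 by (simp add: abs_minus_commute)
              have "block_norm n (\<lambda>t. I t w - ?J l t w) \<le> sqrt n * (2 * r)"
              proof (rule block_norm_le[OF _ bI(7)])
                fix i assume i: "i < n"
                show "osc (\<lambda>t. I t w - ?J l t w) (block n i) \<le> 2 * r"
                proof (rule osc_le_two_sup)
                  fix t assume "t \<in> block n i"
                  then have "t \<in> {0..1}" using block_subset[OF i] by blast
                  then show "\<bar>I t w - ?J l t w\<bar> \<le> r" by (rule pt)
                qed (use block_nonempty in auto)
              qed (use r in auto)
              also have "\<dots> = e" using n(3) by (simp add: r_def)
              finally show ?thesis .
            qed
            have d3: "block_norm n (\<lambda>t. ?J l t w - ?J m t w) \<le> e"
              using n3 e(1) by (intro power2_le_imp_le[OF n3]) auto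
            have d5: "\<bar>sqrt (lam2 * sqint (\<lambda>u. ?H m u w)) - sqrt (lam2 * sqint (\<lambda>u. \<sigma> u w))\<bar> \<le> e"
            proof -
              have "\<bar>sqrt (lam2 * sqint (\<lambda>u. ?H m u w)) - sqrt (lam2 * sqint (\<lambda>u. \<sigma> u w))\<bar> =
                sqrt lam2 * \<bar>sqrt (sqint (\<lambda>u. ?H m u w)) - sqrt (sqint (\<lambda>u. \<sigma> u w))\<bar>"
                using lam2_pos by (simp add: real_sqrt_mult right_diff_distrib[symmetric] abs_mult)
              also have "\<dots> \<le> sqrt lam2 * sqrt (?Z m w)"
                using lam2_pos by (intro mult_left_mono sqrt_sqint_diff square_int_simple s elim) auto
              also have "\<dots> = sqrt (lam2 * ?Z m w)" by (simp add: real_sqrt_mult)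
              also have "\<dots> \<le> sqrt (e\<^sup>2)"
              proof -
                have "?Z m w \<le> e\<^sup>2 / lam2" using n5 \<rho>(3) by linarith
                then have "lam2 * ?Z m w \<le> e\<^sup>2" using lam2_pos by (simp add: field_simps)
                then show ?thesis by (rule real_sqrt_le_mono)
              qed
              finally show ?thesis using e(1) by simp
            qed
            have split: "\<bar>block_norm n (\<lambda>t. p t w) - block_norm n (\<lambda>t. ?J m t w)\<bar> \<le> 3 * e"
            proof -
              have t1: "\<bar>block_norm n (\<lambda>t. p t w) - block_norm n (\<lambda>t. I t w)\<bar> \<le> block_norm n (\<lambda>t. p t w - I t w)"
                using block_norm_diff[OF bI(2) bI(1), of n] by linarith
              have t2: "\<bar>block_norm n (\<lambda>t. I t w) - block_norm n (\<lambda>t. ?J l t w)\<bar> \<le> block_norm n (\<lambda>t. I t w - ?J l t w)"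
                using block_norm_diff[OF bI(1) bI(3), of n] by linarith
              have t3: "\<bar>block_norm n (\<lambda>t. ?J l t w) - block_norm n (\<lambda>t. ?J m t w)\<bar> \<le> block_norm n (\<lambda>t. ?J l t w - ?J m t w)"
                using block_norm_diff[OF bI(3) bI(4), of n] by linarith
              from t1 t2 t3 d1 d2 d3 show ?thesis by linarith
            qed
            show False using split n4 d5 big e(2) e(1) by linarith
          qed
        qed
      qed (use B(1) mA2 mA3 mA4 mZ in auto)
      also have "\<dots> \<le> prob (B j) + (prob ?A2 + (prob ?A3 + (prob (?A4 n) + prob ?Am)))"
        by (intro order_trans[OF measure_Un_le add_mono] order_refl sets.Un B(1) mA2 mA3 mA4 mZ)
      also have "\<dots> < \<eta>0" using j l(1) pA3 n(2) m \<eta> by linarith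
      finally show "norm (prob (?E n) - 0) < \<eta>0"
        by simp
    qed
  qed
qed

end

section \<open>Path regularity and conclusion\<close>

text \<open>The section map into the product is measurable, since the preimage of a generating
  rectangle is either the Borel set in its time factor or empty.\<close>

lemma predictable_path_measurable:
  assumes "predictable F X" and "w \<in> space (F 0)" and sp: "\<And>t. space (F t) = space (F 0)"
  shows "set_borel_measurable lborel {0..t} (\<lambda>u. X u w)"
proof -
  have pair: "(\<lambda>u. (u, w)) \<in> restrict_space borel {0..} \<rightarrow>\<^sub>M predictable_sigma F"
    unfolding predictable_sigma_def
  proof (rule measurable_measure_of)
    show "{{0} \<times> A |A. A \<in> sets (F 0)} \<union> {{s<..t} \<times> A |s t A. 0 \<le> s \<and> s \<le> t \<and> A \<in> sets (F s)} \<subseteq> Pow ({0..} \<times> space (F 0))"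
      using sets.sets_into_space sp by fastforce
    show "(\<lambda>u. (u, w)) \<in> space (restrict_space borel {0..}) \<rightarrow> {0..} \<times> space (F 0)"
      using assms(2) by (auto simp: space_restrict_space)
    fix y assume "y \<in> {{0} \<times> A |A. A \<in> sets (F 0)} \<union> {{s<..t} \<times> A |s t A. 0 \<le> s \<and> s \<le> t \<and> A \<in> sets (F s)}"
    then obtain B A where y: "y = B \<times> A" and B: "B \<in> sets borel" by auto
    have "(\<lambda>u. (u, w)) -` y \<inter> space (restrict_space borel {0..}) = (if w \<in> A then B \<inter> {0..} else {})"
      by (auto simp: y space_restrict_space)
    also have "\<dots> \<in> sets (restrict_space borel {0..})"
      using B by (auto simp: sets_restrict_space)
    finally show "(\<lambda>u. (u, w)) -` y \<inter> space (restrict_space borel {0..}) \<in> sets (restrict_space borel {0..})" .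
  qed
  have "(\<lambda>u. X u w) \<in> borel_measurable (restrict_space borel {0..})"
    using measurable_compose[OF pair assms(1)[unfolded predictable_def]] by simp
  then have "(\<lambda>u. indicator {0..} u *\<^sub>R X u w) \<in> borel_measurable borel"
    by (subst (asm) borel_measurable_restrict_space_iff) auto
  then have "(\<lambda>u. indicator {0..t} u *\<^sub>R (indicator {0..} u *\<^sub>R X u w)) \<in> borel_measurable borel"
    by measurable
  moreover have "(\<lambda>u. indicator {0..t} u *\<^sub>R (indicator {0..} u *\<^sub>R X u w)) = (\<lambda>u. indicator {0..t} u *\<^sub>R X u w)"
    by (auto simp: indicator_def)
  ultimately show ?thesis by (simp add: set_borel_measurable_def)
qed

lemma bounded_integral_lipschitz:
  fixes f :: "real \<Rightarrow> real"
  assumes m: "set_borel_measurable lborel {0..1} f" and K: "\<And>u. u \<in> {0..1} \<Longrightarrow> \<bar>f u\<bar> \<le> K"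
    and st: "s \<in> {0..1}" "t \<in> {0..1}"
  shows "\<bar>(LBINT u:{0..t}. f u) - (LBINT u:{0..s}. f u)\<bar> \<le> K * \<bar>t - s\<bar>"
proof -
  have K0: "0 \<le> K" using K[of 0] by auto
  have int: "set_integrable lborel A f" if "A \<in> sets borel" "A \<subseteq> {0..1}" for A
  proof -
    have "set_integrable lborel {0..1} f" unfolding set_integrable_def
    proof (rule Bochner_Integration.integrable_bound)
      show "integrable lborel (\<lambda>u. K * indicator {0..1::real} u)" by (intro integrable_mult_right integrable_real_indicator) auto
      show "AE u in lborel. norm (indicator {0..1} u *\<^sub>R f u) \<le> norm (K * indicator {0..1} u)"
        using K K0 by (intro AE_I2) (auto simp: indicator_def)
    qed (use m in \<open>simp add: set_borel_measurable_def\<close>)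
    then show ?thesis by (rule set_integrable_subset) (use that in auto)
  qed
  have *: "\<bar>(LBINT u:{0..t}. f u) - (LBINT u:{0..s}. f u)\<bar> \<le> K * (t - s)" if st: "0 \<le> s" "s \<le> t" "t \<le> 1" for s t
  proof -
    have "{0..t} = {0..s} \<union> {s<..t}" using st by auto
    then have "(LBINT u:{0..t}. f u) = (LBINT u:{0..s}. f u) + (LBINT u:{s<..t}. f u)"
      using st by (simp only:) (rule set_integral_Un; auto intro!: int)
    moreover have "norm (LBINT u:{s<..t}. f u) \<le> (LBINT u:{s<..t}. K)"
      unfolding set_lebesgue_integral_def
    proof (rule Bochner_Integration.integral_norm_bound_integral)
      show "integrable lborel (\<lambda>u. indicator {s<..t} u *\<^sub>R f u)"
      proof -
        have "{s<..t} \<subseteq> {0..1}" using st by auto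
        with int[of "{s<..t}"] show ?thesis by (simp add: set_integrable_def)
      qed
      show "integrable lborel (\<lambda>u. indicator {s<..t} u *\<^sub>R K)"
        using st by (intro integrable_scaleR_left integrable_real_indicator) auto
      show "norm (indicator {s<..t} u *\<^sub>R f u) \<le> indicator {s<..t} u *\<^sub>R K" for u
        using K[of u] st by (auto simp: indicator_def)
    qed
    moreover have "(LBINT u:{s<..t}. K) = K * (t - s)" using st by (simp add: set_lebesgue_integral_def)
    ultimately show ?thesis by simp
  qed
  show ?thesis using *[of s t] *[of t s] st by (cases "s \<le> t") (auto simp: abs_minus_commute)
qed

text \<open>Adding 1 after the floor keeps the grid time strictly to the right of \<open>t\<close>
  even if \<open>t\<close> is a grid point, as the filter \<open>at_right t\<close> requires;
  \<open>Suc n\<close> avoids division by zero.\<close>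

lemma right_grid_tendsto:
  assumes "0 \<le> t"
  shows "filterlim (\<lambda>n. (real (nat \<lfloor>real (Suc n) * t\<rfloor>) + 1) / real (Suc n)) (at_right t) sequentially"
proof -
  let ?g = "\<lambda>n. (real (nat \<lfloor>real (Suc n) * t\<rfloor>) + 1) / real (Suc n)"
  have b: "t < ?g n" "?g n \<le> t + 1 / real (Suc n)" for n
  proof -
    have "0 \<le> real (Suc n) * t" using assms by simp
    then have "real (Suc n) * t < real (nat \<lfloor>real (Suc n) * t\<rfloor>) + 1" "real (nat \<lfloor>real (Suc n) * t\<rfloor>) \<le> real (Suc n) * t" by linarith+
    note f = this
    show "t < ?g n"
      using f(1) by (simp add: pos_less_divide_eq mult.commute del: of_nat_Suc)
    have "real (nat \<lfloor>real (Suc n) * t\<rfloor>) + 1 \<le> (t + 1 / real (Suc n)) * real (Suc n)"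
      unfolding distrib_right using f(2) by (simp add: mult.commute del: of_nat_Suc)
    then show "?g n \<le> t + 1 / real (Suc n)"
      by (subst pos_divide_le_eq) (auto simp del: of_nat_Suc)
  qed
  have "(\<lambda>n. ?g n) \<longlonglongrightarrow> t"
  proof (rule tendsto_sandwich[where f = "\<lambda>_. t" and h = "\<lambda>n. t + 1 / real (Suc n)"])
    show "(\<lambda>n. t + 1 / real (Suc n)) \<longlonglongrightarrow> t"
      using tendsto_add[OF tendsto_const LIMSEQ_Suc[OF lim_1_over_n], of t] by simp
  qed (use b in \<open>auto intro!: always_eventually less_imp_le simp del: of_nat_Suc\<close>)
  then show ?thesis using b(1) b(1)[THEN less_imp_neq, THEN not_sym] by (auto simp: filterlim_at intro!: always_eventually simp del: of_nat_Suc)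
qed

text \<open>Right continuity makes the path the limit of its values at grid times just after
  \<open>t\<close>. For each n these take countably many times, hence are jointly measurable, and so
  is their pointwise \<open>lim\<close>, whatever its value on the exceptional paths.\<close>

lemma cadlag_measurable_version:
  assumes X: "\<And>t. 0 \<le> t \<Longrightarrow> X t \<in> borel_measurable N" and c: "cadlag N X"
  obtains Y where "(\<lambda>(w, t). Y t w) \<in> borel_measurable (N \<Otimes>\<^sub>M lborel)" "AE w in N. \<forall>t\<ge>0. X t w = Y t w"
proof -
  define Xn where "Xn n t w = X ((real (nat \<lfloor>real (Suc n) * t\<rfloor>) + 1) / real (Suc n)) w" for n t w
  define Y where "Y t w = lim (\<lambda>n. Xn n t w)" for t w
  have mX: "(\<lambda>(w, t). Xn n t w) \<in> borel_measurable (N \<Otimes>\<^sub>M lborel)" for n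
  proof -
    have "(\<lambda>x. X ((real (nat \<lfloor>real (Suc n) * snd x\<rfloor>) + 1) / real (Suc n)) (fst x)) \<in> borel_measurable (N \<Otimes>\<^sub>M lborel)"
    proof (rule measurable_compose_countable[where f = "\<lambda>i x. X ((real i + 1) / real (Suc n)) (fst x)"])
      show "(\<lambda>x. X ((real i + 1) / real (Suc n)) (fst x)) \<in> borel_measurable (N \<Otimes>\<^sub>M lborel)" for i
        by (rule measurable_compose[OF measurable_fst X]) simp
      show "(\<lambda>x. nat \<lfloor>real (Suc n) * snd x\<rfloor>) \<in> N \<Otimes>\<^sub>M lborel \<rightarrow>\<^sub>M count_space UNIV" by measurable
    qed
    then show ?thesis by (simp add: Xn_def case_prod_beta)
  qed
  show ?thesis
  proof (rule that)
    have "(\<lambda>x. lim (\<lambda>n. (\<lambda>(w, t). Xn n t w) x)) \<in> borel_measurable (N \<Otimes>\<^sub>M lborel)"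
      by (rule borel_measurable_lim_metric[OF mX])
    then show "(\<lambda>(w, t). Y t w) \<in> borel_measurable (N \<Otimes>\<^sub>M lborel)" by (simp add: Y_def case_prod_beta)
    show "AE w in N. \<forall>t\<ge>0. X t w = Y t w"
      using c[unfolded cadlag_def]
    proof eventually_elim
      case (elim w)
      show ?case
      proof (intro allI impI)
        fix t :: real assume t: "0 \<le> t"
        then have "((\<lambda>u. X u w) \<longlongrightarrow> X t w) (at_right t)" using elim by blast
        from filterlim_compose[OF this right_grid_tendsto[OF t]]
        have "(\<lambda>n. Xn n t w) \<longlonglongrightarrow> X t w" by (simp add: Xn_def)
        then show "X t w = Y t w" unfolding Y_def by (rule limI[symmetric])
      qed
    qed
  qed
qed

lemma (in brownian_setup) cadlag_square_int:
  assumes X: "\<And>t. 0 \<le> t \<Longrightarrow> X t \<in> borel_measurable N" and c: "cadlag N X"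
    and i: "AE w in N. set_integrable lborel {0..1} (\<lambda>u. (X u w)\<^sup>2)"
  shows "AE w in N. square_int (\<lambda>u. X u w)" "(\<lambda>w. sqint (\<lambda>u. X u w)) \<in> borel_measurable N"
proof -
  obtain Y where Y: "(\<lambda>(w, t). Y t w) \<in> borel_measurable (N \<Otimes>\<^sub>M lborel)" "AE w in N. \<forall>t\<ge>0. X t w = Y t w"
    by (rule cadlag_measurable_version[OF X c])
  show "AE w in N. square_int (\<lambda>u. X u w)"
    using Y(2) i AE_space
  proof eventually_elim
    case (elim w)
    have "(\<lambda>u. Y u w) \<in> borel_measurable lborel"
      using measurable_compose[OF measurable_Pair1'[OF elim(3)] Y(1)] by simp
    then have "(\<lambda>u. indicator {0..1} u *\<^sub>R Y u w) \<in> borel_measurable lborel" by measurable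
    moreover have "(\<lambda>u. indicator {0..1} u *\<^sub>R Y u w) = (\<lambda>u. indicator {0..1} u *\<^sub>R X u w)"
      using elim(1) by (auto simp: indicator_def)
    ultimately show ?case using elim(2) by (simp add: square_int_def set_borel_measurable_def)
  qed
  have "(\<lambda>w. \<integral>u. indicator {0..1} u *\<^sub>R (Y u w)\<^sup>2 \<partial>lborel) \<in> borel_measurable N"
  proof (rule lborel.borel_measurable_lebesgue_integral)
    have "(\<lambda>x. indicator {0..1} (snd x) *\<^sub>R ((\<lambda>(w, t). Y t w) x)\<^sup>2) \<in> borel_measurable (N \<Otimes>\<^sub>M lborel)"
      using Y(1) by measurable
    then show "(\<lambda>(w, u). indicator {0..1} u *\<^sub>R (Y u w)\<^sup>2) \<in> borel_measurable (N \<Otimes>\<^sub>M lborel)"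
      by (simp add: case_prod_beta)
  qed
  \<comment> \<open>\<open>AE_limit_measurable\<close> is used with a constant sequence, to pass
    from the energy of the version \<open>Y\<close> to that of \<open>X\<close>.\<close>
  then show "(\<lambda>w. sqint (\<lambda>u. X u w)) \<in> borel_measurable N"
  proof (rule AE_limit_measurable)
    show "AE w in N. (\<lambda>l::nat. \<integral>u. indicator {0..1} u *\<^sub>R (Y u w)\<^sup>2 \<partial>lborel) \<longlonglongrightarrow> sqint (\<lambda>u. X u w)"
      using Y(2)
    proof eventually_elim
      case (elim w)
      have "(\<lambda>u. indicator {0..1} u *\<^sub>R (Y u w)\<^sup>2) = (\<lambda>u. indicator {0..1} u *\<^sub>R (X u w)\<^sup>2)"
        using elim by (auto simp: indicator_def)
      then show ?case unfolding set_lebesgue_integral_def by simp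
    qed
  qed
qed

section \<open>Passage to the completed space and conclusion\<close>

lemma brownian_setup_completion:
  assumes "filtered_prob_space M F" "brownian_motion M F W"
  shows "brownian_setup (completion M) F W"
proof -
  interpret filtered_prob_space M F by fact
  interpret C: prob_space "completion M" by (rule prob_space_completion)
  have bm: "adapted F W" "continuous_process M W"
    "\<And>s t. 0 \<le> s \<Longrightarrow> s < t \<Longrightarrow> distributed M lborel (\<lambda>w. W t w - W s w) (normal_density 0 (sqrt (t - s)))"
    "\<And>s t. 0 \<le> s \<Longrightarrow> s < t \<Longrightarrow> indep_set (sets (F s)) {(\<lambda>w. W t w - W s w) -` B \<inter> space M | B. B \<in> sets borel}"
    using assms(2) by (auto simp: brownian_motion_def)
  show ?thesis
  proof
    show "Z \<in> null_sets (completion M) \<Longrightarrow> A \<subseteq> Z \<Longrightarrow> A \<in> sets (completion M)" for Z A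
      by (rule completion.complete)
    show "space (F t) = space (completion M)" for t by (simp add: space_F)
    show "s \<le> t \<Longrightarrow> sets (F s) \<subseteq> sets (F t)" for s t by (rule sets_F_mono)
    show "sets (F t) \<subseteq> sets (completion M)" for t using sets_F_subset[of t] by auto
    show "0 \<le> t \<Longrightarrow> W t \<in> borel_measurable (F t)" for t using bm(1) by (simp add: adapted_def)
    show "AE w in completion M. continuous_on {0..} (\<lambda>t. W t w)"
      using bm(2) unfolding continuous_process_def by (rule AE_completion)
    fix s t :: real assume st: "0 \<le> s" "s < t"
    note D = bm(3)[OF st]
    show "distributed (completion M) lborel (\<lambda>w. W t w - W s w) (normal_density 0 (sqrt (t - s)))"
      using D distr_completion[OF distributed_measurable[OF D]] measurable_completion[OF distributed_measurable[OF D]]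
      by (simp add: distributed_def)
    fix A and B :: "real set" assume AB: "A \<in> sets (F s)" "B \<in> sets borel"
    have mD: "(\<lambda>w. W t w - W s w) \<in> borel_measurable M" using distributed_measurable[OF D] by simp
    have e: "(\<lambda>w. W t w - W s w) -` B \<inter> space M \<in> sets M" by (rule measurable_sets[OF mD AB(2)])
    have A: "A \<in> sets M" using AB(1) sets_F_subset by blast
    have "prob (A \<inter> ((\<lambda>w. W t w - W s w) -` B \<inter> space M)) = prob A * prob ((\<lambda>w. W t w - W s w) -` B \<inter> space M)"
      by (rule indep_setD[OF bm(4)[OF st] AB(1)]) (use AB(2) in blast)
    \<comment> \<open>Both events belong to \<open>sets M\<close>, where the completed measure
      agrees with the original one.\<close>
    then show "C.prob (A \<inter> ((\<lambda>w. W t w - W s w) -` B \<inter> space (completion M))) =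
      C.prob A * C.prob ((\<lambda>w. W t w - W s w) -` B \<inter> space (completion M))"
      using A e by simp
  qed
qed

theorem theorem1:
  fixes M :: "'a measure" and F :: "real \<Rightarrow> 'a measure"
    and W \<mu> \<sigma> p I :: "real \<Rightarrow> 'a \<Rightarrow> real"
  assumes "filtered_prob_space M F"
    and "brownian_motion M F W"
    and "predictable F \<mu>" and "locally_bounded M F \<mu>"
    and "adapted F \<sigma>" and "cadlag M \<sigma>"
    and "ito_integral M F W \<sigma> I"
    and "adapted F p"
    and "AE \<omega> in M. \<forall>t\<ge>0. p t \<omega> = p 0 \<omega> + (LBINT u:{0..t}. \<mu> u \<omega>) + I t \<omega>"
  shows "tendsto_in_prob M (realized_range_variance (range_moment M W 2) p) (integrated_variance \<sigma>)"
proof -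
  interpret filtered_prob_space M F by fact
  interpret C: brownian_setup "completion M" F W by (rule brownian_setup_completion) fact+
  have tip: "tendsto_in_prob M X Y \<longleftrightarrow> C.conv_prob X Y" for X Y
    by (simp add: tendsto_in_prob_def C.conv_prob_def)
  \<comment> \<open>The real power and the square are identified on continuous paths, where the
    range is nonnegative.\<close>
  have lam2: "range_moment M W 2 = C.lam2"
    unfolding range_moment_def C.lam2_def path_range_osc
  proof (rule integral_cong_AE)
    show m: "(\<lambda>w. (osc (\<lambda>t. W t w) {0..1})\<^sup>2) \<in> borel_measurable (completion M)"
      "(\<lambda>w. osc (\<lambda>t. W t w) {0..1} powr 2) \<in> borel_measurable (completion M)"
      using C.osc_W_measurable[of 0 1] by measurable
    show "AE w in completion M. osc (\<lambda>t. W t w) {0..1} powr 2 = (osc (\<lambda>t. W t w) {0..1})\<^sup>2"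
      using C.W_cont_Icc[of 0 1, OF order_refl]
    proof eventually_elim
      case (elim w)
      then have "0 \<le> osc (\<lambda>t. W t w) {0..1}" by (intro osc_nonneg continuous_bounded_Icc) auto
      then show ?case by simp
    qed
  qed
  obtain k s \<xi> where si: "\<And>m. simple_integrand M F (k m) (s m) (\<xi> m)"
    and conv: "\<And>T. 0 \<le> T \<Longrightarrow> tendsto_in_prob M (\<lambda>m w. LBINT u:{0..T}. (simple_process (k m) (s m) (\<xi> m) u w - \<sigma> u w)\<^sup>2) (\<lambda>w. 0)"
      "\<And>T. 0 \<le> T \<Longrightarrow> tendsto_in_prob M (\<lambda>m w. SUP t\<in>{0..T}. \<bar>simple_integral W (k m) (s m) (\<xi> m) t w - I t w\<bar>) (\<lambda>w. 0)"
    using assms(7) unfolding ito_integral_def by blast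
  have int: "AE w in M. \<forall>T\<ge>0. set_integrable lborel {0..T} (\<lambda>u. (\<sigma> u w)\<^sup>2)" and Ic: "AE w in M. continuous_on {0..} (\<lambda>t. I t w)"
    using assms(7) by (auto simp: ito_integral_def continuous_process_def)
  have \<sigma>m: "\<sigma> t \<in> borel_measurable (completion M)" if "0 \<le> t" for t
    using assms(5) that C.F_measurable by (auto simp: adapted_def)
  have pm: "p t \<in> borel_measurable (completion M)" if "0 \<le> t" for t
    using assms(8) that C.F_measurable by (auto simp: adapted_def)
  have cad: "cadlag (completion M) \<sigma>"
    using assms(6) unfolding cadlag_def by (rule AE_completion)
  have int1: "AE w in completion M. set_integrable lborel {0..1} (\<lambda>u. (\<sigma> u w)\<^sup>2)"
    using AE_completion[OF int] by eventually_elim simp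
  note \<sigma> = C.cadlag_square_int[OF \<sigma>m cad int1]
  obtain T :: "nat \<Rightarrow> 'a \<Rightarrow> real" and K :: "nat \<Rightarrow> real" where TK:
    "\<forall>n. stopping_time F (T n) \<and> (\<forall>w\<in>space M. 0 \<le> T n w)"
    "AE w in M. incseq (\<lambda>n. T n w) \<and> filterlim (\<lambda>n. T n w) at_top sequentially"
    "\<forall>n. AE w in M. 0 < T n w \<longrightarrow> (\<forall>t\<ge>0. \<bar>\<mu> (min t (T n w)) w\<bar> \<le> K n)"
    using assms(4) unfolding locally_bounded_def by (elim exE conjE) (rule that)
  have T: "\<And>n. stopping_time F (T n)"
    "AE w in M. filterlim (\<lambda>n. T n w) at_top sequentially"
    "\<And>n. AE w in M. 0 < T n w \<longrightarrow> (\<forall>t\<ge>0. \<bar>\<mu> (min t (T n w)) w\<bar> \<le> K n)"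
    using TK by auto
  let ?D = "\<lambda>t w. p 0 w + (LBINT u:{0..t}. \<mu> u w)"
  \<comment> \<open>Off \<open>B j\<close> the stopping time exceeds 1, so it is positive and
    stopping leaves the drift on the unit interval unchanged; there \<open>K j\<close> bounds
    it.\<close>
  define B where "B j = {w \<in> space M. T j w \<le> 1}" for j
  have Bs: "B j \<in> sets (completion M)" for j
  proof -
    have "{w \<in> space (F 1). T j w \<le> 1} \<in> sets (F 1)" using T(1)[of j] by (auto simp: stopping_time_def pred_def)
    then show ?thesis using C.F_sub[of 1] by (auto simp: B_def space_F)
  qed
  have Blim: "(\<lambda>j. C.prob (B j)) \<longlonglongrightarrow> 0"
  proof -
    have "C.conv_prob (\<lambda>j. indicator (B j)) (\<lambda>_. 0)"
    proof (rule C.conv_prob_AE)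
      show "AE w in completion M. (\<lambda>j. indicator (B j) w :: real) \<longlonglongrightarrow> 0"
        using AE_completion[OF T(2)]
      proof eventually_elim
        case (elim w)
        then have "eventually (\<lambda>j. 1 < T j w) sequentially" by (simp add: filterlim_at_top_dense)
        then have "eventually (\<lambda>j. (indicator (B j) w :: real) = 0) sequentially"
          by eventually_elim (simp add: B_def)
        then show ?case by (rule tendsto_eventually)
      qed
    qed (use Bs in auto)
    from C.conv_probD(3)[OF this, of "1 / 2"] have "(\<lambda>j. C.prob {w \<in> space M. 1 / 2 < \<bar>indicator (B j) w :: real\<bar>}) \<longlonglongrightarrow> 0" by simp
    \<comment> \<open>An indicator exceeds 1/2 exactly on its set, so convergence in probability of
      the indicators says that the probabilities of \<open>B j\<close> vanish.\<close>
    moreover have "{w \<in> space M. 1 / 2 < \<bar>indicator (B j) w :: real\<bar>} = B j" for j by (auto simp: B_def indicator_def)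
    ultimately show ?thesis by simp
  qed
  have lip: "AE w in completion M. w \<notin> B j \<longrightarrow> (\<forall>u\<in>{0..1}. \<forall>t\<in>{0..1}. \<bar>?D t w - ?D u w\<bar> \<le> K j * \<bar>t - u\<bar>)" for j
    using AE_completion[OF T(3)[of j]] AE_space
  proof eventually_elim
    case (elim w)
    show ?case
    proof (intro impI ballI)
      fix u t :: real assume nB: "w \<notin> B j" and ut: "u \<in> {0..1}" "t \<in> {0..1}"
      then have T1: "1 < T j w" using elim(2) by (auto simp: B_def)
      have m: "set_borel_measurable lborel {0..1} (\<lambda>u. \<mu> u w)"
        by (rule predictable_path_measurable[OF assms(3)]) (use elim(2) space_F in simp_all)
      have "\<bar>\<mu> v w\<bar> \<le> K j" if "v \<in> {0..1}" for v
        using elim(1) T1 that by (auto dest!: spec[of _ v] simp: min_def)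
      from bounded_integral_lipschitz[OF m this ut] show "\<bar>?D t w - ?D u w\<bar> \<le> K j * \<bar>t - u\<bar>" by simp
    qed
  qed
  have pD: "AE w in completion M. \<forall>t\<in>{0..1}. p t w = ?D t w + I t w"
    using AE_completion[OF assms(9)]
  proof eventually_elim
    case (elim w)
    show ?case
    proof
      fix t :: real assume "t \<in> {0..1}"
      then have "0 \<le> t" by simp
      with elim show "p t w = ?D t w + I t w" by blast
    qed
  qed
  have Ic1: "AE w in completion M. continuous_on {0..1} (\<lambda>t. I t w)"
    using AE_completion[OF Ic] by eventually_elim (rule continuous_path_Icc; simp)
  have pc: "AE w in completion M. continuous_on {0..1} (\<lambda>t. p t w)"
  proof -
    \<comment> \<open>The index \<open>j\<close> with \<open>1 < T j w\<close> depends on the path,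
      so the Lipschitz bounds must hold for all \<open>j\<close> off one null set. Continuity of
      \<open>p\<close> then follows from that of the drift and of \<open>I\<close>.\<close>
    have "AE w in completion M. \<forall>j. w \<notin> B j \<longrightarrow> (\<forall>u\<in>{0..1}. \<forall>t\<in>{0..1}. \<bar>?D t w - ?D u w\<bar> \<le> K j * \<bar>t - u\<bar>)"
      using lip by (simp add: AE_all_countable)
    then show ?thesis using AE_completion[OF T(2)] pD Ic1
    proof eventually_elim
      case (elim w)
      have "eventually (\<lambda>j. 1 < T j w) sequentially" using elim(2) by (simp add: filterlim_at_top_dense)
      from eventually_happens'[OF sequentially_bot this] obtain j where "1 < T j w" by blast
      then have "w \<notin> B j" by (simp add: B_def)
      have L: "\<bar>?D t w - ?D u w\<bar> \<le> \<bar>K j\<bar> * \<bar>t - u\<bar>" if "u \<in> {0..1}" "t \<in> {0..1}" for u t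
      proof -
        have "\<bar>?D t w - ?D u w\<bar> \<le> K j * \<bar>t - u\<bar>" using elim(1) \<open>w \<notin> B j\<close> that by blast
        also have "\<dots> \<le> \<bar>K j\<bar> * \<bar>t - u\<bar>" by (intro mult_right_mono) auto
        finally show ?thesis .
      qed
      have "continuous_on {0..1} (\<lambda>t. ?D t w)"
        by (rule lipschitz_on_continuous_on[of "\<bar>K j\<bar>"], rule lipschitz_onI) (use L in \<open>auto simp: dist_real_def\<close>)
      then have "continuous_on {0..1} (\<lambda>t. ?D t w + I t w)" using elim(4) by (rule continuous_on_add)
      then show ?case by (rule continuous_on_eq) (rule elim(3)[THEN bspec, symmetric])
    qed
  qed
  have "C.conv_prob (\<lambda>n w. block_norm n (\<lambda>t. p t w)) (\<lambda>w. sqrt (C.lam2 * sqint (\<lambda>u. \<sigma> u w)))"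
    by (rule C.block_norm_converges[OF space_completion[symmetric] si conv(1)[OF zero_le_one, unfolded tip]
          conv(2)[OF zero_le_one, unfolded tip] \<sigma> Ic1 pm pc pD Bs Blim lip])
  \<comment> \<open>The seminorm was needed for its triangle inequality; squaring returns to the sum
    of squared ranges.\<close>
  from C.conv_prob_square[OF this]
  have "C.conv_prob (\<lambda>n w. (block_norm n (\<lambda>t. p t w))\<^sup>2) (\<lambda>w. C.lam2 * sqint (\<lambda>u. \<sigma> u w))"
    using C.lam2_pos sqint_nonneg by simp
  from C.conv_prob_mult_bounded[OF this, of "\<lambda>_. 1 / C.lam2" "\<bar>1 / C.lam2\<bar>"]
  have "C.conv_prob (\<lambda>n w. 1 / C.lam2 * (block_norm n (\<lambda>t. p t w))\<^sup>2) (\<lambda>w. sqint (\<lambda>u. \<sigma> u w))"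
    using C.lam2_pos by simp
  \<comment> \<open>The blocks are numbered from 1 in the statement and from 0 in
    \<open>block_norm\<close>; for n = 0 both sums are empty.\<close>
  moreover have "realized_range_variance (range_moment M W 2) p = (\<lambda>n w. 1 / C.lam2 * (block_norm n (\<lambda>t. p t w))\<^sup>2)"
    unfolding realized_range_variance_def block_norm_square path_range_osc lam2
    by (intro ext) (simp add: sum.atLeast1_atMost_eq)
  ultimately show ?thesis
    by (simp add: tip integrated_variance_def[abs_def])
qed

end
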